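(* Let $N\ge 2$, $0\le\beta<N$, $q\ge 1$, $0\le\lambda<\lambda_N$, and let $F$ be a fixed function as in the context. Let $p>q\left(1-\frac{\beta}{N}\right)$ (respectively $p\ge q$ if $\beta=0$). Then there exists a constant $C=C(N,p,q,\lambda,\beta)>0$ (for the fixed $F$) such that for all $u\in D^{N,q}(\mathbb{R}^N)$ with $\|F(\nabla u)\|_N\le 1$, $$\int_{\mathbb{R}^N}\frac{\exp\left(\lambda\left(1-\frac{\beta}{N}\right)|u|^{\frac{N}{N-1}}\right)|u|^p}{F^0(x)^\beta}\,dx\le C\,\|u\|_q^{q\left(1-\frac{\beta}{N}\right)}.$$ Moreover, the constant $\lambda_N$ is sharp: if $\lambda\ge\lambda_N$, there is no constant $C$, independent of $u$, for which the inequality $$\int_{\mathbb{R}^N}\frac{\exp\left(\lambda\left(1-\frac{\beta}{N}\right)|u|^{\frac{N}{N-1}}\right)|u|^p}{F^0(x)^\beta}\,dx\le C\,\|u\|_q^{q\left(1-\frac{\beta}{N}\right)}$$ holds for all $u\in D^{N,q}(\mathbb{R}^N)$ with $\|F(\nabla u)\|_N\le 1$.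
   Context: $F:\mathbb{R}^N\to[0,+\infty)$ is a convex function of class $C^2(\mathbb{R}^N\setminus\{0\})$, even and positively homogeneous of degree $1$ (so $F(t\xi)=|t|F(\xi)$ for $t\in\mathbb{R}$, $\xi\in\mathbb{R}^N$), with $F(\xi)>0$ for $\xi\ne0$ and $\mathrm{Hess}(F^2)$ positive definite on $\mathbb{R}^N\setminus\{0\}$. Its polar is $F^0(x)=\sup\{\langle x,\xi\rangle: F(\xi)\le 1\}$. The number $\kappa_N$ is the Lebesgue measure of $W_1=\{x\in\mathbb{R}^N: F^0(x)\le1\}$, and $\lambda_N=N^{\frac{N}{N-1}}\kappa_N^{\frac{1}{N-1}}$. The space $D^{N,q}(\mathbb{R}^N)$ is the completion of $C_0^\infty(\mathbb{R}^N)$ under the norm $\|\nabla u\|_N+\|u\|_q$, where $\|\cdot\|_s$ denotes the $L^s(\mathbb{R}^N)$ norm; $\|F(\nabla u)\|_N=\left(\int_{\mathbb{R}^N}F^N(\nabla u)\,dx\right)^{1/N}$. *)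

theory Defs
  imports "HOL-Analysis.Analysis"
begin

definition dir_deriv :: "real^'n \<Rightarrow> (real^'n \<Rightarrow> real) \<Rightarrow> real^'n \<Rightarrow> real" where
  "dir_deriv v f x = frechet_derivative f (at x) v"

text \<open>\<open>C_on k S f\<close> is membership in \<open>C\<^sup>k(S)\<close>; it is meant for open \<open>S\<close>.\<close>

fun C_on :: "nat \<Rightarrow> (real^'n) set \<Rightarrow> (real^'n \<Rightarrow> real) \<Rightarrow> bool" where
  "C_on 0 S f \<longleftrightarrow> continuous_on S f"
| "C_on (Suc k) S f \<longleftrightarrow> (\<forall>x\<in>S. f differentiable (at x)) \<and> (\<forall>v. C_on k S (dir_deriv v f))"

definition grad :: "(real^'n \<Rightarrow> real) \<Rightarrow> real^'n \<Rightarrow> real^'n" where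
  "grad f x = (\<chi> i. dir_deriv (axis i 1) f x)"

definition hessian :: "(real^'n \<Rightarrow> real) \<Rightarrow> real^'n \<Rightarrow> real^'n^'n" where
  "hessian f x = (\<chi> i j. dir_deriv (axis i 1) (dir_deriv (axis j 1) f) x)"

definition pos_definite :: "real^'n^'n \<Rightarrow> bool" where
  "pos_definite A \<longleftrightarrow> transpose A = A \<and> (\<forall>v. v \<noteq> 0 \<longrightarrow> v \<bullet> (A *v v) > 0)"

definition finsler_function :: "(real^'n \<Rightarrow> real) \<Rightarrow> bool" where
  "finsler_function F \<longleftrightarrow>
     (\<forall>\<xi>. F \<xi> \<ge> 0) \<and> convex_on UNIV F \<and> C_on 2 (UNIV - {0}) F \<and>
     (\<forall>t \<xi>. F (t *\<^sub>R \<xi>) = \<bar>t\<bar> * F \<xi>) \<and>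
     (\<forall>\<xi>. \<xi> \<noteq> 0 \<longrightarrow> F \<xi> > 0) \<and>
     (\<forall>\<xi>. \<xi> \<noteq> 0 \<longrightarrow> pos_definite (hessian (\<lambda>\<eta>. (F \<eta>)\<^sup>2) \<xi>))"

definition polar :: "(real^'n \<Rightarrow> real) \<Rightarrow> real^'n \<Rightarrow> real" where
  "polar F x = (SUP \<xi>\<in>{\<xi>. F \<xi> \<le> 1}. x \<bullet> \<xi>)"

definition kappa :: "(real^'n \<Rightarrow> real) \<Rightarrow> real" where
  "kappa F = measure lebesgue {x. polar F x \<le> 1}"

definition lambda_crit :: "(real^'n \<Rightarrow> real) \<Rightarrow> real" where
  "lambda_crit F = (let N = real CARD('n) in N powr (N / (N - 1)) * kappa F powr (1 / (N - 1)))"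

definition in_Lp :: "real \<Rightarrow> (real^'n \<Rightarrow> 'b::euclidean_space) \<Rightarrow> bool" where
  "in_Lp s f \<longleftrightarrow> f \<in> borel_measurable lebesgue \<and> integrable lebesgue (\<lambda>x. norm (f x) powr s)"

definition Lp_norm :: "real \<Rightarrow> (real^'n \<Rightarrow> 'b::euclidean_space) \<Rightarrow> real" where
  "Lp_norm s f = (\<integral>x. norm (f x) powr s \<partial>lebesgue) powr (1 / s)"

definition test_function :: "(real^'n \<Rightarrow> real) \<Rightarrow> bool" where
  "test_function f \<longleftrightarrow> (\<forall>k. C_on k UNIV f) \<and> compact (closure {x. f x \<noteq> 0})"

text \<open>
  The completion of \<open>C\<^sub>0\<^sup>\<infinity>\<close> under \<open>\<parallel>\<nabla>u\<parallel>\<^sub>N + \<parallel>u\<parallel>\<^sub>q\<close> is realised inside \<open>L\<^sup>q \<times> L\<^sup>N\<close> as the closure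
  of the graph of the gradient: \<open>DNq_gradient q u g\<close> says that \<open>u\<close> belongs to the completion and
  that \<open>g\<close> is its gradient \<open>\<nabla>u\<close>, the limit of the gradients of approximating test functions.
  Such a \<open>g\<close> is the weak gradient of \<open>u\<close>, hence determined by \<open>u\<close> up to a null set, so this
  closure is itself the graph of a map. Functions stand for their almost-everywhere classes.
\<close>

definition DNq_gradient :: "real \<Rightarrow> (real^'n \<Rightarrow> real) \<Rightarrow> (real^'n \<Rightarrow> real^'n) \<Rightarrow> bool" where
  "DNq_gradient q u g \<longleftrightarrow>
     in_Lp q u \<and> in_Lp (real CARD('n)) g \<and>
     (\<exists>\<phi> :: nat \<Rightarrow> real^'n \<Rightarrow> real. (\<forall>k. test_function (\<phi> k)) \<and>
        (\<lambda>k. Lp_norm (real CARD('n)) (\<lambda>x. grad (\<phi> k) x - g x) + Lp_norm q (\<lambda>x. \<phi> k x - u x))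
          \<longlonglongrightarrow> 0)"

definition DNq :: "real \<Rightarrow> (real^'n \<Rightarrow> real) set" where
  "DNq q = {u. \<exists>g. DNq_gradient q u g}"

text \<open>
  The integral takes values in \<open>[0, \<infinity>]\<close>. At \<open>x = 0\<close> the quotient is \<open>0\<close> by the convention
  on division by zero (also for \<open>\<beta> = 0\<close>, since \<open>0 powr 0 = 0\<close>), which concerns a null set only.
\<close>

definition tm_integral ::
  "(real^'n \<Rightarrow> real) \<Rightarrow> real \<Rightarrow> real \<Rightarrow> real \<Rightarrow> (real^'n \<Rightarrow> real) \<Rightarrow> ennreal" where
  "tm_integral F \<beta> p lam u =
     (let N = real CARD('n) in
      \<integral>\<^sup>+x. ennreal (exp (lam * (1 - \<beta> / N) * \<bar>u x\<bar> powr (N / (N - 1))) * \<bar>u x\<bar> powr p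
                    / polar F x powr \<beta>) \<partial>lebesgue)"

end

theory Submission
  imports Defs
begin

text \<open>
  Write \<open>H\<close> for the polar of \<open>F\<close>, \<open>N' = N / (N - 1)\<close> and \<open>\<kappa>\<close> for the measure of the unit ball of \<open>H\<close>.
  Averaging the fundamental theorem of calculus over a ball of \<open>H\<close> bounds \<open>\<bar>u\<bar>\<close> by a mean value plus
  the potential of \<open>F (\<nabla>u)\<close> with kernel \<open>H\<^bsup>1 - N\<^esup> / (N \<kappa>)\<close>. Integrate this over the level set
  \<open>E = {\<bar>u\<bar> > s}\<close>, of measure \<open>m\<close>, and split the kernel at the radius of the ball of measure \<open>m\<close>. By
  Hoelder's inequality the outer part contributes \<open>(ln (Q / m) / \<lambda>\<^sub>N)\<^bsup>1 / N'\<^esup>\<close> pointwise, where \<open>Q\<close> is a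
  bound for \<open>\<integral>\<bar>u\<bar>\<^sup>q\<close>; the inner part contributes a constant after integration over \<open>E\<close>. Hence
  \<open>m \<le> Q exp (- \<lambda>\<^sub>N (s - c)\<^bsup>N'\<^esup>)\<close> with the sharp constant and without rearrangement. Since \<open>H\<^bsup>-\<beta>\<^esup> dx\<close>
  gives \<open>E\<close> at most a multiple of \<open>m\<^bsup>1 - \<beta> / N\<^esup>\<close>, summation over levels yields the inequality for
  \<open>\<lambda> < \<lambda>\<^sub>N\<close>. At \<open>\<lambda>\<^sub>N\<close> it fails for truncated logarithms of a smooth approximation of \<open>H\<close>.
\<close>

section \<open>The polar norm and radial integration\<close>

text \<open>The kernel \<open>H powr (1 - N)\<close> just fails to have finite norm for the exponent
  dual to \<open>N\<close>, so no pointwise bound on \<open>u\<close> exists. Averaging over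
  \<open>E\<close> cures this: near the singularity only the mean over \<open>E\<close> matters, and
  it is of order 1 because \<open>\<rho> powr N\<close> is proportional to \<open>m\<close>. The
  averaging radius is tied to the norm by \<open>\<kappa> * R powr N = Q\<close>; this makes the
  mean value at most 2 for every \<open>u\<close> and \<open>(R / \<rho>) powr N = Q / m\<close>,
  whence the exact power of the norm on the right-hand side. The remaining losses (the additive
  threshold, approximation with energy up to \<open>T > 1\<close>, unit steps between levels) change
  the exponent by lower order terms or by a factor as near to 1 as desired, and the gap below
  \<open>lambda_crit\<close> absorbs them. Small values have no such reserve; there the lower bound
  on \<open>p\<close> makes a dyadic series converge. Failure at \<open>lambda_crit\<close> itself
  is due to the factor \<open>\<bar>u\<bar> powr p\<close>: on the Moser functions the exponential
  balances the weighted volume of a small ball up to a constant, while their height tends to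
  infinity and their norm in the space with exponent \<open>q\<close> stays bounded.\<close>

lemma nn_integral_scale:
  fixes f :: "'a::euclidean_space \<Rightarrow> ennreal"
  assumes [measurable]: "f \<in> borel_measurable borel" and c: "c > 0"
  shows "(\<integral>\<^sup>+x. f x \<partial>lborel) = ennreal (c ^ DIM('a)) * (\<integral>\<^sup>+x. f (c *\<^sub>R x) \<partial>lborel)"
proof -
  have "(\<integral>\<^sup>+x. f x \<partial>lborel) =
      (\<integral>\<^sup>+x. f x \<partial>(density (distr lborel borel (\<lambda>x. 0 + c *\<^sub>R x)) (\<lambda>_. ennreal (\<bar>c\<bar> ^ DIM('a)))))"
    using c by (subst lborel_affine[of c 0]) simp_all
  also have "\<dots> = (\<integral>\<^sup>+x. ennreal (\<bar>c\<bar> ^ DIM('a)) * f (c *\<^sub>R x) \<partial>lborel)"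
    by (simp add: nn_integral_density nn_integral_distr)
  also have "\<dots> = ennreal (c ^ DIM('a)) * (\<integral>\<^sup>+x. f (c *\<^sub>R x) \<partial>lborel)"
    using c by (simp add: nn_integral_cmult)
  finally show ?thesis .
qed

lemma nn_integral_shift:
  fixes f :: "'a::euclidean_space \<Rightarrow> ennreal"
  assumes [measurable]: "f \<in> borel_measurable borel"
  shows "(\<integral>\<^sup>+x. f (a + x) \<partial>lborel) = (\<integral>\<^sup>+x. f x \<partial>lborel)"
proof -
  have "(\<integral>\<^sup>+x. f x \<partial>lborel) = (\<integral>\<^sup>+x. f x \<partial>(distr lborel borel ((+) a)))"
    by (simp add: lborel_distr_plus)
  then show ?thesis
    by (simp add: nn_integral_distr)
qed

locale finsler_norm =
  fixes F :: "real^'n \<Rightarrow> real" and N :: real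
  assumes finsler: "finsler_function F" and dim2: "CARD('n) \<ge> 2" and N_eq: "N = real CARD('n)"
begin

abbreviation H :: "real^'n \<Rightarrow> real" where "H \<equiv> polar F"
abbreviation \<kappa> :: real where "\<kappa> \<equiv> kappa F"

lemma N_ge_2: "N \<ge> 2"
  using dim2 N_eq by simp

section \<open>\<open>F\<close> as a norm on a finite-dimensional space\<close>

lemma F_nonneg: "F x \<ge> 0"
  and F_convex: "convex_on UNIV F"
  and F_scale: "F (t *\<^sub>R x) = \<bar>t\<bar> * F x"
  and F_pos: "x \<noteq> 0 \<Longrightarrow> F x > 0"
  using finsler by (auto simp: finsler_function_def)

lemma F_0 [simp]: "F 0 = 0"
  using F_scale[of 0 0] by simp

lemma F_minus: "F (- x) = F x"
  using F_scale[of "-1" x] by simp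

text \<open>Homogeneity turns convexity at the midpoint of \<open>2 *\<^sub>R x\<close> and
  \<open>2 *\<^sub>R y\<close> into subadditivity.\<close>

lemma F_add: "F (x + y) \<le> F x + F y"
proof -
  have "F ((1 - 1/2) *\<^sub>R (2 *\<^sub>R x) + (1/2) *\<^sub>R (2 *\<^sub>R y)) \<le> (1 - 1/2) * F (2 *\<^sub>R x) + (1/2) * F (2 *\<^sub>R y)"
    by (rule convex_onD[OF F_convex]) auto
  then show ?thesis
    by (simp add: F_scale)
qed

lemma F_continuous: "continuous_on S F"
  using convex_on_continuous[OF open_UNIV F_convex] continuous_on_subset by blast

lemma F_measurable [measurable]: "F \<in> borel_measurable borel"
  using F_continuous by (rule borel_measurable_continuous_onI)

text \<open>Compactness of the Euclidean sphere and homogeneity. The comparison carries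
  integrability from the Euclidean norm, in which the completion is formed, to
  \<open>F\<close>.\<close>

lemma F_bounds: "\<exists>a b. 0 < a \<and> 0 < b \<and> (\<forall>x. a * norm x \<le> F x \<and> F x \<le> b * norm x)"
proof -
  let ?S = "sphere 0 1 :: (real^'n) set"
  have ne: "?S \<noteq> {}" by simp
  obtain x0 where x0: "x0 \<in> ?S" "\<And>x. x \<in> ?S \<Longrightarrow> F x0 \<le> F x"
    using continuous_attains_inf[OF compact_sphere ne F_continuous] by blast
  obtain x1 where x1: "x1 \<in> ?S" "\<And>x. x \<in> ?S \<Longrightarrow> F x \<le> F x1"
    using continuous_attains_sup[OF compact_sphere ne F_continuous] by blast
  have hom: "F x = norm x * F (x /\<^sub>R norm x)" if "x \<noteq> 0" for x
    using F_scale[of "norm x" "x /\<^sub>R norm x"] that by simp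
  have "F x0 * norm x \<le> F x \<and> F x \<le> F x1 * norm x" for x
  proof (cases "x = 0")
    case False
    then have "x /\<^sub>R norm x \<in> ?S" by simp
    then have "F x0 \<le> F (x /\<^sub>R norm x)" "F (x /\<^sub>R norm x) \<le> F x1"
      using x0 x1 by blast+
    then show ?thesis
      using hom[OF False] by (metis mult.commute mult_left_mono norm_ge_zero)
  qed simp
  moreover have "F x0 > 0" "F x1 > 0"
    using x0(1) x1(1) by (auto intro!: F_pos)
  ultimately show ?thesis by blast
qed

section \<open>The polar as the dual norm\<close>

lemma polar_bdd: "bdd_above ((\<lambda>\<xi>. x \<bullet> \<xi>) ` {\<xi>. F \<xi> \<le> 1})"
proof -
  obtain a where a: "a > 0" "\<And>x. a * norm x \<le> F x"
    using F_bounds by blast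
  have "x \<bullet> \<xi> \<le> norm x * (1 / a)" if "F \<xi> \<le> 1" for \<xi>
  proof -
    have "norm \<xi> \<le> 1 / a"
      using a(1) order_trans[OF a(2)[of \<xi>] that] by (simp add: field_simps)
    then show ?thesis
      using norm_cauchy_schwarz[of x \<xi>] by (meson mult_left_mono norm_ge_zero order_trans)
  qed
  then show ?thesis
    by (auto simp: bdd_above_def)
qed

lemma inner_le_polar: "F \<xi> \<le> 1 \<Longrightarrow> x \<bullet> \<xi> \<le> H x"
  unfolding polar_def by (intro cSUP_upper polar_bdd) auto

lemma polar_le: "(\<And>\<xi>. F \<xi> \<le> 1 \<Longrightarrow> x \<bullet> \<xi> \<le> c) \<Longrightarrow> H x \<le> c"
  unfolding polar_def by (rule cSUP_least) (auto intro: exI[of _ 0])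

lemma polar_approx: "c < H x \<Longrightarrow> \<exists>\<xi>. F \<xi> \<le> 1 \<and> c < x \<bullet> \<xi>"
  using polar_le[of x c] by (meson not_le)

text \<open>Rescaling \<open>\<xi>\<close> to \<open>F \<xi> = 1\<close> gives the Cauchy-Schwarz
  inequality of the dual pair. Directional derivatives are later bounded by it with constant 1, as
  the sharp exponent demands.\<close>

lemma inner_le_polar_F: "x \<bullet> \<xi> \<le> H x * F \<xi>"
proof (cases "\<xi> = 0")
  case False
  then have p: "F \<xi> > 0" by (rule F_pos)
  have "x \<bullet> ((1 / F \<xi>) *\<^sub>R \<xi>) \<le> H x"
    using p by (intro inner_le_polar) (simp add: F_scale)
  then show ?thesis using p by (simp add: field_simps)
qed simp

lemma polar_nonneg: "H x \<ge> 0"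
  using inner_le_polar[of 0 x] by simp

lemma abs_inner_le_polar_F: "\<bar>x \<bullet> \<xi>\<bar> \<le> H x * F \<xi>"
  using inner_le_polar_F[of x \<xi>] inner_le_polar_F[of x "- \<xi>"] by (simp add: F_minus abs_le_iff)

lemma polar_add: "H (x + y) \<le> H x + H y"
  by (rule polar_le) (auto simp: inner_add_left intro!: add_mono inner_le_polar)

lemma polar_scale: "H (t *\<^sub>R x) = \<bar>t\<bar> * H x"
proof -
  have le: "H (t *\<^sub>R x) \<le> \<bar>t\<bar> * H x" for t x
  proof (rule polar_le)
    fix \<xi> assume \<xi>: "F \<xi> \<le> 1"
    have "t *\<^sub>R x \<bullet> \<xi> \<le> \<bar>t\<bar> * \<bar>x \<bullet> \<xi>\<bar>"
      by (metis abs_ge_self abs_mult inner_scaleR_left)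
    also have "\<bar>x \<bullet> \<xi>\<bar> \<le> H x"
      using inner_le_polar[of \<xi> x] inner_le_polar[of "-\<xi>" x] \<xi> by (auto simp: F_minus abs_le_iff)
    finally show "t *\<^sub>R x \<bullet> \<xi> \<le> \<bar>t\<bar> * H x"
      by (simp add: mult_left_mono)
  qed
  show ?thesis
  proof (cases "t = 0")
    case True
    then show ?thesis using le[of 0 x] polar_nonneg[of 0] by simp
  next
    case False
    have "H x \<le> \<bar>1/t\<bar> * H (t *\<^sub>R x)"
      using le[of "1/t" "t *\<^sub>R x"] False by simp
    then have "\<bar>t\<bar> * H x \<le> H (t *\<^sub>R x)"
      using False by (simp add: field_simps)
    then show ?thesis using le[of t x] by linarith
  qed
qed

lemma polar_0 [simp]: "H 0 = 0"
  using polar_scale[of 0 0] by simp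

lemma polar_bounds: "\<exists>a b. 0 < a \<and> 0 < b \<and> (\<forall>x. a * norm x \<le> H x \<and> H x \<le> b * norm x)"
proof -
  obtain a b where ab: "0 < a" "0 < b" "\<And>x. a * norm x \<le> F x" "\<And>x. F x \<le> b * norm x"
    using F_bounds by blast
  have "H x \<le> (1 / a) * norm x" for x
  proof (rule polar_le)
    fix \<xi> assume "F \<xi> \<le> 1"
    then have "norm \<xi> \<le> 1 / a"
      using ab(1) order_trans[OF ab(3)[of \<xi>]] by (simp add: field_simps)
    then show "x \<bullet> \<xi> \<le> (1 / a) * norm x"
      using norm_cauchy_schwarz[of x \<xi>]
      by (metis mult.commute mult_left_mono norm_ge_zero order_trans)
  qed
  moreover have "(1 / b) * norm x \<le> H x" for x
  proof (cases "x = 0")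
    case False
    \<comment> \<open>Testing the duality inequality with \<open>x\<close> itself already yields the
      lower bound.\<close>
    have "norm x * norm x \<le> H x * F x"
      using inner_le_polar_F[of x x] by (simp add: dot_square_norm power2_eq_square)
    also have "\<dots> \<le> H x * (b * norm x)"
      using ab polar_nonneg by (intro mult_left_mono) auto
    finally show ?thesis using False ab by (simp add: field_simps)
  qed simp
  ultimately show ?thesis
    using ab by (intro exI[of _ "1/b"] exI[of _ "1/a"]) auto
qed

lemma polar_pos: "x \<noteq> 0 \<Longrightarrow> H x > 0"
  using polar_bounds by (smt (verit) mult_pos_pos zero_less_norm_iff)

lemma polar_convex: "convex_on UNIV H"
proof (rule convex_onI)
  fix t :: real and x y :: "real^'n" assume "0 < t" "t < 1"
  then show "H ((1 - t) *\<^sub>R x + t *\<^sub>R y) \<le> (1 - t) * H x + t * H y"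
    using polar_add[of "(1 - t) *\<^sub>R x" "t *\<^sub>R y"] by (simp add: polar_scale)
qed simp

lemma polar_continuous: "continuous_on S H"
  using convex_on_continuous[OF open_UNIV polar_convex] continuous_on_subset by blast

lemma polar_measurable [measurable]: "H \<in> borel_measurable borel"
  using polar_continuous by (rule borel_measurable_continuous_onI)

section \<open>Volumes of polar balls and radial integration\<close>

lemma kappa_emeasure: "emeasure lborel {x. H x \<le> 1} = ennreal \<kappa>"
  and kappa_pos: "\<kappa> > 0"
proof -
  obtain a b where ab: "0 < a" "0 < b" "\<And>x. a * norm x \<le> H x" "\<And>x. H x \<le> b * norm x"
    using polar_bounds by blast
  have [measurable]: "{x. H x \<le> 1} \<in> sets borel" by measurable
  have sub: "{x. H x \<le> 1} \<subseteq> cball 0 (1 / a)"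
  proof
    fix x assume "x \<in> {x. H x \<le> 1}"
    then show "x \<in> cball 0 (1 / a)"
      using ab(1) order_trans[OF ab(3)[of x]] by (simp add: field_simps)
  qed
  have sup: "ball 0 (1 / b) \<subseteq> {x. H x \<le> 1}"
  proof
    fix x :: "real^'n" assume "x \<in> ball 0 (1 / b)"
    then have "b * norm x \<le> 1" using ab by (simp add: field_simps)
    then show "x \<in> {x. H x \<le> 1}" using ab(4)[of x] by simp
  qed
  \<comment> \<open>\<open>kappa\<close> is a real-valued \<open>measure\<close>, which would be 0
    for a set of infinite measure; the enclosing Euclidean ball excludes this.\<close>
  have fin: "emeasure lborel {x. H x \<le> 1} < \<infinity>"
    using emeasure_mono[OF sub, of lborel] emeasure_lborel_cball_finite[of "0::real^'n" "1/a"]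
    by (simp add: order_le_less_trans)
  have eq: "\<kappa> = measure lborel {x. H x \<le> 1}"
    unfolding kappa_def by (simp add: measure_completion)
  show e: "emeasure lborel {x. H x \<le> 1} = ennreal \<kappa>"
    unfolding eq using fin by (intro emeasure_eq_ennreal_measure) auto
  have "0 < emeasure lborel (ball 0 (1 / b) :: (real^'n) set)"
    using ab by (subst emeasure_ball) (auto simp: ennreal_zero_less_mult_iff unit_ball_vol_pos)
  also have "\<dots> \<le> ennreal \<kappa>"
    unfolding e[symmetric] by (intro emeasure_mono[OF sup]) simp
  finally show "\<kappa> > 0" by simp
qed

lemma polar_ball_emeasure:
  assumes "r \<ge> 0"
  shows "emeasure lborel {x. H x \<le> r} = ennreal (\<kappa> * r powr N)"
proof (cases "r = 0")
  case True
  have "{x. H x \<le> 0} = {0}"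
    using polar_pos by (force simp: not_le)
  then show ?thesis using True by simp
next
  case False
  then have r: "r > 0" using assms by simp
  have "emeasure lborel {x. H x \<le> r} = (\<integral>\<^sup>+x. indicator {x. H x \<le> r} x \<partial>lborel)"
    by (subst nn_integral_indicator) auto
  also have "\<dots> = ennreal (r ^ CARD('n)) * (\<integral>\<^sup>+x. indicator {x. H x \<le> r} (r *\<^sub>R x) \<partial>lborel)"
    using r by (subst nn_integral_scale[of _ r]) auto
  also have "(\<lambda>x. indicator {x. H x \<le> r} (r *\<^sub>R x)) = (indicator {x. H x \<le> 1} :: _ \<Rightarrow> ennreal)"
    using r by (auto simp: polar_scale indicator_def fun_eq_iff)
  also have "(\<integral>\<^sup>+x. indicator {x. H x \<le> 1} x \<partial>lborel) = ennreal \<kappa>"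
    by (subst nn_integral_indicator) (auto simp: kappa_emeasure)
  also have "ennreal (r ^ CARD('n)) * ennreal \<kappa> = ennreal (\<kappa> * r powr N)"
    using r kappa_pos by (simp add: ennreal_mult'[symmetric] powr_realpow N_eq mult.commute)
  finally show ?thesis .
qed

text \<open>Polar coordinates without a surface measure: half-lines form an intersection-stable
  generator, so it suffices to compare the volume of \<open>{x. H x \<le> r}\<close> with the
  primitive of the density. The term \<open>max 0 r\<close> covers negative
  \<open>r\<close>.\<close>

lemma distr_polar:
  "distr lborel borel H =
    density lborel (\<lambda>r. ennreal (N * \<kappa> * r powr (N - 1)) * indicator {0<..} r)" (is "?A = ?B")
proof (rule measure_eqI_generator_eq[of "range atMost" UNIV _ _ "\<lambda>i. {..real i}"])
  show "Int_stable (range atMost :: real set set)"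
    by (auto simp: Int_stable_def)
  show "sets ?A = sigma_sets UNIV (range atMost)" "sets ?B = sigma_sets UNIV (range atMost)"
    by (simp_all add: borel_eq_atMost)
  show "(\<Union>i. {..real i}) = UNIV"
    using real_arch_simple by auto
  have A: "emeasure ?A {..r} = ennreal (\<kappa> * max 0 r powr N)" for r
  proof -
    have "emeasure ?A {..r} = emeasure lborel {x. H x \<le> r}"
      by (subst emeasure_distr) (auto intro!: arg_cong2[where f=emeasure])
    also have "\<dots> = ennreal (\<kappa> * max 0 r powr N)"
    proof (cases "r \<ge> 0")
      case False
      then have "{x. H x \<le> r} = {}" using order_trans[OF polar_nonneg] by blast
      then show ?thesis using False by simp
    qed (simp add: polar_ball_emeasure)
    finally show ?thesis .
  qed
  have B: "emeasure ?B {..r} = ennreal (\<kappa> * max 0 r powr N)" for r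
  proof -
    have "emeasure ?B {..r} =
        (\<integral>\<^sup>+s. ennreal (N * \<kappa> * s powr (N - 1)) * indicator {0<..} s * indicator {..r} s \<partial>lborel)"
      by (subst emeasure_density) auto
    also have "\<dots> = (\<integral>\<^sup>+s. ennreal (N * \<kappa> * s powr (N - 1)) * indicator {0..max 0 r} s \<partial>lborel)"
      by (intro nn_integral_cong) (auto simp: indicator_def)
    also have "((\<lambda>s. N * \<kappa> * s powr (N - 1)) has_integral N * \<kappa> * (max 0 r powr (N - 1 + 1) / (N - 1 + 1))) {0..max 0 r}"
      using N_ge_2 by (intro has_integral_mult_right has_integral_powr_from_0) auto
    then have "(\<integral>\<^sup>+s. ennreal (N * \<kappa> * s powr (N - 1)) * indicator {0..max 0 r} s \<partial>lborel) =
        ennreal (N * \<kappa> * (max 0 r powr (N - 1 + 1) / (N - 1 + 1)))"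
      using kappa_pos N_ge_2 by (intro nn_integral_has_integral_lebesgue') auto
    finally show ?thesis using N_ge_2 by simp
  qed
  show "emeasure ?A X = emeasure ?B X" if "X \<in> range atMost" for X
    using that A B by auto
  show "emeasure ?A {..real i} \<noteq> \<infinity>" for i
    unfolding A by simp
qed auto

lemma nn_integral_polar:
  assumes [measurable]: "g \<in> borel_measurable borel"
  shows "(\<integral>\<^sup>+x. g (H x) \<partial>lborel) =
    (\<integral>\<^sup>+r. ennreal (N * \<kappa> * r powr (N - 1)) * indicator {0<..} r * g r \<partial>lborel)"
proof -
  have "(\<integral>\<^sup>+x. g (H x) \<partial>lborel) = (\<integral>\<^sup>+r. g r \<partial>distr lborel borel H)"
    by (subst nn_integral_distr) auto
  also have "\<dots> = (\<integral>\<^sup>+r. ennreal (N * \<kappa> * r powr (N - 1)) * indicator {0<..} r * g r \<partial>lborel)"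
    unfolding distr_polar by (subst nn_integral_density) auto
  finally show ?thesis .
qed

lemma nn_integral_polar_powr:
  assumes a: "a > - N" and \<rho>: "\<rho> \<ge> 0"
  shows "(\<integral>\<^sup>+x. ennreal (H x powr a) * indicator {x. H x \<le> \<rho>} x \<partial>lborel) =
    ennreal (N * \<kappa> * \<rho> powr (N + a) / (N + a))"
proof -
  have "(\<integral>\<^sup>+x. ennreal (H x powr a) * indicator {x. H x \<le> \<rho>} x \<partial>lborel) =
      (\<integral>\<^sup>+x. (\<lambda>r. ennreal (r powr a) * indicator {..\<rho>} r) (H x) \<partial>lborel)"
    by (intro nn_integral_cong) (auto simp: indicator_def)
  also have "\<dots> = (\<integral>\<^sup>+r. ennreal (N * \<kappa> * r powr (N - 1)) * indicator {0<..} r *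
      (ennreal (r powr a) * indicator {..\<rho>} r) \<partial>lborel)"
    by (rule nn_integral_polar) simp
  also have "\<dots> = (\<integral>\<^sup>+r. ennreal (N * \<kappa> * r powr (N - 1 + a)) * indicator {0..\<rho>} r \<partial>lborel)"
    using kappa_pos N_ge_2
    by (intro nn_integral_cong) (auto simp: indicator_def ennreal_mult'[symmetric] mult.assoc powr_add)
  also have "((\<lambda>r. N * \<kappa> * r powr (N - 1 + a)) has_integral
      N * \<kappa> * (\<rho> powr (N - 1 + a + 1) / (N - 1 + a + 1))) {0..\<rho>}"
    using a \<rho> by (intro has_integral_mult_right has_integral_powr_from_0) auto
  then have "(\<integral>\<^sup>+r. ennreal (N * \<kappa> * r powr (N - 1 + a)) * indicator {0..\<rho>} r \<partial>lborel) =
      ennreal (N * \<kappa> * (\<rho> powr (N - 1 + a + 1) / (N - 1 + a + 1)))"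
    using kappa_pos N_ge_2 by (intro nn_integral_has_integral_lebesgue') auto
  finally show ?thesis by (simp add: add.commute)
qed

text \<open>The power \<open>- N\<close> is what the kernel \<open>H powr (1 - N)\<close> becomes
  under the dual exponent \<open>N / (N - 1)\<close>. It is the borderline of integrability, hence
  the logarithm, and inverting that logarithm later gives exponential decay.\<close>

lemma nn_integral_polar_annulus:
  assumes "0 < \<rho>" "\<rho> \<le> R"
  shows "(\<integral>\<^sup>+x. ennreal (H x powr (- N)) * indicator {x. \<rho> \<le> H x \<and> H x \<le> R} x \<partial>lborel) =
    ennreal (N * \<kappa> * ln (R / \<rho>))"
proof -
  have "(\<integral>\<^sup>+x. ennreal (H x powr (- N)) * indicator {x. \<rho> \<le> H x \<and> H x \<le> R} x \<partial>lborel) =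
      (\<integral>\<^sup>+x. (\<lambda>r. ennreal (r powr (- N)) * indicator {\<rho>..R} r) (H x) \<partial>lborel)"
    by (intro nn_integral_cong) (auto simp: indicator_def)
  also have "\<dots> = (\<integral>\<^sup>+r. ennreal (N * \<kappa> * r powr (N - 1)) * indicator {0<..} r *
      (ennreal (r powr (- N)) * indicator {\<rho>..R} r) \<partial>lborel)"
    by (rule nn_integral_polar) simp
  also have "\<dots> = (\<integral>\<^sup>+r. ennreal (N * \<kappa> * (1 / r)) * indicator {\<rho>..R} r \<partial>lborel)"
  proof (intro nn_integral_cong)
    fix r :: real
    show "ennreal (N * \<kappa> * r powr (N - 1)) * indicator {0<..} r * (ennreal (r powr (- N)) * indicator {\<rho>..R} r)
      = ennreal (N * \<kappa> * (1 / r)) * indicator {\<rho>..R} r"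
    proof (cases "\<rho> \<le> r")
      case True
      then have "r powr (N - 1) * r powr (- N) = 1 / r"
        using assms powr_add[of r "N - 1" "- N"] by (simp add: powr_minus_divide)
      then show ?thesis
        using True assms kappa_pos N_ge_2 by (auto simp: indicator_def ennreal_mult'[symmetric] mult.assoc)
    qed (auto simp: indicator_def)
  qed
  also have "((\<lambda>r. 1 / r) has_integral (ln R - ln \<rho>)) {\<rho>..R}"
    using assms by (intro fundamental_theorem_of_calculus)
      (auto intro!: derivative_eq_intros simp: has_real_derivative_iff_has_vector_derivative[symmetric])
  then have "((\<lambda>r. N * \<kappa> * (1 / r)) has_integral N * \<kappa> * (ln R - ln \<rho>)) {\<rho>..R}"
    by (rule has_integral_mult_right)
  then have "(\<integral>\<^sup>+r. ennreal (N * \<kappa> * (1 / r)) * indicator {\<rho>..R} r \<partial>lborel) =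
      ennreal (N * \<kappa> * (ln R - ln \<rho>))"
    using kappa_pos N_ge_2 assms by (intro nn_integral_has_integral_lebesgue') auto
  finally show ?thesis using assms by (simp add: ln_div)
qed

end

section \<open>Pointwise bound by a potential of the gradient\<close>

lemma C_on_Suc_imp: "C_on (Suc k) S f \<Longrightarrow> C_on k S f"
proof (induction k arbitrary: f)
  case 0
  then show ?case
    by (auto intro!: continuous_at_imp_continuous_on differentiable_imp_continuous_within)
next
  case (Suc k)
  then show ?case
    by (metis C_on.simps(2))
qed

lemma frechet_derivative_eq_grad:
  assumes "f differentiable (at x)"
  shows "frechet_derivative f (at x) v = grad f x \<bullet> v"
proof -
  interpret linear "frechet_derivative f (at x)"
    using assms by (rule linear_frechet_derivative)
  have "frechet_derivative f (at x) v = frechet_derivative f (at x) (\<Sum>i\<in>UNIV. v $ i *\<^sub>R axis i 1)"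
    using basis_expansion[of v] by (simp add: scalar_mult_eq_scaleR)
  also have "\<dots> = (\<Sum>i\<in>UNIV. v $ i * frechet_derivative f (at x) (axis i 1))"
    by (simp add: sum scale)
  also have "\<dots> = grad f x \<bullet> v"
    by (simp add: inner_vec_def grad_def dir_deriv_def mult.commute)
  finally show ?thesis .
qed

lemma has_derivative_grad:
  assumes "f differentiable (at x)"
  shows "(f has_derivative (\<lambda>v. grad f x \<bullet> v)) (at x)"
proof -
  have "frechet_derivative f (at x) = (\<lambda>v. grad f x \<bullet> v)"
    using frechet_derivative_eq_grad[OF assms] by (rule ext)
  then show ?thesis
    using assms frechet_derivative_works[of f "at x"] by simp
qed

lemma C1_continuous_grad:
  assumes "C_on 1 UNIV f"
  shows "continuous_on UNIV (grad f)"
  unfolding grad_def using assms by (auto intro!: continuous_on_vec_lambda)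

context finsler_norm
begin

text \<open>The fundamental theorem of calculus on the segment from \<open>x\<close> to
  \<open>x + z\<close>, combined with duality. Values in \<open>ennreal\<close> allow the later
  interchanges of integrals without integrability questions.\<close>

lemma segment_bound:
  assumes f: "C_on 1 UNIV f"
  shows "ennreal \<bar>f x\<bar> \<le> ennreal \<bar>f (x + z)\<bar> +
    (\<integral>\<^sup>+t. ennreal (F (grad f (x + t *\<^sub>R z)) * H z) * indicator {0..1} t \<partial>lborel)"
proof -
  have df: "f differentiable (at y)" for y using f by simp
  define g where "g = (\<lambda>t. F (grad f (x + t *\<^sub>R z)) * H z)"
  have cont: "continuous_on {0..1} (\<lambda>t. grad f (x + t *\<^sub>R z))"
    by (intro continuous_on_compose2[OF C1_continuous_grad[OF f]] continuous_intros) auto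
  have g: "g integrable_on {0..1}"
    unfolding g_def
    by (intro integrable_continuous_interval continuous_intros continuous_on_compose2[OF F_continuous cont]) auto
  have "((\<lambda>t. grad f (x + t *\<^sub>R z) \<bullet> z) has_integral (f (x + 1 *\<^sub>R z) - f (x + 0 *\<^sub>R z))) {0..1}"
  proof (rule fundamental_theorem_of_calculus)
    fix t :: real
    have "((\<lambda>t. f (x + t *\<^sub>R z)) has_derivative (\<lambda>h. grad f (x + t *\<^sub>R z) \<bullet> (h *\<^sub>R z))) (at t within {0..1})"
      by (rule has_derivative_compose[OF _ has_derivative_grad[OF df]]) (auto intro!: derivative_eq_intros)
    then show "((\<lambda>t. f (x + t *\<^sub>R z)) has_vector_derivative grad f (x + t *\<^sub>R z) \<bullet> z) (at t within {0..1})"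
      by (simp add: has_vector_derivative_def)
  qed simp
  then have i: "f (x + z) - f x = integral {0..1} (\<lambda>t. grad f (x + t *\<^sub>R z) \<bullet> z)"
      "(\<lambda>t. grad f (x + t *\<^sub>R z) \<bullet> z) integrable_on {0..1}"
    by (auto simp: integral_unique has_integral_integrable)
  have "norm (integral {0..1} (\<lambda>t. grad f (x + t *\<^sub>R z) \<bullet> z)) \<le> integral {0..1} g"
    using abs_inner_le_polar_F[of z]
    by (intro integral_norm_bound_integral i g) (auto simp: g_def inner_commute[of _ z] mult.commute[of "H z"])
  then have le: "\<bar>f x\<bar> \<le> \<bar>f (x + z)\<bar> + integral {0..1} g"
    using i(1) by auto
  have nn: "integral {0..1} g \<ge> 0"
    by (intro integral_nonneg g) (simp add: g_def F_nonneg polar_nonneg)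
  have "(\<integral>\<^sup>+t. ennreal (g t) * indicator {0..1} t \<partial>lborel) = ennreal (integral {0..1} g)"
    by (rule nn_integral_has_integral_lebesgue'[OF _ integrable_integral[OF g]])
      (simp add: g_def F_nonneg polar_nonneg)
  then show ?thesis
    using le nn unfolding g_def by (simp flip: ennreal_plus)
qed

text \<open>Substituting \<open>w = t *\<^sub>R z\<close> in the averaged segment bound costs
  \<open>t powr (- N)\<close> for the volume and one more \<open>1 / t\<close> for
  \<open>H z\<close>. With \<open>h = H w\<close>, the variable \<open>t\<close> then occurs only in
  this integral, which produces the potential kernel.\<close>

lemma kernel_time_integral:
  assumes h: "h \<ge> 0" and R: "R > 0"
  shows "ennreal h * (\<integral>\<^sup>+t. ennreal (t powr (- N - 1)) * indicator {s. 0 < s \<and> s \<le> 1 \<and> h \<le> s * R} t \<partial>lborel)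
    \<le> ennreal (R powr N / N * h powr (1 - N)) * indicator {..R} h"
proof (cases "0 < h \<and> h \<le> R")
  case True
  have pos: "0 < h / R"
    using True R by simp
  have sub: "{s. 0 < s \<and> s \<le> 1 \<and> h \<le> s * R} = {h / R..1}"
  proof -
    have "0 < t" if "h / R \<le> t" for t
      using less_le_trans[OF pos that] .
    then show ?thesis
      using R by (auto simp: pos_divide_le_eq)
  qed
  have "((\<lambda>t. t powr (- N - 1)) has_integral (- (1 powr (- N)) / N - (- ((h / R) powr (- N)) / N))) {h / R..1}"
    using True R N_ge_2 by (intro fundamental_theorem_of_calculus)
      (auto intro!: derivative_eq_intros dest!: less_le_trans[OF pos] simp: has_real_derivative_iff_has_vector_derivative[symmetric])
  then have "(\<integral>\<^sup>+t. ennreal (t powr (- N - 1)) * indicator {h / R..1} t \<partial>lborel) =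
      ennreal (- (1 powr (- N)) / N - (- ((h / R) powr (- N)) / N))"
    by (intro nn_integral_has_integral_lebesgue') auto
  \<comment> \<open>The negative contribution of the upper limit \<open>t = 1\<close> is
    dropped.\<close>
  also have "\<dots> \<le> ennreal ((h / R) powr (- N) / N)"
    using N_ge_2 by (intro ennreal_leI) (auto simp: field_simps)
  also have "(h / R) powr (- N) / N = R powr N / N * h powr (- N)"
    using True R by (simp add: powr_divide powr_minus field_simps)
  finally have "ennreal h * (\<integral>\<^sup>+t. ennreal (t powr (- N - 1)) * indicator {h / R..1} t \<partial>lborel)
      \<le> ennreal h * ennreal (R powr N / N * h powr (- N))"
    by (rule mult_left_mono) simp
  also have "\<dots> = ennreal (R powr N / N * h powr (1 - N))"
    using True N_ge_2 by (simp add: ennreal_mult'[symmetric] powr_diff powr_minus field_simps)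
  finally show ?thesis using True unfolding sub by simp
next
  case False
  then consider "h = 0" | "h > R" using h by force
  then show ?thesis
  proof cases
    case 2
    have "\<not> h \<le> s * R" if "0 < s" "s \<le> 1" for s
      using mult_right_mono[OF that(2), of R] R 2 by linarith
    then have "{s. 0 < s \<and> s \<le> 1 \<and> h \<le> s * R} = {}"
      by auto
    then show ?thesis by simp
  qed simp
qed

text \<open>Integration of \<open>segment_bound\<close> over the polar ball. Division by its volume
  \<open>\<kappa> * R powr N\<close> would show the kernel constant
  \<open>1 / (N * \<kappa>)\<close>, from which \<open>lambda_crit\<close> descends.\<close>

lemma representation_bound:
  assumes f: "C_on 1 UNIV f" and R: "R > 0"
  shows "ennreal (\<kappa> * R powr N) * ennreal \<bar>f x\<bar> \<le>
    (\<integral>\<^sup>+z. ennreal \<bar>f (x + z)\<bar> * indicator {z. H z \<le> R} z \<partial>lborel) +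
    ennreal (R powr N / N) * (\<integral>\<^sup>+z. ennreal (H z powr (1 - N) * F (grad f (x + z))) * indicator {z. H z \<le> R} z \<partial>lborel)"
proof -
  have [measurable]: "grad f \<in> borel_measurable borel" "f \<in> borel_measurable borel"
    using C1_continuous_grad[OF f] C_on_Suc_imp[of 0 UNIV f] f
    by (auto intro!: borel_measurable_continuous_onI)
  let ?u = "\<lambda>y. F (grad f y)"
  let ?W = "{z. H z \<le> R}"
  have "ennreal (\<kappa> * R powr N) * ennreal \<bar>f x\<bar> = (\<integral>\<^sup>+z. ennreal \<bar>f x\<bar> * indicator ?W z \<partial>lborel)"
    using R by (simp add: nn_integral_cmult_indicator polar_ball_emeasure mult.commute)
  also have "\<dots> \<le> (\<integral>\<^sup>+z. ennreal \<bar>f (x + z)\<bar> * indicator ?W z +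
      (\<integral>\<^sup>+t. ennreal (?u (x + t *\<^sub>R z) * H z) * indicator {0..1} t \<partial>lborel) * indicator ?W z \<partial>lborel)"
    using segment_bound[OF f, of x] by (intro nn_integral_mono) (auto simp: indicator_def)
  also have "\<dots> = (\<integral>\<^sup>+z. ennreal \<bar>f (x + z)\<bar> * indicator ?W z \<partial>lborel) +
      (\<integral>\<^sup>+z. (\<integral>\<^sup>+t. ennreal (?u (x + t *\<^sub>R z) * H z) * indicator {0..1} t \<partial>lborel) * indicator ?W z \<partial>lborel)"
    by (rule nn_integral_add) measurable
  also have "(\<integral>\<^sup>+z. (\<integral>\<^sup>+t. ennreal (?u (x + t *\<^sub>R z) * H z) * indicator {0..1} t \<partial>lborel) * indicator ?W z \<partial>lborel) =
      (\<integral>\<^sup>+z. (\<integral>\<^sup>+t. ennreal (?u (x + t *\<^sub>R z) * H z) * indicator {0..1} t * indicator ?W z \<partial>lborel) \<partial>lborel)"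
    by (intro nn_integral_cong nn_integral_multc[symmetric]) measurable
  also have "\<dots> = (\<integral>\<^sup>+t. (\<integral>\<^sup>+z. ennreal (?u (x + t *\<^sub>R z) * H z) * indicator {0..1} t * indicator ?W z \<partial>lborel) \<partial>lborel)"
    by (rule lborel_pair.Fubini') measurable
  also have "\<dots> = (\<integral>\<^sup>+t. (\<integral>\<^sup>+w. ennreal (?u (x + w)) * (ennreal (H w) *
      (ennreal (t powr (- N - 1)) * indicator {s. 0 < s \<and> s \<le> 1 \<and> H w \<le> s * R} t)) \<partial>lborel) \<partial>lborel)"
  \<comment> \<open>The scaling by \<open>t\<close> is singular at \<open>t = 0\<close>, which is
    discarded as a null set.\<close>
  proof (rule nn_integral_cong_AE, use AE_lborel_singleton[of "0::real"] in eventually_elim)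
    fix t :: real assume "t \<noteq> 0"
    show "(\<integral>\<^sup>+z. ennreal (?u (x + t *\<^sub>R z) * H z) * indicator {0..1} t * indicator ?W z \<partial>lborel) =
      (\<integral>\<^sup>+w. ennreal (?u (x + w)) * (ennreal (H w) *
      (ennreal (t powr (- N - 1)) * indicator {s. 0 < s \<and> s \<le> 1 \<and> H w \<le> s * R} t)) \<partial>lborel)"
    proof (cases "0 < t \<and> t \<le> 1")
      case False
      then show ?thesis using \<open>t \<noteq> 0\<close> by (auto simp: indicator_def)
    next
      case True
      then have t: "t > 0" by simp
      \<comment> \<open>The Jacobian \<open>t ^ CARD('n)\<close> and the factor \<open>t\<close> of
        \<open>H (t *\<^sub>R z)\<close> cancel the power introduced for the substitution.\<close>
      have pw: "t powr (- N - 1) * (t ^ CARD('n) * t) = 1"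
        using t by (simp add: N_eq powr_diff powr_minus powr_realpow)
      define G where "G w = ennreal (?u (x + w)) * (ennreal (H w) *
          (ennreal (t powr (- N - 1)) * indicator {s. 0 < s \<and> s \<le> 1 \<and> H w \<le> s * R} t))" for w
      have [measurable]: "G \<in> borel_measurable borel"
        unfolding G_def by measurable
      have "(\<integral>\<^sup>+w. G w \<partial>lborel) = ennreal (t ^ CARD('n)) * (\<integral>\<^sup>+z. G (t *\<^sub>R z) \<partial>lborel)"
        using nn_integral_scale[of G t] t by simp
      also have "\<dots> = ennreal (t ^ CARD('n)) * (\<integral>\<^sup>+z. ennreal (?u (x + t *\<^sub>R z)) * (ennreal (H (t *\<^sub>R z)) *
          (ennreal (t powr (- N - 1)) * indicator {s. 0 < s \<and> s \<le> 1 \<and> H (t *\<^sub>R z) \<le> s * R} t)) \<partial>lborel)"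
        by (simp add: G_def)
      also have "\<dots> = (\<integral>\<^sup>+z. ennreal (t ^ CARD('n)) * (ennreal (?u (x + t *\<^sub>R z)) * (ennreal (H (t *\<^sub>R z)) *
          (ennreal (t powr (- N - 1)) * indicator {s. 0 < s \<and> s \<le> 1 \<and> H (t *\<^sub>R z) \<le> s * R} t))) \<partial>lborel)"
        by (rule nn_integral_cmult[symmetric]) measurable
      also have "\<dots> = (\<integral>\<^sup>+z. ennreal (?u (x + t *\<^sub>R z) * H z) * indicator {0..1} t * indicator ?W z \<partial>lborel)"
      proof (intro nn_integral_cong)
        fix z
        have "t ^ CARD('n) * (?u (x + t *\<^sub>R z) * (H (t *\<^sub>R z) * t powr (- N - 1))) =
            (t powr (- N - 1) * (t ^ CARD('n) * t)) * (?u (x + t *\<^sub>R z) * H z)"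
          using t by (simp add: polar_scale)
        also have "\<dots> = ?u (x + t *\<^sub>R z) * H z" unfolding pw by simp
        finally show "ennreal (t ^ CARD('n)) * (ennreal (?u (x + t *\<^sub>R z)) * (ennreal (H (t *\<^sub>R z)) *
          (ennreal (t powr (- N - 1)) * indicator {s. 0 < s \<and> s \<le> 1 \<and> H (t *\<^sub>R z) \<le> s * R} t))) =
          ennreal (?u (x + t *\<^sub>R z) * H z) * indicator {0..1} t * indicator ?W z"
          using True polar_nonneg F_nonneg
          by (auto simp: indicator_def polar_scale ennreal_mult'[symmetric])
      qed
      finally show ?thesis by (simp add: G_def)
    qed
  qed
  also have "\<dots> = (\<integral>\<^sup>+w. (\<integral>\<^sup>+t. ennreal (?u (x + w)) * (ennreal (H w) *
      (ennreal (t powr (- N - 1)) * indicator {s. 0 < s \<and> s \<le> 1 \<and> H w \<le> s * R} t)) \<partial>lborel) \<partial>lborel)"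
    by (rule lborel_pair.Fubini') measurable
  also have "\<dots> = (\<integral>\<^sup>+w. ennreal (?u (x + w)) * (ennreal (H w) *
      (\<integral>\<^sup>+t. ennreal (t powr (- N - 1)) * indicator {s. 0 < s \<and> s \<le> 1 \<and> H w \<le> s * R} t \<partial>lborel)) \<partial>lborel)"
    by (simp add: nn_integral_cmult)
  also have "\<dots> \<le> (\<integral>\<^sup>+w. ennreal (?u (x + w)) * (ennreal (R powr N / N * H w powr (1 - N)) * indicator {..R} (H w)) \<partial>lborel)"
    by (intro nn_integral_mono mult_left_mono kernel_time_integral polar_nonneg R) simp
  also have "\<dots> = (\<integral>\<^sup>+w. ennreal (R powr N / N) * (ennreal (H w powr (1 - N) * ?u (x + w)) * indicator ?W w) \<partial>lborel)"
    using N_ge_2 F_nonneg by (intro nn_integral_cong) (auto simp: indicator_def ennreal_mult'[symmetric] mult_ac)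
  also have "\<dots> = ennreal (R powr N / N) * (\<integral>\<^sup>+w. ennreal (H w powr (1 - N) * ?u (x + w)) * indicator ?W w \<partial>lborel)"
    by (rule nn_integral_cmult) measurable
  finally show ?thesis by (simp add: add_left_mono)
qed

end

section \<open>Exponential decay of level sets\<close>

text \<open>Young's inequality for \<open>f x / A\<close> and \<open>g x / B\<close>, multiplied by
  \<open>A * B\<close> and integrated. Positive upper bounds in place of the norms avoid the case of
  a vanishing norm.\<close>

lemma nn_integral_Hoelder:
  fixes f g :: "'a \<Rightarrow> real"
  assumes pq: "p > 1" "q > 1" "1 / p + 1 / q = 1"
    and [measurable]: "f \<in> borel_measurable M" "g \<in> borel_measurable M"
    and nonneg: "\<And>x. f x \<ge> 0" "\<And>x. g x \<ge> 0" and AB: "A > 0" "B > 0"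
    and f: "(\<integral>\<^sup>+x. ennreal (f x powr p) \<partial>M) \<le> ennreal (A powr p)"
    and g: "(\<integral>\<^sup>+x. ennreal (g x powr q) \<partial>M) \<le> ennreal (B powr q)"
  shows "(\<integral>\<^sup>+x. ennreal (f x * g x) \<partial>M) \<le> ennreal (A * B)"
proof -
  define a where "a = A * B / (p * A powr p)"
  define b where "b = A * B / (q * B powr q)"
  have ab: "a > 0" "b > 0" using pq AB by (auto simp: a_def b_def)
  have "f x * g x \<le> a * f x powr p + b * g x powr q" for x
  proof -
    have "(f x / A) * (g x / B) \<le> (f x / A) powr p / p + (g x / B) powr q / q"
      using nonneg AB pq by (intro Youngs_inequality) auto
    then have "A * B * ((f x / A) * (g x / B)) \<le> A * B * ((f x / A) powr p / p + (g x / B) powr q / q)"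
      using AB by (intro mult_left_mono) auto
    then show ?thesis
      using AB nonneg by (simp add: a_def b_def powr_divide field_simps)
  qed
  then have "(\<integral>\<^sup>+x. ennreal (f x * g x) \<partial>M) \<le>
      (\<integral>\<^sup>+x. ennreal a * ennreal (f x powr p) + ennreal b * ennreal (g x powr q) \<partial>M)"
    using ab by (intro nn_integral_mono) (simp add: ennreal_mult'[symmetric] ennreal_plus[symmetric] del: ennreal_plus)
  also have "\<dots> = ennreal a * (\<integral>\<^sup>+x. ennreal (f x powr p) \<partial>M) + ennreal b * (\<integral>\<^sup>+x. ennreal (g x powr q) \<partial>M)"
    by (simp add: nn_integral_add nn_integral_cmult)
  also have "\<dots> \<le> ennreal a * ennreal (A powr p) + ennreal b * ennreal (B powr q)"
    by (intro add_mono mult_left_mono f g) auto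
  also have "\<dots> = ennreal (a * A powr p + b * B powr q)"
    using ab by (simp add: ennreal_mult'[symmetric])
  also have "a * A powr p + b * B powr q = A * B * (1 / p + 1 / q)"
    using AB pq by (simp add: a_def b_def field_simps)
  finally show ?thesis using pq by simp
qed

context finsler_norm
begin

text \<open>Hoelder's inequality with the annulus integral. Translation invariance of the energy
  makes the bound uniform in \<open>x\<close>, and \<open>max 0\<close> covers
  \<open>\<rho> \<ge> R\<close>, where the region is empty.\<close>

lemma far_bound:
  assumes [measurable]: "u \<in> borel_measurable borel" and u: "\<And>x. u x \<ge> 0"
    and T: "T > 0" "(\<integral>\<^sup>+x. ennreal (u x powr N) \<partial>lborel) \<le> ennreal (T powr N)"
    and \<rho>: "0 < \<rho>" and R: "0 < R"
  shows "(\<integral>\<^sup>+w. ennreal (H w powr (1 - N) * u (x + w)) * indicator {w. \<rho> < H w \<and> H w \<le> R} w \<partial>lborel) \<le>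
    ennreal ((N * \<kappa> * max 0 (ln (R / \<rho>))) powr ((N - 1) / N) * T)"
proof (cases "\<rho> < R")
  case False
  then have "{w. \<rho> < H w \<and> H w \<le> R} = {}" by auto
  then show ?thesis by simp
next
  case True
  then have ln: "ln (R / \<rho>) > 0" using \<rho> by simp
  define A where "A = (N * \<kappa> * ln (R / \<rho>)) powr ((N - 1) / N)"
  have A: "A > 0" "A powr (N / (N - 1)) = N * \<kappa> * ln (R / \<rho>)"
    using ln N_ge_2 kappa_pos by (auto simp: A_def powr_powr)
  have "(\<integral>\<^sup>+w. ennreal ((H w powr (1 - N) * indicator {w. \<rho> < H w \<and> H w \<le> R} w) * u (x + w)) \<partial>lborel)
      \<le> ennreal (A * T)"
  proof (rule nn_integral_Hoelder[where p="N / (N - 1)" and q=N])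
    show "1 < N / (N - 1)" "1 < N" "1 / (N / (N - 1)) + 1 / N = 1"
      using N_ge_2 by (auto simp: field_simps)
    have "(\<integral>\<^sup>+w. ennreal ((H w powr (1 - N) * indicator {w. \<rho> < H w \<and> H w \<le> R} w) powr (N / (N - 1))) \<partial>lborel) \<le>
      (\<integral>\<^sup>+w. ennreal (H w powr (- N)) * indicator {x. \<rho> \<le> H x \<and> H x \<le> R} w \<partial>lborel)"
    proof (intro nn_integral_mono)
      fix w
      have "(1 - N) * (N / (N - 1)) = - N" using N_ge_2 by (simp add: field_simps)
      then show "ennreal ((H w powr (1 - N) * indicator {w. \<rho> < H w \<and> H w \<le> R} w) powr (N / (N - 1)))
        \<le> ennreal (H w powr (- N)) * indicator {x. \<rho> \<le> H x \<and> H x \<le> R} w"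
        by (simp add: indicator_def powr_powr)
    qed
    also have "\<dots> = ennreal (N * \<kappa> * ln (R / \<rho>))"
      using \<rho> True by (intro nn_integral_polar_annulus) auto
    finally show "(\<integral>\<^sup>+w. ennreal ((H w powr (1 - N) * indicator {w. \<rho> < H w \<and> H w \<le> R} w) powr (N / (N - 1))) \<partial>lborel)
      \<le> ennreal (A powr (N / (N - 1)))" by (simp add: A)
    show "(\<integral>\<^sup>+w. ennreal (u (x + w) powr N) \<partial>lborel) \<le> ennreal (T powr N)"
      using T(2) nn_integral_shift[of "\<lambda>w. ennreal (u w powr N)" x] by simp
  qed (use A u T in auto)
  also have "(\<integral>\<^sup>+w. ennreal ((H w powr (1 - N) * indicator {w. \<rho> < H w \<and> H w \<le> R} w) * u (x + w)) \<partial>lborel) =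
      (\<integral>\<^sup>+w. ennreal (H w powr (1 - N) * u (x + w)) * indicator {w. \<rho> < H w \<and> H w \<le> R} w \<partial>lborel)"
    by (intro nn_integral_cong) (auto simp: indicator_def)
  finally show ?thesis using ln by (simp add: A_def)
qed

text \<open>Hoelder's inequality fails at the origin, where the dual power of the kernel is not
  integrable. With the order of integration exchanged, the mean of \<open>u\<close> over each
  translate of \<open>E\<close> is bounded uniformly in \<open>w\<close>, and only the integrable
  kernel itself remains.\<close>

lemma near_bound:
  assumes [measurable]: "u \<in> borel_measurable borel" "E \<in> sets borel" and u: "\<And>x. u x \<ge> 0"
    and T: "T > 0" "(\<integral>\<^sup>+x. ennreal (u x powr N) \<partial>lborel) \<le> ennreal (T powr N)"
    and \<rho>: "0 < \<rho>" and E: "emeasure lborel E = ennreal m" "m > 0"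
  shows "(\<integral>\<^sup>+x. (\<integral>\<^sup>+w. ennreal (H w powr (1 - N) * u (x + w)) * indicator {w. H w \<le> \<rho>} w \<partial>lborel) * indicator E x \<partial>lborel)
    \<le> ennreal (2 * T * m powr (1 - 1 / N) * (N * \<kappa> * \<rho>))"
proof -
  \<comment> \<open>This value balances the two terms of the pointwise inequality below: after
    integration each equals \<open>T * m powr (1 - 1 / N)\<close>, which explains the factor
    2.\<close>
  define \<eta> where "\<eta> = m powr (1 / N) / T"
  have \<eta>: "\<eta> > 0" using E T by (simp add: \<eta>_def)
  have le: "u y \<le> \<eta> powr (N - 1) * u y powr N + 1 / \<eta>" for y
  proof (cases "u y \<le> 1 / \<eta>")
    case False
    then have 1: "\<eta> * u y > 1" using \<eta> by (simp add: field_simps)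
    then have p: "u y > 0" using u[of y] by (cases "u y = 0") auto
    then have "1 \<le> (\<eta> * u y) powr (N - 1)" using N_ge_2 1 by (intro ge_one_powr_ge_zero) auto
    then have "u y * 1 \<le> u y * (\<eta> * u y) powr (N - 1)" using p by (intro mult_left_mono) auto
    also have "\<dots> = \<eta> powr (N - 1) * u y powr N"
      using p \<eta> by (simp add: powr_mult powr_diff)
    also have "\<dots> \<le> \<dots> + 1 / \<eta>" using \<eta> by simp
    finally show ?thesis by simp
  qed (simp add: add_increasing)
  have inner: "(\<integral>\<^sup>+x. ennreal (u (x + w)) * indicator E x \<partial>lborel) \<le> ennreal (2 * T * m powr (1 - 1 / N))" for w
  proof -
    have "(\<integral>\<^sup>+x. ennreal (u (x + w)) * indicator E x \<partial>lborel) \<le>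
        (\<integral>\<^sup>+x. ennreal (\<eta> powr (N - 1)) * ennreal (u (w + x) powr N) + ennreal (1 / \<eta>) * indicator E x \<partial>lborel)"
      using le \<eta> by (intro nn_integral_mono)
        (auto simp: indicator_def ennreal_mult'[symmetric] ennreal_plus[symmetric] add.commute[of w] simp del: ennreal_plus)
    also have "\<dots> = ennreal (\<eta> powr (N - 1)) * (\<integral>\<^sup>+x. ennreal (u (w + x) powr N) \<partial>lborel) + ennreal (1 / \<eta>) * ennreal m"
      by (subst nn_integral_add) (auto simp: nn_integral_cmult nn_integral_cmult_indicator E)
    also have "\<dots> \<le> ennreal (\<eta> powr (N - 1)) * ennreal (T powr N) + ennreal (1 / \<eta>) * ennreal m"
      using T(2) nn_integral_shift[of "\<lambda>w. ennreal (u w powr N)" w]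
      by (intro add_mono mult_left_mono) auto
    also have "\<dots> = ennreal (\<eta> powr (N - 1) * T powr N + m / \<eta>)"
      using \<eta> E by (simp add: ennreal_mult'[symmetric] ennreal_plus[symmetric] del: ennreal_plus)
    also have "\<eta> powr (N - 1) * T powr N + m / \<eta> = 2 * T * m powr (1 - 1 / N)"
    proof -
      have "\<eta> powr (N - 1) = m powr (1 - 1 / N) / T powr (N - 1)"
        using T E N_ge_2 by (simp add: \<eta>_def powr_divide powr_powr diff_divide_distrib right_diff_distrib)
      moreover have "T powr N = T powr (N - 1) * T"
        using T by (simp add: powr_diff)
      moreover have "m / \<eta> = m powr (1 - 1 / N) * T"
        using T E by (simp add: \<eta>_def powr_diff)
      ultimately show ?thesis using T by simp
    qed
    finally show ?thesis .
  qed
  have "(\<integral>\<^sup>+x. (\<integral>\<^sup>+w. ennreal (H w powr (1 - N) * u (x + w)) * indicator {w. H w \<le> \<rho>} w \<partial>lborel) * indicator E x \<partial>lborel)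
      = (\<integral>\<^sup>+x. (\<integral>\<^sup>+w. ennreal (H w powr (1 - N) * u (x + w)) * indicator {w. H w \<le> \<rho>} w * indicator E x \<partial>lborel) \<partial>lborel)"
    by (intro nn_integral_cong nn_integral_multc[symmetric]) measurable
  also have "\<dots> = (\<integral>\<^sup>+w. (\<integral>\<^sup>+x. ennreal (H w powr (1 - N) * u (x + w)) * indicator {w. H w \<le> \<rho>} w * indicator E x \<partial>lborel) \<partial>lborel)"
    by (rule lborel_pair.Fubini') measurable
  also have "\<dots> = (\<integral>\<^sup>+w. (\<integral>\<^sup>+x. (ennreal (H w powr (1 - N)) * indicator {w. H w \<le> \<rho>} w) * (ennreal (u (x + w)) * indicator E x) \<partial>lborel) \<partial>lborel)"
    using u by (intro nn_integral_cong) (simp add: ennreal_mult' mult_ac)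
  also have "\<dots> = (\<integral>\<^sup>+w. (ennreal (H w powr (1 - N)) * indicator {w. H w \<le> \<rho>} w) * (\<integral>\<^sup>+x. ennreal (u (x + w)) * indicator E x \<partial>lborel) \<partial>lborel)"
    by (intro nn_integral_cong nn_integral_cmult) measurable
  also have "\<dots> \<le> (\<integral>\<^sup>+w. (ennreal (H w powr (1 - N)) * indicator {w. H w \<le> \<rho>} w) * ennreal (2 * T * m powr (1 - 1 / N)) \<partial>lborel)"
    by (intro nn_integral_mono mult_left_mono inner) simp
  also have "\<dots> = (\<integral>\<^sup>+w. ennreal (H w powr (1 - N)) * indicator {w. H w \<le> \<rho>} w \<partial>lborel) * ennreal (2 * T * m powr (1 - 1 / N))"
    by (rule nn_integral_multc) measurable
  also have "(\<integral>\<^sup>+w. ennreal (H w powr (1 - N)) * indicator {w. H w \<le> \<rho>} w \<partial>lborel) = ennreal (N * \<kappa> * \<rho>)"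
    using nn_integral_polar_powr[of "1 - N" \<rho>] \<rho> by simp
  also have "ennreal (N * \<kappa> * \<rho>) * ennreal (2 * T * m powr (1 - 1 / N)) = ennreal (2 * T * m powr (1 - 1 / N) * (N * \<kappa> * \<rho>))"
    using \<rho> N_ge_2 kappa_pos T by (simp add: ennreal_mult'[symmetric] mult_ac)
  finally show ?thesis .
qed

lemma lambda_crit_eq: "lambda_crit F = N powr (N / (N - 1)) * \<kappa> powr (1 / (N - 1))"
  by (simp add: lambda_crit_def Let_def N_eq)

lemma lambda_crit_pos: "lambda_crit F > 0"
  using N_ge_2 kappa_pos by (simp add: lambda_crit_eq)

text \<open>The summand 2 stems from the mean value in \<open>representation_bound\<close>, the other one from \<open>near_bound\<close>.\<close>

definition threshold :: "real \<Rightarrow> real" where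
  "threshold T = 2 + 2 * T * \<kappa> powr (- 1 / N)"

lemma level_set_bound:
  assumes f: "C_on 1 UNIV f" and q: "q \<ge> 1" and T: "T > 0" and Q: "Q > 0"
    and grad: "(\<integral>\<^sup>+x. ennreal (F (grad f x) powr N) \<partial>lborel) \<le> ennreal (T powr N)"
    and norm: "(\<integral>\<^sup>+x. ennreal (\<bar>f x\<bar> powr q) \<partial>lborel) \<le> ennreal Q"
    and s: "s > threshold T"
  shows "emeasure lborel {x. s < \<bar>f x\<bar>} \<le>
    ennreal (Q * exp (- (lambda_crit F / T powr (N / (N - 1))) * (s - threshold T) powr (N / (N - 1))))"
proof -
  have [measurable]: "grad f \<in> borel_measurable borel" "f \<in> borel_measurable borel"
    using C1_continuous_grad[OF f] C_on_Suc_imp[of 0 UNIV f] f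
    by (auto intro!: borel_measurable_continuous_onI)
  let ?u = "\<lambda>y. F (grad f y)"
  let ?E = "{x. s < \<bar>f x\<bar>}"
  have s0: "s > 0" using s T by (simp add: threshold_def add_pos_pos) (smt (verit) mult_nonneg_nonneg powr_ge_zero)
  \<comment> \<open>Markov's inequality: the level set has finite measure, so \<open>m\<close> may
    be taken real and divided by.\<close>
  have "ennreal (s powr q) * emeasure lborel ?E = (\<integral>\<^sup>+x. ennreal (s powr q) * indicator ?E x \<partial>lborel)"
    by (subst nn_integral_cmult_indicator) auto
  also have "\<dots> \<le> (\<integral>\<^sup>+x. ennreal (\<bar>f x\<bar> powr q) \<partial>lborel)"
    using s0 q by (intro nn_integral_mono) (auto simp: indicator_def intro!: powr_mono2)
  also have "\<dots> \<le> ennreal Q" by (rule norm)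
  finally have "emeasure lborel ?E \<noteq> \<infinity>"
    using s0 by (auto simp: ennreal_mult_top top_unique)
  then obtain m where m: "emeasure lborel ?E = ennreal m" "m \<ge> 0"
    by (cases "emeasure lborel ?E") auto
  show ?thesis
  proof (cases "m = 0")
    case False
    then have mp: "m > 0" using m by simp
    \<comment> \<open>\<open>R\<close> and \<open>\<rho>\<close> are the radii of the polar balls of
      measure \<open>Q\<close> and \<open>m\<close>.\<close>
    define R where "R = (Q / \<kappa>) powr (1 / N)"
    define \<rho> where "\<rho> = (m / \<kappa>) powr (1 / N)"
    have R: "R > 0" "\<kappa> * R powr N = Q" and \<rho>: "\<rho> > 0" "\<kappa> * \<rho> powr N = m"
      using Q mp kappa_pos N_ge_2 by (auto simp: R_def \<rho>_def powr_powr)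
    define far where "far = (N * \<kappa> * max 0 (ln (R / \<rho>))) powr ((N - 1) / N) * T"
    have far0: "far \<ge> 0" using T by (simp add: far_def)
    define c where "c = Q / (N * \<kappa>)"
    have c: "c > 0" "R powr N / N = c" using Q kappa_pos N_ge_2 R by (auto simp: c_def field_simps)
    let ?near = "\<lambda>x. \<integral>\<^sup>+w. ennreal (H w powr (1 - N) * ?u (x + w)) * indicator {w. H w \<le> \<rho>} w \<partial>lborel"
    \<comment> \<open>From \<open>\<bar>f\<bar> \<le> 1 + \<bar>f\<bar> powr q\<close>: the ball has
      measure \<open>Q\<close>, and so is the integral of the power bounded. Divided by
      \<open>Q\<close>, this is the summand 2 of \<open>threshold\<close>.\<close>
    have avg: "(\<integral>\<^sup>+z. ennreal \<bar>f (x + z)\<bar> * indicator {z. H z \<le> R} z \<partial>lborel) \<le> ennreal (2 * Q)" for x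
    proof -
      have "(\<integral>\<^sup>+z. ennreal \<bar>f (x + z)\<bar> * indicator {z. H z \<le> R} z \<partial>lborel) \<le>
          (\<integral>\<^sup>+z. indicator {z. H z \<le> R} z + ennreal (\<bar>f (x + z)\<bar> powr q) \<partial>lborel)"
      proof (intro nn_integral_mono)
        fix z
        have "\<bar>f (x + z)\<bar> \<le> 1 + \<bar>f (x + z)\<bar> powr q"
        proof (cases "\<bar>f (x + z)\<bar> \<le> 1")
          case False
          then have "\<bar>f (x + z)\<bar> powr 1 \<le> \<bar>f (x + z)\<bar> powr q" using q by (intro powr_mono) auto
          then show ?thesis using False by simp
        qed (simp add: add_increasing2)
        then have "ennreal \<bar>f (x + z)\<bar> \<le> 1 + ennreal (\<bar>f (x + z)\<bar> powr q)"
          by (metis ennreal_1 ennreal_leI ennreal_plus powr_ge_zero zero_le_one)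
        then show "ennreal \<bar>f (x + z)\<bar> * indicator {z. H z \<le> R} z \<le> indicator {z. H z \<le> R} z + ennreal (\<bar>f (x + z)\<bar> powr q)"
          by (auto simp: indicator_def)
      qed
      also have "\<dots> = emeasure lborel {z. H z \<le> R} + (\<integral>\<^sup>+z. ennreal (\<bar>f (x + z)\<bar> powr q) \<partial>lborel)"
        by (subst nn_integral_add) auto
      also have "\<dots> \<le> ennreal Q + ennreal Q"
        using R norm nn_integral_shift[of "\<lambda>w. ennreal (\<bar>f w\<bar> powr q)" x]
        by (intro add_mono) (auto simp: polar_ball_emeasure)
      also have "\<dots> = ennreal (2 * Q)" using Q by (simp add: ennreal_plus[symmetric] del: ennreal_plus)
      finally show ?thesis .
    qed
    have pw: "ennreal Q * ennreal \<bar>f x\<bar> \<le> ennreal (2 * Q + c * far) + ennreal c * ?near x" for x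
    proof -
      have "(\<integral>\<^sup>+w. ennreal (H w powr (1 - N) * ?u (x + w)) * indicator {w. H w \<le> R} w \<partial>lborel) \<le>
        (\<integral>\<^sup>+w. ennreal (H w powr (1 - N) * ?u (x + w)) * indicator {w. \<rho> < H w \<and> H w \<le> R} w +
           ennreal (H w powr (1 - N) * ?u (x + w)) * indicator {w. H w \<le> \<rho>} w \<partial>lborel)"
        by (intro nn_integral_mono) (auto simp: indicator_def)
      also have "\<dots> = (\<integral>\<^sup>+w. ennreal (H w powr (1 - N) * ?u (x + w)) * indicator {w. \<rho> < H w \<and> H w \<le> R} w \<partial>lborel) + ?near x"
        by (rule nn_integral_add) measurable
      also have "\<dots> \<le> ennreal far + ?near x"
        unfolding far_def using R \<rho> T grad F_nonneg by (intro add_right_mono far_bound) auto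
      finally have 1: "(\<integral>\<^sup>+w. ennreal (H w powr (1 - N) * ?u (x + w)) * indicator {w. H w \<le> R} w \<partial>lborel) \<le> ennreal far + ?near x" .
      have "ennreal Q * ennreal \<bar>f x\<bar> \<le> ennreal (2 * Q) + ennreal c * (ennreal far + ?near x)"
        using representation_bound[OF f R(1), of x] unfolding R(2) c(2)
        by (rule order_trans) (intro add_mono mult_left_mono avg 1, simp)
      also have "\<dots> = ennreal (2 * Q + c * far) + ennreal c * ?near x"
        using c far0 Q by (simp add: distrib_left ennreal_mult'[symmetric] add.assoc)
      finally show ?thesis .
    qed
    have "ennreal (Q * s * m) = (\<integral>\<^sup>+x. ennreal (Q * s) * indicator ?E x \<partial>lborel)"
      using Q s0 m by (subst nn_integral_cmult_indicator) (auto simp: ennreal_mult')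
    also have "\<dots> \<le> (\<integral>\<^sup>+x. (ennreal Q * ennreal \<bar>f x\<bar>) * indicator ?E x \<partial>lborel)"
      using Q by (intro nn_integral_mono) (auto simp: indicator_def ennreal_mult'[symmetric] intro!: ennreal_leI)
    also have "\<dots> \<le> (\<integral>\<^sup>+x. ennreal (2 * Q + c * far) * indicator ?E x + ennreal c * (?near x * indicator ?E x) \<partial>lborel)"
      using pw by (intro nn_integral_mono) (auto simp: indicator_def)
    also have "\<dots> = ennreal (2 * Q + c * far) * ennreal m + ennreal c * (\<integral>\<^sup>+x. ?near x * indicator ?E x \<partial>lborel)"
      by (subst nn_integral_add) (auto simp: nn_integral_cmult nn_integral_cmult_indicator m)
    also have "\<dots> \<le> ennreal (2 * Q + c * far) * ennreal m + ennreal c * ennreal (2 * T * m powr (1 - 1 / N) * (N * \<kappa> * \<rho>))"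
      using T \<rho> mp grad F_nonneg m by (intro add_left_mono mult_left_mono near_bound) auto
    also have "\<dots> = ennreal ((2 * Q + c * far) * m + c * (2 * T * m powr (1 - 1 / N) * (N * \<kappa> * \<rho>)))"
      using c far0 Q mp T N_ge_2 kappa_pos \<rho>
      by (simp add: ennreal_mult'[symmetric] ennreal_plus[symmetric] del: ennreal_plus)
    finally have main: "Q * s * m \<le> (2 * Q + c * far) * m + c * (2 * T * m powr (1 - 1 / N) * (N * \<kappa> * \<rho>))"
      using c far0 Q mp T N_ge_2 kappa_pos \<rho> by (subst (asm) ennreal_le_iff) auto
    \<comment> \<open>The inner contribution is linear in \<open>m\<close>; division of the
      integrated inequality by \<open>Q * m\<close> leaves a constant.\<close>
    have "m powr (1 - 1 / N) * \<rho> = m * \<kappa> powr (- 1 / N)"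
      using mp kappa_pos by (simp add: \<rho>_def powr_divide powr_diff powr_minus field_simps)
    then have "c * (2 * T * m powr (1 - 1 / N) * (N * \<kappa> * \<rho>)) = c * N * \<kappa> * 2 * T * (m * \<kappa> powr (- 1 / N))"
      by (metis (no_types, opaque_lifting) mult.assoc mult.left_commute)
    also have "\<dots> = Q * (2 * T * \<kappa> powr (- 1 / N)) * m"
      using kappa_pos N_ge_2 by (simp add: c_def)
    finally have near: "c * (2 * T * m powr (1 - 1 / N) * (N * \<kappa> * \<rho>)) = Q * (2 * T * \<kappa> powr (- 1 / N)) * m" .
    have "Q * m * s \<le> Q * m * (threshold T + far / (N * \<kappa>))"
      using main[unfolded near] N_ge_2 kappa_pos by (simp add: threshold_def c_def algebra_simps)
    then have sle: "s - threshold T \<le> far / (N * \<kappa>)"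
      using Q mp by simp
    define l where "l = ln (R / \<rho>)"
    \<comment> \<open>If the logarithm were not positive, the outer part would vanish and
      \<open>s\<close> could not exceed the threshold.\<close>
    have l: "l > 0"
    proof (rule ccontr)
      assume "\<not> l > 0"
      then have "far = 0" by (simp add: far_def l_def)
      then show False using sle s by simp
    qed
    have NN: "(N - 1) / N * (N / (N - 1)) = 1" "N / (N - 1) = 1 + 1 / (N - 1)"
      using N_ge_2 by (auto simp: field_simps)
    have "(s - threshold T) powr (N / (N - 1)) \<le> (far / (N * \<kappa>)) powr (N / (N - 1))"
      using sle s N_ge_2 by (intro powr_mono2) auto
    also have "\<dots> = (N * \<kappa> * l) * T powr (N / (N - 1)) / (N * \<kappa>) powr (N / (N - 1))"
      using l N_ge_2 kappa_pos T NN(1) by (simp add: far_def l_def[symmetric] powr_divide powr_mult powr_powr)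
    \<comment> \<open>Origin of \<open>lambda_crit\<close>: the kernel constant raised to the power
      \<open>N / (N - 1)\<close>, with one factor \<open>\<kappa>\<close> going to the logarithmic
      term.\<close>
    also have "(N * \<kappa>) powr (N / (N - 1)) = lambda_crit F * \<kappa>"
      using kappa_pos N_ge_2 unfolding lambda_crit_eq NN(2) by (simp add: powr_mult powr_add)
    finally have *: "(lambda_crit F / T powr (N / (N - 1))) * (s - threshold T) powr (N / (N - 1)) \<le> N * l"
      using lambda_crit_pos T kappa_pos by (simp add: field_simps)
    have "N * l = ln ((R / \<rho>) powr N)"
      using R \<rho> by (simp add: l_def ln_powr)
    \<comment> \<open>The ratio of the two volumes; the bound on \<open>m\<close> thereby becomes
      linear in \<open>Q\<close>.\<close>
    also have "(R / \<rho>) powr N = Q / m"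
      using R \<rho> kappa_pos N_ge_2 by (simp add: R_def \<rho>_def powr_divide powr_powr Q mp less_imp_le)
    finally have "Q / m = exp (N * l)"
      using Q mp by simp
    then have "m = Q * exp (- (N * l))"
      using mp Q by (simp add: exp_minus field_simps)
    also have "\<dots> \<le> Q * exp (- (lambda_crit F / T powr (N / (N - 1))) * (s - threshold T) powr (N / (N - 1)))"
      using * Q by (intro mult_left_mono) auto
    finally show ?thesis unfolding m(1) by (rule ennreal_leI)
  qed (simp add: m)
qed

end

section \<open>Passage to the completion\<close>

text \<open>Either \<open>c \<le> \<tau> * a\<close> or \<open>a \<le> c / \<tau>\<close>. A small
  \<open>\<tau>\<close> puts the coefficient of the main term close to 1, at the expense of the
  error term; approximation thus spoils the energy bound by as little as desired.\<close>

lemma powr_add_le: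
  fixes a c :: real
  assumes "a \<ge> 0" "c \<ge> 0" "\<tau> > 0" "s \<ge> 0"
  shows "(a + c) powr s \<le> (1 + \<tau>) powr s * a powr s + (1 + 1 / \<tau>) powr s * c powr s"
proof (cases "c \<le> \<tau> * a")
  case True
  then have "(a + c) powr s \<le> ((1 + \<tau>) * a) powr s"
    using assms by (intro powr_mono2) (auto simp: algebra_simps)
  also have "\<dots> = (1 + \<tau>) powr s * a powr s"
    using assms by (simp add: powr_mult)
  finally show ?thesis by (simp add: add_increasing2)
next
  case False
  then have "a \<le> c / \<tau>" using assms by (simp add: field_simps)
  then have "(a + c) powr s \<le> ((1 + 1 / \<tau>) * c) powr s"
    using assms by (intro powr_mono2) (auto simp: algebra_simps)
  also have "\<dots> = (1 + 1 / \<tau>) powr s * c powr s"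
    using assms by (simp add: powr_mult)
  finally show ?thesis by (simp add: add_increasing)
qed

section \<open>Membership in Lebesgue spaces\<close>

lemma in_Lp_diff:
  assumes f: "in_Lp s f" and g: "in_Lp s g" and s: "s \<ge> 0"
  shows "in_Lp s (\<lambda>x. f x - g x)"
proof -
  have [measurable]: "f \<in> borel_measurable lebesgue" "g \<in> borel_measurable lebesgue"
    using f g by (auto simp: in_Lp_def)
  have "integrable lebesgue (\<lambda>x. norm (f x - g x) powr s)"
  proof (rule Bochner_Integration.integrable_bound)
    show "integrable lebesgue (\<lambda>x. (1 + 1) powr s * norm (f x) powr s + (1 + 1 / 1) powr s * norm (g x) powr s)"
      using f g by (auto simp: in_Lp_def)
    have "norm (f x - g x) powr s \<le> (1 + 1) powr s * norm (f x) powr s + (1 + 1 / 1) powr s * norm (g x) powr s" for x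
      using powr_mono2[OF s _ norm_triangle_ineq4[of "f x" "g x"]] powr_add_le[of "norm (f x)" "norm (g x)" 1 s] s
      by simp
    then show "AE x in lebesgue. norm (norm (f x - g x) powr s) \<le>
        norm ((1 + 1) powr s * norm (f x) powr s + (1 + 1 / 1) powr s * norm (g x) powr s)"
      by (intro AE_I2) (smt (verit) powr_ge_zero real_norm_def)
  qed measurable
  then show ?thesis by (simp add: in_Lp_def)
qed

lemma test_function_C_on: "test_function f \<Longrightarrow> C_on k UNIV f"
  by (simp add: test_function_def)

lemma grad_eq_0_outside_support:
  assumes "x \<notin> closure {x. f x \<noteq> 0}"
  shows "grad f x = 0"
proof -
  have "(f has_derivative (\<lambda>_. 0)) (at x)"
  proof (rule has_derivative_transform_within_open[of "\<lambda>_. 0"])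
    show "open (- closure {x. f x \<noteq> 0})" "x \<in> - closure {x. f x \<noteq> 0}"
      using assms by auto
    show "0 = f y" if "y \<in> - closure {x. f x \<noteq> 0}" for y
      using that closure_subset[of "{x. f x \<noteq> 0}"] by auto
  qed simp
  then have "frechet_derivative f (at x) = (\<lambda>_. 0)"
    by (metis frechet_derivative_at)
  then show ?thesis
    by (simp add: grad_def dir_deriv_def vec_eq_iff)
qed

lemma in_Lp_compact_support:
  fixes f :: "real^'n \<Rightarrow> 'b::euclidean_space"
  assumes f: "continuous_on UNIV f" and K: "compact K" and z: "\<And>x. x \<notin> K \<Longrightarrow> f x = 0" and s: "s > 0"
  shows "in_Lp s f"
proof -
  have [measurable]: "f \<in> borel_measurable borel"
    using f by (rule borel_measurable_continuous_onI)
  have "integrable lborel (\<lambda>x. indicator K x *\<^sub>R (norm (f x) powr s))"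
    using f s by (intro borel_integrable_compact K continuous_on_powr' continuous_intros)
      (auto intro: continuous_on_subset)
  also have "(\<lambda>x. indicator K x *\<^sub>R (norm (f x) powr s)) = (\<lambda>x. norm (f x) powr s)"
    using z s by (auto simp: fun_eq_iff indicator_def)
  finally show ?thesis
    unfolding in_Lp_def by (simp add: integrable_completion measurable_completion)
qed

lemma test_function_in_Lp:
  assumes "test_function f" "s > 0"
  shows "in_Lp s f" "in_Lp s (grad f)"
proof -
  have K: "compact (closure {x. f x \<noteq> 0})"
    using assms by (simp add: test_function_def)
  have 1: "C_on 1 UNIV f" "C_on 0 UNIV f"
    using assms(1) by (auto dest: test_function_C_on simp del: C_on.simps)
  show "in_Lp s f"
    using 1 closure_subset[of "{x. f x \<noteq> 0}"] by (intro in_Lp_compact_support[OF _ K] assms) auto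
  show "in_Lp s (grad f)"
    by (intro in_Lp_compact_support[OF _ K] assms C1_continuous_grad 1 grad_eq_0_outside_support)
qed

lemma nn_integral_in_Lp:
  assumes "in_Lp s f" "s > 0"
  shows "(\<integral>\<^sup>+x. ennreal (norm (f x) powr s) \<partial>lebesgue) = ennreal (Lp_norm s f powr s)"
  using assms unfolding in_Lp_def Lp_norm_def
  by (subst nn_integral_eq_integral) (auto simp: powr_powr)

context finsler_norm
begin

lemma F_comp_in_Lp:
  assumes "in_Lp s g" and s: "s \<ge> 0"
  shows "in_Lp s (\<lambda>x. F (g x))"
proof -
  have [measurable]: "g \<in> borel_measurable lebesgue"
    using assms by (auto simp: in_Lp_def)
  obtain b where b: "b > 0" "\<And>x. F x \<le> b * norm x"
    using F_bounds by blast
  have "integrable lebesgue (\<lambda>x. F (g x) powr s)"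
  proof (rule Bochner_Integration.integrable_bound)
    show "integrable lebesgue (\<lambda>x. b powr s * norm (g x) powr s)"
      using assms by (auto simp: in_Lp_def)
    have "F (g x) powr s \<le> b powr s * norm (g x) powr s" for x
      using powr_mono2[OF s F_nonneg b(2)[of "g x"]] b by (simp add: powr_mult)
    then show "AE x in lebesgue. norm (F (g x) powr s) \<le> norm (b powr s * norm (g x) powr s)"
      by simp
  qed measurable
  then show ?thesis
    by (simp add: in_Lp_def F_nonneg)
qed

text \<open>Approximating test functions may have energy slightly above 1, so the bound is by some
  \<open>T > 1\<close>. The error in \<open>u\<close> is measured by its power integral, ready for
  Markov's inequality.\<close>

lemma DNq_approximation:
  assumes u: "DNq_gradient q u g" and q: "q \<ge> 1" and g1: "Lp_norm N (\<lambda>x. F (g x)) \<le> 1"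
    and T: "T > 1" and \<delta>: "\<delta> > 0"
  shows "\<exists>\<phi>. test_function \<phi> \<and>
    (\<integral>\<^sup>+x. ennreal (F (grad \<phi> x) powr N) \<partial>lebesgue) \<le> ennreal (T powr N) \<and>
    (\<integral>\<^sup>+x. ennreal (\<bar>\<phi> x - u x\<bar> powr q) \<partial>lebesgue) \<le> ennreal \<delta>"
proof -
  have N0: "N > 0" using N_ge_2 by simp
  obtain \<phi> where \<phi>: "\<And>k. test_function (\<phi> k)"
    "(\<lambda>k. Lp_norm N (\<lambda>x. grad (\<phi> k) x - g x) + Lp_norm q (\<lambda>x. \<phi> k x - u x)) \<longlonglongrightarrow> 0"
    using u by (auto simp: DNq_gradient_def N_eq)
  have Lp: "in_Lp q u" "in_Lp N g"
    using u by (auto simp: DNq_gradient_def N_eq)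
  have [measurable]: "u \<in> borel_measurable lebesgue" "g \<in> borel_measurable lebesgue"
    using Lp by (auto simp: in_Lp_def)
  obtain b where b: "b > 0" "\<And>x. F x \<le> b * norm x"
    using F_bounds by blast
  \<comment> \<open>Any \<open>\<tau>\<close> with \<open>1 + \<tau> < T\<close> makes
    \<open>A < T powr N\<close> and leaves the reserve \<open>T powr N - A\<close> for the gradient
    error.\<close>
  define \<tau> where "\<tau> = (T - 1) / 2"
  have \<tau>: "\<tau> > 0" "1 + \<tau> < T" using T by (auto simp: \<tau>_def field_simps)
  define A where "A = (1 + \<tau>) powr N"
  define B where "B = (1 + 1 / \<tau>) powr N * b powr N"
  have "1 + 1 / \<tau> > 0"
    using \<tau> by (simp add: add_pos_pos)
  then have AB: "A < T powr N" "A > 0" "B > 0"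
    using \<tau> b N0 by (auto simp: A_def B_def powr_less_mono2 intro: add_pos_pos)
  define \<epsilon> where "\<epsilon> = min (\<delta> powr (1 / q)) (((T powr N - A) / B) powr (1 / N))"
  have \<epsilon>: "\<epsilon> > 0" using \<delta> AB by (simp add: \<epsilon>_def)
  obtain k where k: "Lp_norm N (\<lambda>x. grad (\<phi> k) x - g x) + Lp_norm q (\<lambda>x. \<phi> k x - u x) < \<epsilon>"
    using order_tendstoD(2)[OF \<phi>(2) \<epsilon>] by (auto simp: eventually_sequentially)
  have nn: "Lp_norm N (\<lambda>x. grad (\<phi> k) x - g x) \<ge> 0" "Lp_norm q (\<lambda>x. \<phi> k x - u x) \<ge> 0"
    by (auto simp: Lp_norm_def)
  note L\<phi> = test_function_in_Lp[OF \<phi>(1)[of k]]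
  have [measurable]: "grad (\<phi> k) \<in> borel_measurable lebesgue"
    using L\<phi>(2)[of 1] by (auto simp: in_Lp_def)
  have dq: "in_Lp q (\<lambda>x. \<phi> k x - u x)" and dN: "in_Lp N (\<lambda>x. grad (\<phi> k) x - g x)"
    using q N0 by (auto intro!: in_Lp_diff L\<phi> Lp)
  have "(\<integral>\<^sup>+x. ennreal (\<bar>\<phi> k x - u x\<bar> powr q) \<partial>lebesgue) = ennreal (Lp_norm q (\<lambda>x. \<phi> k x - u x) powr q)"
    using nn_integral_in_Lp[OF dq] q by simp
  also have "\<dots> \<le> ennreal ((\<delta> powr (1 / q)) powr q)"
    using k nn q by (intro ennreal_leI powr_mono2) (auto simp: \<epsilon>_def)
  also have "(\<delta> powr (1 / q)) powr q = \<delta>"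
    using q \<delta> by (simp add: powr_powr)
  finally have 1: "(\<integral>\<^sup>+x. ennreal (\<bar>\<phi> k x - u x\<bar> powr q) \<partial>lebesgue) \<le> ennreal \<delta>" .
  have "(\<integral>\<^sup>+x. ennreal (norm (grad (\<phi> k) x - g x) powr N) \<partial>lebesgue) = ennreal (Lp_norm N (\<lambda>x. grad (\<phi> k) x - g x) powr N)"
    using nn_integral_in_Lp[OF dN] N0 by simp
  also have "\<dots> \<le> ennreal ((((T powr N - A) / B) powr (1 / N)) powr N)"
    using k nn N0 by (intro ennreal_leI powr_mono2) (auto simp: \<epsilon>_def)
  also have "(((T powr N - A) / B) powr (1 / N)) powr N = (T powr N - A) / B"
    using N0 AB by (simp add: powr_powr)
  finally have 2: "(\<integral>\<^sup>+x. ennreal (norm (grad (\<phi> k) x - g x) powr N) \<partial>lebesgue) \<le> ennreal ((T powr N - A) / B)" .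
  have "(\<integral>\<^sup>+x. ennreal (F (g x) powr N) \<partial>lebesgue) = ennreal (Lp_norm N (\<lambda>x. F (g x)) powr N)"
    using nn_integral_in_Lp[OF F_comp_in_Lp[OF Lp(2)]] N0 by (simp add: F_nonneg)
  also have "\<dots> \<le> ennreal (1 powr N)"
    using g1 N0 by (intro ennreal_leI powr_mono2) (auto simp: Lp_norm_def)
  finally have 3: "(\<integral>\<^sup>+x. ennreal (F (g x) powr N) \<partial>lebesgue) \<le> 1" by simp
  have pw: "F (grad (\<phi> k) x) powr N \<le> A * F (g x) powr N + B * norm (grad (\<phi> k) x - g x) powr N" for x
  proof -
    have "F (grad (\<phi> k) x) \<le> F (g x) + F (grad (\<phi> k) x - g x)"
      using F_add[of "g x" "grad (\<phi> k) x - g x"] by simp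
    also have "\<dots> \<le> F (g x) + b * norm (grad (\<phi> k) x - g x)"
      using b by simp
    finally have "F (grad (\<phi> k) x) powr N \<le> (F (g x) + b * norm (grad (\<phi> k) x - g x)) powr N"
      using F_nonneg N0 by (intro powr_mono2) auto
    also have "\<dots> \<le> A * F (g x) powr N + (1 + 1 / \<tau>) powr N * (b * norm (grad (\<phi> k) x - g x)) powr N"
      unfolding A_def using \<tau> b N0 F_nonneg by (intro powr_add_le) auto
    finally show ?thesis
      using b by (simp add: B_def powr_mult mult.assoc)
  qed
  have "(\<integral>\<^sup>+x. ennreal (F (grad (\<phi> k) x) powr N) \<partial>lebesgue) \<le>
      (\<integral>\<^sup>+x. ennreal A * ennreal (F (g x) powr N) + ennreal B * ennreal (norm (grad (\<phi> k) x - g x) powr N) \<partial>lebesgue)"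
    using pw AB by (intro nn_integral_mono) (simp add: ennreal_mult'[symmetric] ennreal_plus[symmetric] del: ennreal_plus)
  also have "\<dots> = ennreal A * (\<integral>\<^sup>+x. ennreal (F (g x) powr N) \<partial>lebesgue) +
      ennreal B * (\<integral>\<^sup>+x. ennreal (norm (grad (\<phi> k) x - g x) powr N) \<partial>lebesgue)"
    by (simp add: nn_integral_add nn_integral_cmult)
  also have "\<dots> \<le> ennreal A * 1 + ennreal B * ennreal ((T powr N - A) / B)"
    by (intro add_mono mult_left_mono 2 3) auto
  also have "\<dots> = ennreal (T powr N)"
    using AB by (simp add: ennreal_mult'[symmetric] ennreal_plus[symmetric] del: ennreal_plus)
  finally show ?thesis using 1 \<phi>(1) by blast
qed

text \<open>If \<open>\<bar>u x\<bar> > s\<close>, then \<open>\<bar>\<phi> x\<bar> > s - 1\<close>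
  or \<open>\<bar>\<phi> x - u x\<bar> \<ge> 1\<close>. The first set obeys the bound for test
  functions, the second has measure at most \<open>e\<close> by Markov's inequality, and
  \<open>e\<close> is arbitrary. One test function per \<open>e\<close> suffices, without
  convergence almost everywhere.\<close>

lemma DNq_level_set_bound:
  assumes u: "DNq_gradient q u g" and q: "q \<ge> 1" and g1: "Lp_norm N (\<lambda>x. F (g x)) \<le> 1"
    and T: "T > 1" and s: "s > threshold T + 1" and U: "Lp_norm q u powr q = U" "U > 0"
  shows "emeasure lebesgue {x. s < \<bar>u x\<bar>} \<le>
    ennreal (2 powr (q + 1) * U * exp (- (lambda_crit F / T powr (N / (N - 1))) * (s - 1 - threshold T) powr (N / (N - 1))))"
proof (rule ennreal_le_epsilon)
  let ?r = "2 powr (q + 1) * U * exp (- (lambda_crit F / T powr (N / (N - 1))) * (s - 1 - threshold T) powr (N / (N - 1)))"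
  fix e :: real assume e: "e > 0"
  have Lp: "in_Lp q u"
    using u by (auto simp: DNq_gradient_def)
  have [measurable]: "u \<in> borel_measurable lebesgue"
    using Lp by (auto simp: in_Lp_def)
  \<comment> \<open>The minimum serves twice: \<open>e\<close> bounds the exceptional set, and
    \<open>U\<close> keeps the power integral of \<open>\<phi>\<close> below
    \<open>2 powr (q + 1) * U\<close>.\<close>
  obtain \<phi> where \<phi>: "test_function \<phi>"
    "(\<integral>\<^sup>+x. ennreal (F (grad \<phi> x) powr N) \<partial>lebesgue) \<le> ennreal (T powr N)"
    "(\<integral>\<^sup>+x. ennreal (\<bar>\<phi> x - u x\<bar> powr q) \<partial>lebesgue) \<le> ennreal (min e U)"
    using DNq_approximation[OF u q g1 T, of "min e U"] e U by auto
  have C1: "C_on 1 UNIV \<phi>" by (rule test_function_C_on[OF \<phi>(1)])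
  have cont: "continuous_on UNIV \<phi>" using test_function_C_on[OF \<phi>(1), of 0] by simp
  have [measurable]: "\<phi> \<in> borel_measurable borel"
    using cont by (rule borel_measurable_continuous_onI)
  then have [measurable]: "\<phi> \<in> borel_measurable lebesgue"
    by (simp add: measurable_completion)
  have "(\<integral>\<^sup>+x. ennreal (\<bar>\<phi> x\<bar> powr q) \<partial>lborel) = (\<integral>\<^sup>+x. ennreal (\<bar>\<phi> x\<bar> powr q) \<partial>lebesgue)"
    by (simp add: nn_integral_completion)
  also have "\<dots> \<le> (\<integral>\<^sup>+x. ennreal (2 powr q) * ennreal (\<bar>u x\<bar> powr q) + ennreal (2 powr q) * ennreal (\<bar>\<phi> x - u x\<bar> powr q) \<partial>lebesgue)"
  proof (intro nn_integral_mono)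
    fix x
    have "\<bar>\<phi> x\<bar> powr q \<le> (\<bar>u x\<bar> + \<bar>\<phi> x - u x\<bar>) powr q"
      using q by (intro powr_mono2) auto
    also have "\<dots> \<le> 2 powr q * \<bar>u x\<bar> powr q + 2 powr q * \<bar>\<phi> x - u x\<bar> powr q"
      using powr_add_le[of "\<bar>u x\<bar>" "\<bar>\<phi> x - u x\<bar>" 1 q] q by simp
    finally show "ennreal (\<bar>\<phi> x\<bar> powr q) \<le> ennreal (2 powr q) * ennreal (\<bar>u x\<bar> powr q) + ennreal (2 powr q) * ennreal (\<bar>\<phi> x - u x\<bar> powr q)"
      by (simp add: ennreal_mult'[symmetric] ennreal_plus[symmetric] del: ennreal_plus)
  qed
  also have "\<dots> = ennreal (2 powr q) * (\<integral>\<^sup>+x. ennreal (\<bar>u x\<bar> powr q) \<partial>lebesgue) + ennreal (2 powr q) * (\<integral>\<^sup>+x. ennreal (\<bar>\<phi> x - u x\<bar> powr q) \<partial>lebesgue)"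
    by (simp add: nn_integral_add nn_integral_cmult)
  also have "\<dots> \<le> ennreal (2 powr q) * ennreal U + ennreal (2 powr q) * ennreal U"
    using nn_integral_in_Lp[OF Lp] q U \<phi>(3) by (intro add_mono mult_left_mono) (auto simp: ennreal_le_iff2 elim: order_trans)
  also have "\<dots> = ennreal (2 powr (q + 1) * U)"
    using U by (simp add: ennreal_mult'[symmetric] ennreal_plus[symmetric] powr_add del: ennreal_plus)
  finally have Q: "(\<integral>\<^sup>+x. ennreal (\<bar>\<phi> x\<bar> powr q) \<partial>lborel) \<le> ennreal (2 powr (q + 1) * U)" .
  have G: "(\<integral>\<^sup>+x. ennreal (F (grad \<phi> x) powr N) \<partial>lborel) \<le> ennreal (T powr N)"
    using \<phi>(2) by (simp add: nn_integral_completion)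
  have "emeasure lborel {x. s - 1 < \<bar>\<phi> x\<bar>} \<le> ennreal ?r"
    using level_set_bound[OF C1 q _ _ G Q, of "s - 1"] T U s by simp
  then have 1: "emeasure lebesgue {x. s - 1 < \<bar>\<phi> x\<bar>} \<le> ennreal ?r"
    by (simp add: emeasure_completion)
  have "{x \<in> space lebesgue. 1 \<le> \<bar>\<phi> x - u x\<bar>} \<in> sets lebesgue"
      "{x \<in> space lebesgue. s - 1 < \<bar>\<phi> x\<bar>} \<in> sets lebesgue"
    by measurable
  then have sets: "{x. 1 \<le> \<bar>\<phi> x - u x\<bar>} \<in> sets lebesgue"
      "{x. s - 1 < \<bar>\<phi> x\<bar>} \<in> sets lebesgue"
    by simp_all
  have "emeasure lebesgue {x. 1 \<le> \<bar>\<phi> x - u x\<bar>} = (\<integral>\<^sup>+x. indicator {x. 1 \<le> \<bar>\<phi> x - u x\<bar>} x \<partial>lebesgue)"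
    using sets by (subst nn_integral_indicator) auto
  also have "\<dots> \<le> (\<integral>\<^sup>+x. ennreal (\<bar>\<phi> x - u x\<bar> powr q) \<partial>lebesgue)"
    using q by (intro nn_integral_mono) (auto simp: indicator_def ennreal_ge_1 ge_one_powr_ge_zero)
  also have "\<dots> \<le> ennreal e"
    using \<phi>(3) e U by (auto simp: min_def split: if_splits elim!: order_trans intro!: ennreal_leI)
  finally have 2: "emeasure lebesgue {x. 1 \<le> \<bar>\<phi> x - u x\<bar>} \<le> ennreal e" .
  have "emeasure lebesgue {x. s < \<bar>u x\<bar>} \<le> emeasure lebesgue ({x. s - 1 < \<bar>\<phi> x\<bar>} \<union> {x. 1 \<le> \<bar>\<phi> x - u x\<bar>})"
  proof (rule emeasure_mono)
    have "s - 1 < \<bar>\<phi> x\<bar> \<or> 1 \<le> \<bar>\<phi> x - u x\<bar>" if "s < \<bar>u x\<bar>" for x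
      using that by linarith
    then show "{x. s < \<bar>u x\<bar>} \<subseteq> {x. s - 1 < \<bar>\<phi> x\<bar>} \<union> {x. 1 \<le> \<bar>\<phi> x - u x\<bar>}"
      by blast
  qed (use sets in blast)
  also have "\<dots> \<le> emeasure lebesgue {x. s - 1 < \<bar>\<phi> x\<bar>} + emeasure lebesgue {x. 1 \<le> \<bar>\<phi> x - u x\<bar>}"
    using sets by (intro emeasure_subadditive)
  also have "\<dots> \<le> ennreal ?r + ennreal e"
    by (intro add_mono 1 2)
  finally show "emeasure lebesgue {x. s < \<bar>u x\<bar>} \<le> ennreal ?r + ennreal e" .
qed

end

section \<open>The subcritical inequality\<close>

text \<open>Layers may overlap: they will be whole superlevel sets, whose measure is under control,
  and a point has to be charged to only one of them.\<close>

lemma nn_integral_layers: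
  fixes c d :: "nat \<Rightarrow> real" and h w :: "'a \<Rightarrow> ennreal"
  assumes [measurable]: "h \<in> borel_measurable M" "\<And>k. E k \<in> sets M"
    and layer: "\<And>x. w x = 0 \<or> (\<exists>k. x \<in> E k \<and> w x \<le> ennreal (c k) * h x)"
    and d: "\<And>k. (\<integral>\<^sup>+x. h x * indicator (E k) x \<partial>M) \<le> ennreal (d k)"
    and nonneg: "\<And>k. c k \<ge> 0" "\<And>k. d k \<ge> 0" and sm: "summable (\<lambda>k. c k * d k)"
  shows "(\<integral>\<^sup>+x. w x \<partial>M) \<le> ennreal (\<Sum>k. c k * d k)"
proof -
  have "w x \<le> (\<Sum>k. ennreal (c k) * (h x * indicator (E k) x))" for x
    using layer[of x]
  proof
    assume "\<exists>k. x \<in> E k \<and> w x \<le> ennreal (c k) * h x"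
    then obtain k where k: "x \<in> E k" "w x \<le> ennreal (c k) * h x" by blast
    have "ennreal (c k) * (h x * indicator (E k) x) \<le> (\<Sum>k. ennreal (c k) * (h x * indicator (E k) x))"
      using sum_le_suminf[of "\<lambda>k. ennreal (c k) * (h x * indicator (E k) x)" "{k}"] by simp
    then show ?thesis using k by simp
  qed simp
  then have "(\<integral>\<^sup>+x. w x \<partial>M) \<le> (\<integral>\<^sup>+x. (\<Sum>k. ennreal (c k) * (h x * indicator (E k) x)) \<partial>M)"
    by (intro nn_integral_mono)
  also have "\<dots> = (\<Sum>k. \<integral>\<^sup>+x. ennreal (c k) * (h x * indicator (E k) x) \<partial>M)"
    by (rule nn_integral_suminf) measurable
  also have "\<dots> = (\<Sum>k. ennreal (c k) * (\<integral>\<^sup>+x. h x * indicator (E k) x \<partial>M))"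
    by (intro suminf_cong nn_integral_cmult) measurable
  also have "\<dots> \<le> (\<Sum>k. ennreal (c k * d k))"
    using d nonneg by (intro suminf_le) (auto simp: ennreal_mult' intro!: mult_left_mono)
  also have "\<dots> = ennreal (\<Sum>k. c k * d k)"
    using nonneg sm by (intro suminf_ennreal2) auto
  finally show ?thesis .
qed

text \<open>\<open>ln y < y\<close> at \<open>y = \<epsilon> / (p + 1) * x\<close>; the denominator
  \<open>p + 1\<close> stays positive for \<open>p = 0\<close>.\<close>

lemma powr_le_exp:
  fixes p \<epsilon> x :: real
  assumes "p \<ge> 0" "\<epsilon> > 0" "x > 0"
  shows "x powr p \<le> ((p + 1) / \<epsilon>) powr p * exp (\<epsilon> * x)"
proof -
  have "ln (\<epsilon> / (p + 1) * x) \<le> \<epsilon> / (p + 1) * x"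
    using assms by (intro less_imp_le ln_less_self) auto
  then have "p * ln (\<epsilon> / (p + 1) * x) \<le> p * (\<epsilon> / (p + 1) * x)"
    using assms by (intro mult_left_mono) auto
  also have "\<dots> \<le> \<epsilon> * x"
    using assms by (auto simp: field_simps)
  finally have "exp (p * ln (\<epsilon> / (p + 1) * x)) \<le> exp (\<epsilon> * x)"
    by simp
  then have "(\<epsilon> / (p + 1) * x) powr p \<le> exp (\<epsilon> * x)"
    using assms by (simp add: powr_def)
  then show ?thesis
    using assms by (simp add: powr_divide powr_mult field_simps)
qed

text \<open>The shift by \<open>c\<close> costs only a factor tending to 1 in the base, so
  \<open>mu\<close> may be lowered slightly and still exceed \<open>lam\<close>. As
  \<open>a \<ge> 1\<close>, the remaining gap gives at least geometric decay.\<close>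

lemma summable_exp_gap:
  fixes lam mu a c M p \<theta> :: real
  assumes "0 \<le> lam" "lam < mu" "a \<ge> 1" "M \<ge> 0" "p \<ge> 0" "\<theta> > 0"
  shows "summable (\<lambda>k. exp (\<theta> * lam * (M + real k + 1) powr a) * (M + real k + 1) powr p *
    exp (- \<theta> * mu * (M + real k - c) powr a))" (is "summable ?f")
proof -
  define mu' where "mu' = (lam + mu) / 2"
  have mu': "lam < mu'" "mu' < mu" "mu' > 0" using assms by (auto simp: mu'_def)
  \<comment> \<open>Half of this rate will absorb the factor with exponent \<open>p\<close>, the
    other half is the rate of the geometric majorant.\<close>
  define \<epsilon> where "\<epsilon> = \<theta> * (mu' - lam)"
  have \<epsilon>: "\<epsilon> > 0" using mu' assms by (simp add: \<epsilon>_def)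
  have "((\<lambda>k. 1 - (c + 1) * inverse (M + 1 + real k)) \<longlongrightarrow> 1 - (c + 1) * 0) sequentially"
    by (intro tendsto_intros tendsto_inverse_0_at_top filterlim_tendsto_add_at_top[OF tendsto_const]
      filterlim_real_sequentially)
  then have "((\<lambda>k. (1 - (c + 1) * inverse (M + 1 + real k)) powr a) \<longlongrightarrow> (1 - (c + 1) * 0) powr a) sequentially"
    by (intro tendsto_powr tendsto_const) auto
  moreover have "mu' / mu < (1 - (c + 1) * 0) powr a"
    using mu' by simp
  ultimately have ev1: "\<forall>\<^sub>F k in sequentially. mu' / mu < (1 - (c + 1) * inverse (M + 1 + real k)) powr a"
    by (rule order_tendstoD)
  have ev2: "\<forall>\<^sub>F k in sequentially. real k \<ge> c"
    using filterlim_real_sequentially by (auto simp: filterlim_at_top)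
  define K where "K = ((p + 1) / (\<epsilon> / 2)) powr p * exp (- (\<epsilon> / 2) * (M + 1))"
  have "\<forall>\<^sub>F k in sequentially. norm (?f k) \<le> K * exp (- (\<epsilon> / 2)) ^ k"
    using ev1 ev2
  proof eventually_elim
    case (elim k)
    define x where "x = M + real k + 1"
    have x: "x \<ge> 1" using assms by (simp add: x_def)
    have "M + real k - c = (1 - (c + 1) * inverse x) * x"
      using x by (simp add: x_def field_simps)
    moreover have "1 - (c + 1) * inverse x \<ge> 0"
      using x elim(2) assms by (simp add: field_simps) (simp add: x_def)
    ultimately have "(M + real k - c) powr a = (1 - (c + 1) * inverse x) powr a * x powr a"
      using x by (simp add: powr_mult)
    also have "\<dots> \<ge> mu' / mu * x powr a"
      using elim(1) by (intro mult_right_mono) (auto simp: x_def add_ac)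
    finally have 1: "mu * (M + real k - c) powr a \<ge> mu' * x powr a"
      using mu' by (simp add: field_simps)
    have "x \<le> x powr a" using x assms powr_mono[of 1 a x] by simp
    then have "\<epsilon> * x \<le> \<epsilon> * x powr a" using \<epsilon> by simp
    moreover have "\<theta> * (mu' * x powr a) \<le> \<theta> * (mu * (M + real k - c) powr a)"
      using 1 assms by (intro mult_left_mono) auto
    ultimately have 2: "\<theta> * lam * x powr a + - \<theta> * mu * (M + real k - c) powr a \<le> - \<epsilon> * x"
      by (simp add: \<epsilon>_def algebra_simps)
    have "norm (?f k) = exp (\<theta> * lam * x powr a + - \<theta> * mu * (M + real k - c) powr a) * x powr p"
      unfolding exp_add by (simp add: x_def)
    also have "\<dots> \<le> exp (- \<epsilon> * x) * (((p + 1) / (\<epsilon> / 2)) powr p * exp (\<epsilon> / 2 * x))"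
      using 2 powr_le_exp[of p "\<epsilon> / 2" x] assms \<epsilon> x by (intro mult_mono) auto
    also have "\<dots> = ((p + 1) / (\<epsilon> / 2)) powr p * exp (- \<epsilon> * x + \<epsilon> / 2 * x)"
      unfolding exp_add by simp
    also have "- \<epsilon> * x + \<epsilon> / 2 * x = - (\<epsilon> / 2) * (M + 1) + real k * - (\<epsilon> / 2)"
      by (simp add: x_def field_simps)
    also have "((p + 1) / (\<epsilon> / 2)) powr p * exp \<dots> = K * exp (- (\<epsilon> / 2)) ^ k"
      unfolding exp_add K_def exp_of_nat_mult by simp
    finally show ?case .
  qed
  moreover have "summable (\<lambda>k. K * exp (- (\<epsilon> / 2)) ^ k)"
    using \<epsilon> by (intro summable_mult summable_geometric) auto
  ultimately show ?thesis
    by (rule summable_comparison_test_ev)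
qed

context finsler_norm
begin

section \<open>The singular weight, and small and large values of \<open>u\<close>\<close>

lemma polar_measurable_lebesgue [measurable]: "H \<in> borel_measurable lebesgue"
  by (simp add: measurable_completion)

text \<open>The summand \<open>N / (N - \<beta>)\<close> is the share of the polar ball of measure
  \<open>m\<close>, the summand 1 that of the part of the set outside this ball.\<close>

definition weight_const :: "real \<Rightarrow> real" where
  "weight_const \<beta> = \<kappa> powr (\<beta> / N) * (N / (N - \<beta>) + 1)"

text \<open>Among all sets of measure \<open>m\<close>, the polar ball carries the largest weight.\<close>

lemma weighted_measure_bound:
  assumes E: "E \<in> sets lebesgue" "emeasure lebesgue E \<le> ennreal m" "m \<ge> 0"
    and \<beta>: "0 \<le> \<beta>" "\<beta> < N"
  shows "(\<integral>\<^sup>+x. ennreal (H x powr (- \<beta>)) * indicator E x \<partial>lebesgue) \<le>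
    ennreal (weight_const \<beta> * m powr (1 - \<beta> / N))"
proof (cases "m = 0")
  case True
  then have "E \<in> null_sets lebesgue" using E by (auto simp: null_sets_def)
  then have "(\<integral>\<^sup>+x. ennreal (H x powr (- \<beta>)) * indicator E x \<partial>lebesgue) = 0"
    by (simp add: nn_integral_null_set)
  then show ?thesis by simp
next
  case False
  then have m: "m > 0" using E by simp
  \<comment> \<open>The ball of this radius has measure \<open>m\<close>; outside it the weight is
    at most \<open>\<rho> powr (- \<beta>)\<close>.\<close>
  define \<rho> where "\<rho> = (m / \<kappa>) powr (1 / N)"
  have \<rho>: "\<rho> > 0" using m kappa_pos by (simp add: \<rho>_def)
  note [measurable] = E(1)
  have "(\<integral>\<^sup>+x. ennreal (H x powr (- \<beta>)) * indicator E x \<partial>lebesgue) \<le>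
      (\<integral>\<^sup>+x. ennreal (H x powr (- \<beta>)) * indicator {x. H x \<le> \<rho>} x + ennreal (\<rho> powr (- \<beta>)) * indicator E x \<partial>lebesgue)"
  proof (intro nn_integral_mono)
    fix x
    have "H x powr (- \<beta>) \<le> \<rho> powr (- \<beta>)" if "\<not> H x \<le> \<rho>"
      using that \<beta> \<rho> by (intro powr_mono2') auto
    then show "ennreal (H x powr (- \<beta>)) * indicator E x \<le>
        ennreal (H x powr (- \<beta>)) * indicator {x. H x \<le> \<rho>} x + ennreal (\<rho> powr (- \<beta>)) * indicator E x"
      by (auto simp: indicator_def intro: ennreal_leI)
  qed
  also have "\<dots> = (\<integral>\<^sup>+x. ennreal (H x powr (- \<beta>)) * indicator {x. H x \<le> \<rho>} x \<partial>lebesgue) + ennreal (\<rho> powr (- \<beta>)) * emeasure lebesgue E"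
    by (subst nn_integral_add) (auto simp: nn_integral_cmult_indicator)
  also have "(\<integral>\<^sup>+x. ennreal (H x powr (- \<beta>)) * indicator {x. H x \<le> \<rho>} x \<partial>lebesgue) = ennreal (N * \<kappa> * \<rho> powr (N - \<beta>) / (N - \<beta>))"
    using nn_integral_polar_powr[of "- \<beta>" \<rho>] \<beta> \<rho> by (simp add: nn_integral_completion)
  also have "\<dots> + ennreal (\<rho> powr (- \<beta>)) * emeasure lebesgue E \<le> \<dots> + ennreal (\<rho> powr (- \<beta>)) * ennreal m"
    by (intro add_left_mono mult_left_mono E) simp
  also have "\<dots> = ennreal (N * \<kappa> * \<rho> powr (N - \<beta>) / (N - \<beta>) + \<rho> powr (- \<beta>) * m)"
    using \<beta> m kappa_pos N_ge_2 by (simp add: ennreal_mult'[symmetric] ennreal_plus[symmetric] del: ennreal_plus)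
  also have "N * \<kappa> * \<rho> powr (N - \<beta>) / (N - \<beta>) + \<rho> powr (- \<beta>) * m = weight_const \<beta> * m powr (1 - \<beta> / N)"
  proof -
    have "\<rho> powr (- \<beta>) * m = \<kappa> powr (\<beta> / N) * m powr (1 - \<beta> / N)"
      using m kappa_pos by (simp add: \<rho>_def powr_powr powr_divide powr_minus powr_diff field_simps)
    moreover have "\<kappa> * \<rho> powr (N - \<beta>) = \<rho> powr (- \<beta>) * m"
    proof -
      have "\<kappa> * \<rho> powr N = m" using m kappa_pos N_ge_2 by (simp add: \<rho>_def powr_powr)
      then show ?thesis using powr_add[of \<rho> N "- \<beta>"] by (simp add: mult.commute mult.left_commute)
    qed
    ultimately show ?thesis
      by (simp add: weight_const_def algebra_simps)
  qed
  finally show ?thesis .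
qed

text \<open>For \<open>\<beta> = 0\<close> and \<open>p \<ge> q\<close> the estimate is pointwise.
  Otherwise values are grouped dyadically: Markov's inequality bounds each superlevel set, the
  weight raises its measure to the power \<open>1 - \<beta> / N\<close>, and the contributions decay
  geometrically since \<open>p > q * (1 - \<beta> / N)\<close>.\<close>

lemma small_values_bound:
  assumes \<beta>: "0 \<le> \<beta>" "\<beta> < N" and q: "q \<ge> 1" and M: "M > 0"
    and pq: "p > q * (1 - \<beta> / N) \<or> \<beta> = 0 \<and> p \<ge> q"
  shows "\<exists>C\<ge>0. \<forall>u. in_Lp q u \<longrightarrow>
    (\<integral>\<^sup>+x. ennreal (\<bar>u x\<bar> powr p * H x powr (- \<beta>)) * indicator {x. \<bar>u x\<bar> \<le> M} x \<partial>lebesgue)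
      \<le> ennreal (C * (Lp_norm q u powr q) powr (1 - \<beta> / N))"
  using pq
proof
  assume pq: "\<beta> = 0 \<and> p \<ge> q"
  show ?thesis
  proof (intro exI[of _ "M powr (p - q)"] conjI allI impI)
    fix u :: "real^'n \<Rightarrow> real" assume u: "in_Lp q u"
    then have [measurable]: "u \<in> borel_measurable lebesgue" by (auto simp: in_Lp_def)
    have "(\<integral>\<^sup>+x. ennreal (\<bar>u x\<bar> powr p * H x powr (- \<beta>)) * indicator {x. \<bar>u x\<bar> \<le> M} x \<partial>lebesgue) \<le>
      (\<integral>\<^sup>+x. ennreal (M powr (p - q)) * ennreal (\<bar>u x\<bar> powr q) \<partial>lebesgue)"
    proof (intro nn_integral_mono)
      fix x
      have "\<bar>u x\<bar> powr p * H x powr (- \<beta>) \<le> M powr (p - q) * \<bar>u x\<bar> powr q" if "\<bar>u x\<bar> \<le> M"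
      proof -
        have "\<bar>u x\<bar> powr p = \<bar>u x\<bar> powr (p - q) * \<bar>u x\<bar> powr q"
          by (simp add: powr_add[symmetric])
        also have "\<dots> \<le> M powr (p - q) * \<bar>u x\<bar> powr q"
          using that pq by (intro mult_right_mono powr_mono2) auto
        finally show ?thesis using pq by (cases "H x = 0") auto
      qed
      then show "ennreal (\<bar>u x\<bar> powr p * H x powr (- \<beta>)) * indicator {x. \<bar>u x\<bar> \<le> M} x
          \<le> ennreal (M powr (p - q)) * ennreal (\<bar>u x\<bar> powr q)"
        by (auto simp: indicator_def ennreal_mult'[symmetric] intro!: ennreal_leI)
    qed
    also have "\<dots> = ennreal (M powr (p - q) * (Lp_norm q u powr q) powr (1 - \<beta> / N))"
      using nn_integral_in_Lp[OF u] q pq by (simp add: nn_integral_cmult ennreal_mult' Lp_norm_def)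
    finally show "(\<integral>\<^sup>+x. ennreal (\<bar>u x\<bar> powr p * H x powr (- \<beta>)) * indicator {x. \<bar>u x\<bar> \<le> M} x \<partial>lebesgue)
      \<le> ennreal (M powr (p - q) * (Lp_norm q u powr q) powr (1 - \<beta> / N))" .
  qed simp
next
  assume pq: "p > q * (1 - \<beta> / N)"
  define \<theta> where "\<theta> = 1 - \<beta> / N"
  have \<theta>: "\<theta> > 0" using \<beta> by (simp add: \<theta>_def)
  have p: "p > 0" using pq \<theta> q less_le_trans[of 0 "q * \<theta>" p] by (simp add: \<theta>_def)
  \<comment> \<open>The ratio of the series; the strict inequality between \<open>p\<close> and
    \<open>q * \<theta>\<close> makes it less than 1.\<close>
  define r where "r = 2 powr (- (p - q * \<theta>))"
  have r: "0 < r" "r < 1" using pq by (auto simp: r_def \<theta>_def powr_less_one)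
  define B where "B = weight_const \<beta> * (M powr (p - q * \<theta>) * 2 powr (q * \<theta>))"
  have wc: "weight_const \<beta> \<ge> 0" using \<beta> N_ge_2 by (simp add: weight_const_def)
  have B: "B \<ge> 0" using wc by (simp add: B_def)
  show ?thesis
  proof (intro exI[of _ "B * (1 / (1 - r))"] conjI allI impI)
    show "B * (1 / (1 - r)) \<ge> 0" using B r by simp
    fix u :: "real^'n \<Rightarrow> real" assume u: "in_Lp q u"
    then have [measurable]: "u \<in> borel_measurable lebesgue" by (auto simp: in_Lp_def)
    define U where "U = Lp_norm q u powr q"
    have U: "U \<ge> 0" by (simp add: U_def)
    define c where "c j = (M * 2 powr (- real j)) powr p" for j
    \<comment> \<open>Layer \<open>j\<close> holds the values in the interval from
      \<open>t j\<close>, excluded, to \<open>2 * t j\<close>, included; \<open>c j\<close> is the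
      upper end raised to the power \<open>p\<close>.\<close>
    define t where "t j = M * 2 powr (- real j - 1)" for j
    have t: "t j > 0" for j using M by (simp add: t_def)
    define d where "d j = weight_const \<beta> * (U * t j powr (- q)) powr \<theta>" for j
    define E where "E j = {x. t j < \<bar>u x\<bar>}" for j
    have "{x \<in> space lebesgue. t j < \<bar>u x\<bar>} \<in> sets lebesgue" for j by measurable
    then have E[measurable]: "E j \<in> sets lebesgue" for j by (simp add: E_def)
    have Em: "emeasure lebesgue (E j) \<le> ennreal (U * t j powr (- q))" for j
    proof -
      have "emeasure lebesgue (E j) = (\<integral>\<^sup>+x. indicator (E j) x \<partial>lebesgue)"
        by (subst nn_integral_indicator) auto
      also have "\<dots> \<le> (\<integral>\<^sup>+x. ennreal (t j powr (- q)) * ennreal (\<bar>u x\<bar> powr q) \<partial>lebesgue)"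
      proof (intro nn_integral_mono)
        fix x
        have "1 \<le> t j powr (- q) * \<bar>u x\<bar> powr q" if "t j < \<bar>u x\<bar>"
          using that t[of j] q powr_mono2[of q "t j" "\<bar>u x\<bar>"] by (simp add: powr_minus field_simps)
        then show "indicator (E j) x \<le> ennreal (t j powr (- q)) * ennreal (\<bar>u x\<bar> powr q)"
          by (auto simp: indicator_def E_def ennreal_mult'[symmetric])
      qed
      also have "\<dots> = ennreal (U * t j powr (- q))"
        using nn_integral_in_Lp[OF u] q by (simp add: nn_integral_cmult ennreal_mult' U_def mult.commute)
      finally show ?thesis .
    qed
    have cd: "c j * d j = B * U powr \<theta> * r ^ j" for j
    proof -
      have "c j * d j = weight_const \<beta> * U powr \<theta> * (M powr p * M powr (- (q * \<theta>))) *
          (2 powr (- real j * p) * 2 powr (- (- real j - 1) * (q * \<theta>)))"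
        using M U by (simp add: c_def d_def t_def powr_mult powr_powr algebra_simps)
      also have "M powr p * M powr (- (q * \<theta>)) = M powr (p - q * \<theta>)"
        by (simp add: powr_add[symmetric])
      also have "2 powr (- real j * p) * 2 powr (- (- real j - 1) * (q * \<theta>)) = 2 powr (q * \<theta>) * r ^ j"
        unfolding r_def by (simp add: powr_add[symmetric] powr_realpow[symmetric] powr_powr algebra_simps)
      finally show ?thesis by (simp add: B_def)
    qed
    have sums: "(\<lambda>j. c j * d j) sums (B * U powr \<theta> * (1 / (1 - r)))"
      unfolding cd using r by (intro sums_mult geometric_sums) auto
    have "(\<integral>\<^sup>+x. ennreal (\<bar>u x\<bar> powr p * H x powr (- \<beta>)) * indicator {x. \<bar>u x\<bar> \<le> M} x \<partial>lebesgue)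
        \<le> ennreal (\<Sum>j. c j * d j)"
    proof (rule nn_integral_layers[where E=E and h="\<lambda>x. ennreal (H x powr (- \<beta>))"])
      show "(\<integral>\<^sup>+x. ennreal (H x powr - \<beta>) * indicator (E k) x \<partial>lebesgue) \<le> ennreal (d k)" for k
        unfolding d_def \<theta>_def using U Em by (intro weighted_measure_bound E \<beta>) auto
      show "0 \<le> c k" "0 \<le> d k" for k using wc by (auto simp: c_def d_def)
      show "summable (\<lambda>k. c k * d k)" using sums by (rule sums_summable)
      fix x
      show "ennreal (\<bar>u x\<bar> powr p * H x powr - \<beta>) * indicator {x. \<bar>u x\<bar> \<le> M} x = 0 \<or>
         (\<exists>k. x \<in> E k \<and> ennreal (\<bar>u x\<bar> powr p * H x powr - \<beta>) * indicator {x. \<bar>u x\<bar> \<le> M} x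
            \<le> ennreal (c k) * ennreal (H x powr - \<beta>))"
      proof (cases "u x = 0 \<or> \<bar>u x\<bar> > M")
        case False
        then have a: "0 < \<bar>u x\<bar>" "\<bar>u x\<bar> \<le> M" by auto
        define y where "y = log 2 (M / \<bar>u x\<bar>)"
        have y: "y \<ge> 0" "M = \<bar>u x\<bar> * 2 powr y" using a by (auto simp: y_def zero_le_log_cancel_iff field_simps)
        \<comment> \<open>The dyadic index of \<open>\<bar>u x\<bar>\<close>: rounding
          \<open>y\<close> down places the value strictly above \<open>t k\<close>.\<close>
        define k where "k = nat \<lfloor>y\<rfloor>"
        have k: "real k \<le> y" "y < real k + 1" using y(1) by (auto simp: k_def)
        have "t k = \<bar>u x\<bar> * 2 powr (y - real k - 1)"
          unfolding t_def by (subst y(2)) (simp add: powr_add[symmetric] algebra_simps)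
        also have "\<dots> < \<bar>u x\<bar> * 1"
          using a k by (intro mult_strict_left_mono powr_less_one) auto
        finally have "x \<in> E k" by (simp add: E_def)
        have "\<bar>u x\<bar> * 1 \<le> \<bar>u x\<bar> * 2 powr (y - real k)"
          using k by (intro mult_left_mono ge_one_powr_ge_zero) auto
        also have "\<dots> = M * 2 powr (- real k)"
          by (subst y(2)) (simp add: powr_add[symmetric] algebra_simps)
        finally have "\<bar>u x\<bar> powr p \<le> c k"
          unfolding c_def using p by (intro powr_mono2) auto
        then have "\<bar>u x\<bar> powr p * H x powr - \<beta> \<le> c k * H x powr - \<beta>"
          by (rule mult_right_mono) simp
        then show ?thesis using \<open>x \<in> E k\<close> a
          by (auto simp: ennreal_mult'[symmetric] c_def intro!: exI[of _ k] ennreal_leI)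
      qed (use p in auto)
    qed measurable
    also have "(\<Sum>j. c j * d j) = B * (1 / (1 - r)) * U powr \<theta>"
      using sums_unique[OF sums] by simp
    finally show "(\<integral>\<^sup>+x. ennreal (\<bar>u x\<bar> powr p * H x powr (- \<beta>)) * indicator {x. \<bar>u x\<bar> \<le> M} x \<partial>lebesgue)
      \<le> ennreal (B * (1 / (1 - r)) * (Lp_norm q u powr q) powr (1 - \<beta> / N))"
      by (simp add: U_def \<theta>_def)
  qed
qed

text \<open>Unit layers above \<open>M\<close>: the integrand grows with rate
  \<open>lam * \<theta>\<close>, the weighted measure of the level decays with rate
  \<open>mu * \<theta>\<close>, and the series converges because \<open>lam < mu\<close>. Both
  \<open>M\<close> and the sum are independent of \<open>u\<close>.\<close>

lemma large_values_bound:
  assumes \<beta>: "0 \<le> \<beta>" "\<beta> < N" and q: "q \<ge> 1" and p: "p \<ge> 0"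
    and lam: "0 \<le> lam" "lam < lambda_crit F"
  shows "\<exists>M>0. \<exists>C\<ge>0. \<forall>u g. DNq_gradient q u g \<and> Lp_norm N (\<lambda>x. F (g x)) \<le> 1 \<and> Lp_norm q u > 0 \<longrightarrow>
    (\<integral>\<^sup>+x. ennreal (exp (lam * (1 - \<beta> / N) * \<bar>u x\<bar> powr (N / (N - 1))) * \<bar>u x\<bar> powr p * H x powr (- \<beta>))
        * indicator {x. M < \<bar>u x\<bar>} x \<partial>lebesgue)
      \<le> ennreal (C * (Lp_norm q u powr q) powr (1 - \<beta> / N))"
proof -
  define \<theta> where "\<theta> = 1 - \<beta> / N"
  have \<theta>: "\<theta> > 0" using \<beta> by (simp add: \<theta>_def)
  define a where "a = N / (N - 1)"
  have a: "a \<ge> 1" using N_ge_2 by (simp add: a_def)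
  define mu where "mu = (lam + lambda_crit F) / 2"
  have mu: "lam < mu" "mu < lambda_crit F" "mu > 0" using lam lambda_crit_pos by (auto simp: mu_def)
  \<comment> \<open>Chosen so that the decay rate \<open>lambda_crit F / T powr a\<close> of the
    level sets is exactly \<open>mu\<close>; \<open>mu < lambda_crit F\<close> gives the required
    \<open>T > 1\<close>.\<close>
  define T where "T = (lambda_crit F / mu) powr (1 / a)"
  have T: "T > 1" "lambda_crit F / T powr a = mu"
    using mu a by (auto simp: T_def powr_powr intro: gr_one_powr)
  define thr where "thr = threshold T + 1"
  \<comment> \<open>Every level \<open>M + real k\<close> then lies in the range where
    \<open>DNq_level_set_bound\<close> applies.\<close>
  define M where "M = real (nat \<lceil>thr\<rceil> + 1)"
  have M: "M > thr" "M > 0"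
    unfolding M_def by linarith+
  define c where "c k = exp (\<theta> * lam * (M + real k + 1) powr a) * (M + real k + 1) powr p" for k
  define e where "e k = exp (- \<theta> * mu * (M + real k - thr) powr a)" for k
  have sm: "summable (\<lambda>k. c k * e k)"
    unfolding c_def e_def using lam mu a M p \<theta> by (intro summable_exp_gap) auto
  define W where "W = weight_const \<beta> * (2 powr (q + 1)) powr \<theta>"
  have wc: "weight_const \<beta> \<ge> 0" using \<beta> N_ge_2 by (simp add: weight_const_def)
  have W: "W \<ge> 0" using wc by (simp add: W_def)
  show ?thesis
  proof (rule exI[of _ M], rule conjI[OF M(2)], intro exI[of _ "W * (\<Sum>k. c k * e k)"] conjI allI impI)
    show "W * (\<Sum>k. c k * e k) \<ge> 0"
      using W sm by (intro mult_nonneg_nonneg suminf_nonneg) (auto simp: c_def e_def)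
    fix u g assume *: "DNq_gradient q u g \<and> Lp_norm N (\<lambda>x. F (g x)) \<le> 1 \<and> Lp_norm q u > 0"
    then have u: "in_Lp q u" by (auto simp: DNq_gradient_def)
    then have [measurable]: "u \<in> borel_measurable lebesgue" by (auto simp: in_Lp_def)
    define U where "U = Lp_norm q u powr q"
    have U: "U > 0" using * by (simp add: U_def)
    define E where "E k = {x. M + real k < \<bar>u x\<bar>}" for k
    have "{x \<in> space lebesgue. M + real j < \<bar>u x\<bar>} \<in> sets lebesgue" for j by measurable
    then have E[measurable]: "E j \<in> sets lebesgue" for j by (simp add: E_def)
    have Em: "emeasure lebesgue (E k) \<le> ennreal (2 powr (q + 1) * U * exp (- mu * (M + real k - thr) powr a))" for k
      using DNq_level_set_bound[of q u g T "M + real k" U, unfolded T(2)[unfolded a_def]] * q T(1) M U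
      by (simp add: E_def U_def a_def thr_def diff_diff_eq add.commute)
    have d: "weight_const \<beta> * (2 powr (q + 1) * U * exp (- mu * (M + real k - thr) powr a)) powr \<theta> =
        W * U powr \<theta> * e k" for k
      using U by (simp add: W_def e_def powr_mult exp_powr_real mult_ac)
    have cd: "(\<lambda>k. c k * (W * U powr \<theta> * e k)) = (\<lambda>k. (W * U powr \<theta>) * (c k * e k))"
      by (simp add: mult_ac)
    have "(\<integral>\<^sup>+x. ennreal (exp (lam * (1 - \<beta> / N) * \<bar>u x\<bar> powr (N / (N - 1))) * \<bar>u x\<bar> powr p * H x powr (- \<beta>))
        * indicator {x. M < \<bar>u x\<bar>} x \<partial>lebesgue) \<le> ennreal (\<Sum>k. c k * (W * U powr \<theta> * e k))"
    proof (rule nn_integral_layers[where E=E and h="\<lambda>x. ennreal (H x powr (- \<beta>))"])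
      show "(\<integral>\<^sup>+x. ennreal (H x powr - \<beta>) * indicator (E k) x \<partial>lebesgue) \<le> ennreal (W * U powr \<theta> * e k)" for k
        unfolding d[symmetric] unfolding \<theta>_def using U by (intro weighted_measure_bound E Em \<beta>) auto
      show "0 \<le> c k" "0 \<le> W * U powr \<theta> * e k" for k using W by (auto simp: c_def e_def)
      show "summable (\<lambda>k. c k * (W * U powr \<theta> * e k))"
        unfolding cd by (intro summable_mult sm)
      fix x
      let ?w = "ennreal (exp (lam * (1 - \<beta> / N) * \<bar>u x\<bar> powr (N / (N - 1))) * \<bar>u x\<bar> powr p * H x powr (- \<beta>))
        * indicator {x. M < \<bar>u x\<bar>} x"
      show "?w = 0 \<or> (\<exists>k. x \<in> E k \<and> ?w \<le> ennreal (c k) * ennreal (H x powr - \<beta>))"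
      proof (cases "M < \<bar>u x\<bar>")
        case True
        \<comment> \<open>Rounding up and subtracting 1, instead of rounding down, keeps the lower
          inequality strict when \<open>\<bar>u x\<bar> - M\<close> is an integer.\<close>
        define k where "k = nat (\<lceil>\<bar>u x\<bar> - M\<rceil> - 1)"
        have k: "M + real k < \<bar>u x\<bar>" "\<bar>u x\<bar> \<le> M + real k + 1"
          using True unfolding k_def by linarith+
        have "exp (lam * (1 - \<beta> / N) * \<bar>u x\<bar> powr (N / (N - 1))) \<le> exp (\<theta> * lam * (M + real k + 1) powr a)"
          using k(2) \<theta> lam a unfolding \<theta>_def[symmetric] a_def[symmetric]
          by (auto simp: mult.commute[of \<theta>] intro!: mult_left_mono powr_mono2)
        moreover have "\<bar>u x\<bar> powr p \<le> (M + real k + 1) powr p"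
          using k(2) p by (intro powr_mono2) auto
        ultimately have "exp (lam * (1 - \<beta> / N) * \<bar>u x\<bar> powr (N / (N - 1))) * \<bar>u x\<bar> powr p * H x powr (- \<beta>) \<le> c k * H x powr (- \<beta>)"
          unfolding c_def by (intro mult_right_mono mult_mono) auto
        then have "?w \<le> ennreal (c k) * ennreal (H x powr - \<beta>)"
          using True by (simp add: ennreal_mult'[symmetric] c_def ennreal_leI)
        then show ?thesis using k by (auto simp: E_def)
      qed simp
    qed measurable
    also have "(\<Sum>k. c k * (W * U powr \<theta> * e k)) = W * (\<Sum>k. c k * e k) * U powr \<theta>"
      unfolding cd using sm by (subst suminf_mult) auto
    finally show "(\<integral>\<^sup>+x. ennreal (exp (lam * (1 - \<beta> / N) * \<bar>u x\<bar> powr (N / (N - 1))) * \<bar>u x\<bar> powr p * H x powr (- \<beta>))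
        * indicator {x. M < \<bar>u x\<bar>} x \<partial>lebesgue)
      \<le> ennreal (W * (\<Sum>k. c k * e k) * (Lp_norm q u powr q) powr (1 - \<beta> / N))"
      by (simp add: U_def \<theta>_def)
  qed
qed

lemma tm_integral_eq:
  "tm_integral F \<beta> p lam u = (\<integral>\<^sup>+x. ennreal (exp (lam * (1 - \<beta> / N) * \<bar>u x\<bar> powr (N / (N - 1))) *
     \<bar>u x\<bar> powr p * H x powr (- \<beta>)) \<partial>lebesgue)"
  by (simp add: tm_integral_def Let_def N_eq powr_minus divide_inverse)

lemma subcritical_inequality:
  assumes \<beta>: "0 \<le> \<beta>" "\<beta> < N" and q: "q \<ge> 1"
    and pq: "p > q * (1 - \<beta> / N) \<or> \<beta> = 0 \<and> p \<ge> q"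
    and lam: "0 \<le> lam" "lam < lambda_crit F"
  shows "\<exists>C>0. \<forall>u g. DNq_gradient q u g \<and> Lp_norm N (\<lambda>x. F (g x)) \<le> 1 \<longrightarrow>
    tm_integral F \<beta> p lam u \<le> ennreal (C * Lp_norm q u powr (q * (1 - \<beta> / N)))"
proof -
  define \<theta> where "\<theta> = 1 - \<beta> / N"
  have \<theta>: "\<theta> > 0" using \<beta> by (simp add: \<theta>_def)
  have p: "p > 0" using pq \<theta> q less_trans[of 0 "q * \<theta>" p] by (auto simp: \<theta>_def)
  obtain M C1 where M: "M > 0" and C1: "C1 \<ge> 0" and large: "\<And>u g. DNq_gradient q u g \<Longrightarrow>
    Lp_norm N (\<lambda>x. F (g x)) \<le> 1 \<Longrightarrow> Lp_norm q u > 0 \<Longrightarrow>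
    (\<integral>\<^sup>+x. ennreal (exp (lam * \<theta> * \<bar>u x\<bar> powr (N / (N - 1))) * \<bar>u x\<bar> powr p * H x powr (- \<beta>))
        * indicator {x. M < \<bar>u x\<bar>} x \<partial>lebesgue) \<le> ennreal (C1 * (Lp_norm q u powr q) powr \<theta>)"
    using large_values_bound[OF \<beta> q less_imp_le[OF p] lam] unfolding \<theta>_def by blast
  obtain C2 where C2: "C2 \<ge> 0" and small: "\<And>u. in_Lp q u \<Longrightarrow>
    (\<integral>\<^sup>+x. ennreal (\<bar>u x\<bar> powr p * H x powr (- \<beta>)) * indicator {x. \<bar>u x\<bar> \<le> M} x \<partial>lebesgue)
      \<le> ennreal (C2 * (Lp_norm q u powr q) powr \<theta>)"
    using small_values_bound[OF \<beta> q M pq] unfolding \<theta>_def by auto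
  define B where "B = exp (lam * \<theta> * M powr (N / (N - 1)))"
  show ?thesis
  \<comment> \<open>The summand 1 makes the constant positive; \<open>B\<close> bounds the
    exponential where \<open>\<bar>u x\<bar> \<le> M\<close>.\<close>
  proof (intro exI[of _ "C1 + B * C2 + 1"] conjI allI impI)
    show "C1 + B * C2 + 1 > 0" using C1 C2 by (simp add: B_def add_nonneg_pos)
    fix u g assume *: "DNq_gradient q u g \<and> Lp_norm N (\<lambda>x. F (g x)) \<le> 1"
    then have u: "in_Lp q u" by (auto simp: DNq_gradient_def)
    then have [measurable]: "u \<in> borel_measurable lebesgue" by (auto simp: in_Lp_def)
    let ?\<Psi> = "\<lambda>x. exp (lam * \<theta> * \<bar>u x\<bar> powr (N / (N - 1))) * \<bar>u x\<bar> powr p * H x powr (- \<beta>)"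
    let ?V = "(Lp_norm q u powr q) powr \<theta>"
    have tm: "tm_integral F \<beta> p lam u = (\<integral>\<^sup>+x. ennreal (?\<Psi> x) \<partial>lebesgue)"
      by (simp add: tm_integral_eq \<theta>_def)
    have V: "Lp_norm q u powr (q * (1 - \<beta> / N)) = ?V"
      by (simp add: \<theta>_def powr_powr)
    show "tm_integral F \<beta> p lam u \<le> ennreal ((C1 + B * C2 + 1) * Lp_norm q u powr (q * (1 - \<beta> / N)))"
    \<comment> \<open>The estimate of large values assumes a positive norm; a vanishing norm makes
      the integrand zero almost everywhere.\<close>
    proof (cases "Lp_norm q u = 0")
      case True
      then have "(\<integral>\<^sup>+x. ennreal (\<bar>u x\<bar> powr q) \<partial>lebesgue) = 0"
        using nn_integral_in_Lp[OF u] q by simp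
      then have "AE x in lebesgue. \<bar>u x\<bar> powr q = 0"
        by (subst (asm) nn_integral_0_iff_AE) (auto simp: ennreal_eq_0_iff elim: eventually_mono)
      then have "AE x in lebesgue. ennreal (?\<Psi> x) = 0"
        by eventually_elim simp
      then have "(\<integral>\<^sup>+x. ennreal (?\<Psi> x) \<partial>lebesgue) = 0"
        by (subst nn_integral_0_iff_AE) auto
      then show ?thesis by (simp add: tm)
    next
      case False
      then have pos: "Lp_norm q u > 0" by (simp add: Lp_norm_def order_less_le)
      have "(\<integral>\<^sup>+x. ennreal (?\<Psi> x) \<partial>lebesgue) \<le> (\<integral>\<^sup>+x. ennreal (?\<Psi> x) * indicator {x. M < \<bar>u x\<bar>} x +
          ennreal B * (ennreal (\<bar>u x\<bar> powr p * H x powr (- \<beta>)) * indicator {x. \<bar>u x\<bar> \<le> M} x) \<partial>lebesgue)"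
      proof (intro nn_integral_mono)
        fix x
        have "?\<Psi> x \<le> B * (\<bar>u x\<bar> powr p * H x powr (- \<beta>))" if "\<bar>u x\<bar> \<le> M"
        proof -
          have "exp (lam * \<theta> * \<bar>u x\<bar> powr (N / (N - 1))) \<le> B"
            unfolding B_def using that N_ge_2 lam \<theta> by (auto intro!: mult_left_mono powr_mono2)
          then have "exp (lam * \<theta> * \<bar>u x\<bar> powr (N / (N - 1))) * (\<bar>u x\<bar> powr p * H x powr (- \<beta>)) \<le> B * (\<bar>u x\<bar> powr p * H x powr (- \<beta>))"
            by (rule mult_right_mono) simp
          then show ?thesis by (simp add: mult.assoc)
        qed
        then show "ennreal (?\<Psi> x) \<le> ennreal (?\<Psi> x) * indicator {x. M < \<bar>u x\<bar>} x +
          ennreal B * (ennreal (\<bar>u x\<bar> powr p * H x powr (- \<beta>)) * indicator {x. \<bar>u x\<bar> \<le> M} x)"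
          by (cases "\<bar>u x\<bar> \<le> M") (auto simp: B_def ennreal_mult'[symmetric] intro!: ennreal_leI)
      qed
      also have "\<dots> = (\<integral>\<^sup>+x. ennreal (?\<Psi> x) * indicator {x. M < \<bar>u x\<bar>} x \<partial>lebesgue) +
          ennreal B * (\<integral>\<^sup>+x. ennreal (\<bar>u x\<bar> powr p * H x powr (- \<beta>)) * indicator {x. \<bar>u x\<bar> \<le> M} x \<partial>lebesgue)"
      proof -
        have "{x \<in> space lebesgue. M < \<bar>u x\<bar>} \<in> sets lebesgue" "{x \<in> space lebesgue. \<bar>u x\<bar> \<le> M} \<in> sets lebesgue"
          by measurable
        then have [measurable]: "{x. M < \<bar>u x\<bar>} \<in> sets lebesgue" "{x. \<bar>u x\<bar> \<le> M} \<in> sets lebesgue"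
          by simp_all
        show ?thesis
          by (subst nn_integral_add) (measurable, simp add: nn_integral_cmult)
      qed
      also have "\<dots> \<le> ennreal (C1 * ?V) + ennreal B * ennreal (C2 * ?V)"
        using * pos u by (intro add_mono mult_left_mono large small) auto
      also have "\<dots> = ennreal ((C1 + B * C2) * ?V)"
        using C1 C2 by (simp add: B_def ennreal_mult'[symmetric] ennreal_plus[symmetric] algebra_simps del: ennreal_plus)
      also have "\<dots> \<le> ennreal ((C1 + B * C2 + 1) * ?V)"
        by (intro ennreal_leI mult_right_mono) auto
      finally show ?thesis unfolding tm V .
    qed
  qed
qed

end

section \<open>Smooth functions\<close>

definition smooth :: "(real^'n \<Rightarrow> real) \<Rightarrow> bool" where
  "smooth f \<longleftrightarrow> (\<forall>k. C_on k UNIV f)"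

lemma smooth_C_on: "smooth f \<Longrightarrow> C_on k UNIV f"
  by (simp add: smooth_def)

lemma smooth_differentiable: "smooth f \<Longrightarrow> f differentiable (at x)"
  using smooth_C_on[of f 1] by simp

lemma smooth_dir_deriv: "smooth f \<Longrightarrow> smooth (dir_deriv v f)"
  by (metis C_on.simps(2) smooth_def)

lemma dir_deriv_eqI: "(f has_derivative D) (at x) \<Longrightarrow> dir_deriv v f x = D v"
  unfolding dir_deriv_def by (metis frechet_derivative_at)

lemma grad_eqI: "(f has_derivative (\<lambda>v. a \<bullet> v)) (at x) \<Longrightarrow> grad f x = a"
  by (simp add: grad_def dir_deriv_eqI vec_eq_iff inner_axis)

lemma has_derivative_dir_deriv:
  "f differentiable (at x) \<Longrightarrow> (f has_derivative (\<lambda>v. dir_deriv v f x)) (at x)"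
  unfolding dir_deriv_def by (simp add: frechet_derivative_works[symmetric])

section \<open>Closure properties of the classes \<open>C_on k UNIV\<close>\<close>

lemma C_on_const: "C_on k (UNIV :: (real^'n) set) (\<lambda>_. c)"
proof (induction k arbitrary: c)
  case (Suc k)
  have "dir_deriv v (\<lambda>_. c) = (\<lambda>_. 0)" for v :: "real^'n"
    by (rule ext, rule dir_deriv_eqI) simp
  then show ?case using Suc by simp
qed simp

lemma C_on_inner: "C_on k UNIV (\<lambda>x. x \<bullet> a)"
proof (cases k)
  case (Suc k)
  have "dir_deriv v (\<lambda>x. x \<bullet> a) = (\<lambda>_. v \<bullet> a)" for v
    by (rule ext, rule dir_deriv_eqI) (auto intro!: derivative_eq_intros)
  moreover have "(\<lambda>x. x \<bullet> a) differentiable (at x)" for x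
    unfolding differentiable_def by (auto intro!: derivative_eq_intros)
  ultimately show ?thesis using Suc by (simp add: C_on_const)
qed (auto intro!: continuous_intros)

lemma C_on_add: "C_on k UNIV f \<Longrightarrow> C_on k UNIV g \<Longrightarrow> C_on k UNIV (\<lambda>x. f x + g x)"
proof (induction k arbitrary: f g)
  case (Suc k)
  have "dir_deriv v (\<lambda>x. f x + g x) = (\<lambda>x. dir_deriv v f x + dir_deriv v g x)" for v
    using Suc.prems by (intro ext dir_deriv_eqI has_derivative_add has_derivative_dir_deriv) auto
  then show ?case using Suc by auto
qed (auto intro!: continuous_intros)

lemma C_on_mult: "C_on k UNIV f \<Longrightarrow> C_on k UNIV g \<Longrightarrow> C_on k UNIV (\<lambda>x. f x * g x)"
proof (induction k arbitrary: f g)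
  case (Suc k)
  have "dir_deriv v (\<lambda>x. f x * g x) = (\<lambda>x. f x * dir_deriv v g x + dir_deriv v f x * g x)" for v
    using Suc.prems by (intro ext dir_deriv_eqI has_derivative_mult has_derivative_dir_deriv) auto
  moreover have "C_on k UNIV (\<lambda>x. f x * dir_deriv v g x + dir_deriv v f x * g x)" for v
    using Suc.prems C_on_Suc_imp[OF Suc.prems(1)] C_on_Suc_imp[OF Suc.prems(2)]
    by (intro C_on_add Suc.IH) auto
  moreover have "(\<lambda>x. f x * g x) differentiable (at x)" for x
    using Suc.prems by (intro differentiable_mult) auto
  ultimately show ?case by simp
qed (auto intro!: continuous_intros)

text \<open>The chain rule as an induction step: one more order for \<open>h\<close> after
  \<open>f\<close> needs only the present order for \<open>h'\<close> after \<open>f\<close>. The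
  derivative is demanded on the range of \<open>f\<close> alone, which admits \<open>ln\<close> and
  \<open>inverse\<close> on positive functions.\<close>

lemma C_on_compose_step:
  assumes f: "smooth f" and h: "\<And>x. (h has_real_derivative h' (f x)) (at (f x))"
    and h': "C_on k UNIV (\<lambda>x. h' (f x))"
  shows "C_on (Suc k) UNIV (\<lambda>x. h (f x))"
proof -
  have D: "((\<lambda>x. h (f x)) has_derivative (\<lambda>v. h' (f x) * dir_deriv v f x)) (at x)" for x
    by (rule has_derivative_compose[OF has_derivative_dir_deriv[OF smooth_differentiable[OF f]]
      h[unfolded has_field_derivative_def]])
  then have "dir_deriv v (\<lambda>x. h (f x)) = (\<lambda>x. h' (f x) * dir_deriv v f x)" for v
    by (intro ext dir_deriv_eqI)
  moreover have "(\<lambda>x. h (f x)) differentiable (at x)" for x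
    using D by (auto simp: differentiable_def)
  moreover have "C_on k UNIV (\<lambda>x. h' (f x) * dir_deriv v f x)" for v
    by (intro C_on_mult h' smooth_C_on smooth_dir_deriv f)
  ultimately show ?thesis by simp
qed

lemma C_on_compose_0:
  assumes f: "smooth f" and h: "\<And>x. (h has_real_derivative h' x) (at (f x))"
  shows "C_on 0 UNIV (\<lambda>x. h (f x))"
proof -
  have "isCont f x" for x
    using smooth_differentiable[OF f] by (rule differentiable_imp_continuous_within)
  moreover have "isCont h (f x)" for x
    using h by (rule DERIV_isCont)
  ultimately have "isCont (\<lambda>x. h (f x)) x" for x
    by (rule isCont_o2)
  then show ?thesis by (simp add: continuous_at_imp_continuous_on)
qed

lemma smooth_const: "smooth (\<lambda>_. c)"
  and smooth_inner: "smooth (\<lambda>x. x \<bullet> a)"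
  and smooth_add: "smooth f \<Longrightarrow> smooth g \<Longrightarrow> smooth (\<lambda>x. f x + g x)"
  and smooth_mult: "smooth f \<Longrightarrow> smooth g \<Longrightarrow> smooth (\<lambda>x. f x * g x)"
  by (simp_all add: smooth_def C_on_const C_on_inner C_on_add C_on_mult)

lemma smooth_sum: "(\<And>i. i \<in> I \<Longrightarrow> smooth (f i)) \<Longrightarrow> smooth (\<lambda>x. \<Sum>i\<in>I. f i x)"
  by (induction I rule: infinite_finite_induct) (auto intro: smooth_const smooth_add)

lemma smooth_exp:
  assumes "smooth f"
  shows "smooth (\<lambda>x. exp (f x))"
  unfolding smooth_def
proof
  fix k show "C_on k UNIV (\<lambda>x. exp (f x))"
  proof (induction k)
    case 0
    show ?case by (rule C_on_compose_0[OF assms DERIV_exp])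
  next
    case (Suc k)
    then show ?case by (intro C_on_compose_step[OF assms DERIV_exp])
  qed
qed

lemma smooth_inverse:
  assumes "smooth f" and pos: "\<And>x. f x > 0"
  shows "smooth (\<lambda>x. inverse (f x))"
  unfolding smooth_def
proof
  \<comment> \<open>The derivative is written in terms of \<open>inverse (f x)\<close> so that the
    induction hypothesis covers it.\<close>
  have D: "(inverse has_real_derivative - 1 * (inverse (f x) * inverse (f x))) (at (f x))" for x
    using pos[of x] DERIV_inverse[of "f x" UNIV] by (simp add: numeral_2_eq_2)
  fix k show "C_on k UNIV (\<lambda>x. inverse (f x))"
  proof (induction k)
    case 0
    show ?case by (rule C_on_compose_0[OF assms(1) D])
  next
    case (Suc k)
    then show ?case by (intro C_on_compose_step[OF assms(1) D] C_on_mult C_on_const)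
  qed
qed

lemma smooth_ln:
  assumes "smooth f" and pos: "\<And>x. f x > 0"
  shows "smooth (\<lambda>x. ln (f x))"
  unfolding smooth_def
proof
  have D: "(ln has_real_derivative inverse (f x)) (at (f x))" for x
    using pos[of x] by (rule DERIV_ln)
  fix k show "C_on k UNIV (\<lambda>x. ln (f x))"
  proof (cases k)
    case 0
    show ?thesis unfolding 0 by (rule C_on_compose_0[OF assms(1) D])
  next
    case (Suc k)
    then show ?thesis
      using smooth_C_on[OF smooth_inverse[OF assms]] C_on_compose_step[OF assms(1) D] by blast
  qed
qed

text \<open>The classical smooth function that vanishes on the negative half-line. The index
  \<open>j\<close> makes the family closed, up to linear combinations, under
  differentiation.\<close>

definition flat :: "nat \<Rightarrow> real \<Rightarrow> real" where
  "flat j t = (if t \<le> 0 then 0 else exp (- (1 / t)) / t ^ j)"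

text \<open>\<open>powr_le_exp\<close> at \<open>1 / t\<close> with exponent \<open>j + 2\<close>. A
  quadratic bound forces the difference quotient at 0 to vanish.\<close>

lemma flat_quadratic: "\<exists>C. \<forall>t. \<bar>flat j t\<bar> \<le> C * t\<^sup>2"
proof (intro exI allI)
  fix t :: real
  let ?p = "real (j + 2)"
  show "\<bar>flat j t\<bar> \<le> ((?p + 1) / 1) powr ?p * t\<^sup>2"
  proof (cases "t \<le> 0")
    case False
    have "(1 / t) powr ?p \<le> ((?p + 1) / 1) powr ?p * exp (1 * (1 / t))"
      using False by (intro powr_le_exp) auto
    then have "(1 / t) ^ (j + 2) \<le> ((?p + 1) / 1) powr ?p * exp (1 / t)"
      using False by (subst (asm) powr_realpow) auto
    then have "(1 / t) ^ (j + 2) * exp (- (1 / t)) \<le> ((?p + 1) / 1) powr ?p * exp (1 / t) * exp (- (1 / t))"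
      by (rule mult_right_mono) simp
    also have "\<dots> = ((?p + 1) / 1) powr ?p"
      by (simp add: exp_minus)
    finally have "(1 / t) ^ (j + 2) * exp (- (1 / t)) * t\<^sup>2 \<le> ((?p + 1) / 1) powr ?p * t\<^sup>2"
      by (rule mult_right_mono) simp
    also have "(1 / t) ^ (j + 2) * exp (- (1 / t)) * t\<^sup>2 = \<bar>flat j t\<bar>"
      using False by (simp add: flat_def power_add power_divide power2_eq_square)
    finally show ?thesis .
  qed (simp add: flat_def)
qed

text \<open>Differentiating the exponential contributes \<open>1 / t\<^sup>2\<close> and raises the
  index by 2; differentiating the power raises it by 1. At 0 both sides vanish.\<close>

lemma flat_deriv: "(flat j has_real_derivative (flat (j + 2) t - real j * flat (j + 1) t)) (at t)"
proof (cases t "0 :: real" rule: linorder_cases)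
  case less
  have D: "((\<lambda>_. 0) has_real_derivative 0) (at t)" by simp
  have "(flat j has_real_derivative 0) (at t)"
    by (rule has_field_derivative_transform_within_open[OF D, of "{..<0}"]) (use less in \<open>auto simp: flat_def\<close>)
  then show ?thesis using less by (simp add: flat_def)
next
  case greater
  have D: "((\<lambda>t. exp (- (1 / t)) / t ^ j) has_real_derivative (flat (j + 2) t - real j * flat (j + 1) t)) (at t)"
  proof -
    let ?e = "exp (- (1 / t))"
    have "t ^ (j + 2) = t ^ j * t\<^sup>2" by (rule power_add)
    then have 2: "flat (j + 2) t = ?e * (1 / t\<^sup>2) / t ^ j"
      unfolding flat_def using greater by (auto simp del: add_2_eq_Suc' power_Suc)
    have 1: "real j * flat (j + 1) t = ?e * (real j * t ^ (j - Suc 0)) / (t ^ j * t ^ j)"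
      using greater by (cases j) (auto simp: flat_def)
    have "((\<lambda>t. exp (- (1 / t))) has_real_derivative ?e * (1 / t\<^sup>2)) (at t)"
      using greater by (auto intro!: derivative_eq_intros simp: power2_eq_square)
    from DERIV_divide[OF this DERIV_pow] greater
    have "((\<lambda>t. exp (- (1 / t)) / t ^ j) has_real_derivative
        (?e * (1 / t\<^sup>2) * t ^ j - ?e * (real j * t ^ (j - Suc 0))) / (t ^ j * t ^ j)) (at t)"
      by simp
    also have "(?e * (1 / t\<^sup>2) * t ^ j - ?e * (real j * t ^ (j - Suc 0))) / (t ^ j * t ^ j) =
        flat (j + 2) t - real j * flat (j + 1) t"
      unfolding 1 2 diff_divide_distrib using greater by simp
    finally show ?thesis .
  qed
  show ?thesis
    by (rule has_field_derivative_transform_within_open[OF D, of "{0<..}"]) (use greater in \<open>auto simp: flat_def\<close>)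
next
  case equal
  obtain C where C: "\<And>t. \<bar>flat j t\<bar> \<le> C * t\<^sup>2" using flat_quadratic by blast
  have "((\<lambda>h. flat j h / h) \<longlongrightarrow> 0) (at 0)"
  proof (rule Lim_null_comparison)
    show "\<forall>\<^sub>F h in at 0. norm (flat j h / h) \<le> C * \<bar>h\<bar>"
      unfolding eventually_at_filter
      using C by (intro always_eventually) (auto simp: divide_simps power2_eq_square abs_mult mult.assoc)
    show "((\<lambda>h. C * \<bar>h\<bar>) \<longlongrightarrow> 0) (at 0)"
      by (auto intro!: tendsto_eq_intros)
  qed
  then show ?thesis using equal by (simp add: DERIV_def flat_def)
qed

lemma smooth_flat:
  assumes "smooth f"
  shows "smooth (\<lambda>x. flat j (f x))"
  unfolding smooth_def
proof
  fix k show "C_on k UNIV (\<lambda>x. flat j (f x))"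
  proof (induction k arbitrary: j)
    case 0
    show ?case by (rule C_on_compose_0[OF assms flat_deriv])
  next
    case (Suc k)
    have "(flat j has_real_derivative (flat (j + 2) t + - real j * flat (j + 1) t)) (at t)" for t
      using flat_deriv[of j t] by simp
    then show ?case
      by (rule C_on_compose_step[OF assms]) (intro C_on_add C_on_mult C_on_const Suc)
  qed
qed

text \<open>A smooth substitute for the positive part; \<open>1 + 1 / t \<le> exp (1 / t)\<close> keeps its slope below 1.\<close>

definition soft_pos :: "real \<Rightarrow> real" where
  "soft_pos t = t * flat 0 t"

text \<open>The third bound limits the price of smoothing: at most 1 is lost in the height of the
  Moser functions, negligible against a height of order \<open>L\<close>.\<close>

lemma soft_pos_bounds: "0 \<le> soft_pos t" "soft_pos t \<le> max 0 t" "t - 1 \<le> soft_pos t"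
proof -
  show "0 \<le> soft_pos t" "soft_pos t \<le> max 0 t"
    by (auto simp: soft_pos_def flat_def mult_left_le)
  show "t - 1 \<le> soft_pos t"
  proof (cases "t \<le> 0")
    case False
    have "t * (1 + - (1 / t)) \<le> t * exp (- (1 / t))"
      using False by (intro mult_left_mono exp_ge_add_one_self) auto
    then show ?thesis using False by (simp add: soft_pos_def flat_def algebra_simps)
  qed (simp add: soft_pos_def flat_def)
qed

lemma soft_pos_deriv:
  "\<exists>d. (soft_pos has_real_derivative d) (at t) \<and> 0 \<le> d \<and> d \<le> (if t > 0 then 1 else 0)"
proof (intro exI conjI)
  show "(soft_pos has_real_derivative (flat 0 t + t * flat 2 t)) (at t)"
    unfolding soft_pos_def using flat_deriv[of 0 t]
    by (auto intro!: derivative_eq_intros simp: numeral_2_eq_2)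
  show "0 \<le> flat 0 t + t * flat 2 t" by (simp add: flat_def)
  show "flat 0 t + t * flat 2 t \<le> (if t > 0 then 1 else 0)"
  proof (cases "t > 0")
    case True
    have "exp (- (1 / t)) * (1 + 1 / t) \<le> exp (- (1 / t)) * exp (1 / t)"
      by (intro mult_left_mono exp_ge_add_one_self) simp
    then show ?thesis using True
      by (simp add: flat_def exp_minus power2_eq_square distrib_left field_simps)
  qed (simp add: flat_def)
qed

lemma smooth_soft_pos: "smooth f \<Longrightarrow> smooth (\<lambda>x. soft_pos (f x))"
  unfolding soft_pos_def by (intro smooth_mult smooth_flat)

lemma test_function_DNq:
  assumes "test_function f" "q > 0"
  shows "DNq_gradient q f (grad f)"
  unfolding DNq_gradient_def using assms
  by (intro conjI exI[of _ "\<lambda>_. f"] test_function_in_Lp) (auto simp: Lp_norm_def)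

context finsler_norm
begin

section \<open>Moser functions and sharpness\<close>

text \<open>For \<open>\<sigma> < 1\<close> each point of the Euclidean sphere has an admissible
  \<open>\<xi>\<close> exceeding \<open>\<sigma> * H x\<close>, also on a neighbourhood. Compactness
  selects finitely many, and homogeneity reaches all \<open>x\<close>.\<close>

lemma polar_finite_net:
  assumes \<sigma>: "0 < \<sigma>" "\<sigma> < 1"
  shows "\<exists>X. finite X \<and> X \<noteq> {} \<and> (\<forall>\<xi>\<in>X. F \<xi> \<le> 1) \<and> (\<forall>x. \<exists>\<xi>\<in>X. \<sigma> * H x \<le> x \<bullet> \<xi>)"
proof -
  let ?S = "sphere 0 1 :: (real^'n) set"
  have op: "open {x. \<sigma> * H x < x \<bullet> \<xi>}" for \<xi>
    by (intro open_Collect_less continuous_intros polar_continuous)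
  have cov: "?S \<subseteq> (\<Union>\<xi>\<in>{\<xi>. F \<xi> \<le> 1}. {x. \<sigma> * H x < x \<bullet> \<xi>})"
  proof
    fix x assume "x \<in> ?S"
    then have "H x > 0" by (intro polar_pos) auto
    then have "\<sigma> * H x < H x" using \<sigma> by simp
    then show "x \<in> (\<Union>\<xi>\<in>{\<xi>. F \<xi> \<le> 1}. {x. \<sigma> * H x < x \<bullet> \<xi>})"
      using polar_approx by blast
  qed
  obtain X where X: "X \<subseteq> {\<xi>. F \<xi> \<le> 1}" "finite X" "?S \<subseteq> (\<Union>\<xi>\<in>X. {x. \<sigma> * H x < x \<bullet> \<xi>})"
    by (rule compactE_image[OF compact_sphere op cov])
  obtain e :: "real^'n" where "e \<in> ?S" using norm_axis_1 by (metis mem_sphere_0)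
  then have ne: "X \<noteq> {}" using X by auto
  have "\<exists>\<xi>\<in>X. \<sigma> * H x \<le> x \<bullet> \<xi>" for x
  proof (cases "x = 0")
    case False
    then have "x /\<^sub>R norm x \<in> ?S" by simp
    then obtain \<xi> where \<xi>: "\<xi> \<in> X" "\<sigma> * H (x /\<^sub>R norm x) < (x /\<^sub>R norm x) \<bullet> \<xi>"
      using X by blast
    then have "\<sigma> * H x < x \<bullet> \<xi>"
      using False by (simp add: polar_scale field_simps)
    then show ?thesis using \<xi> by (intro bexI[of _ \<xi>]) auto
  qed (use ne in auto)
  then show ?thesis using X ne by blast
qed

text \<open>A smooth approximation of the polar: the log-sum-exp of finitely many linear functionals
  \<open>\<xi>\<close> with \<open>F \<xi> \<le> 1\<close>. Its gradient is a convex combination of these \<open>\<xi>\<close>.\<close>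

lemma smooth_polar_approximation:
  assumes \<sigma>: "0 < \<sigma>" "\<sigma> < 1" and \<mu>: "\<mu> > 0"
  shows "\<exists>G. smooth G \<and> (\<forall>x. \<sigma> * H x + \<mu> \<le> G x \<and> G x \<le> H x + 2 * \<mu> \<and> F (grad G x) \<le> 1)"
proof -
  obtain X where X: "finite X" "X \<noteq> {}" "\<And>\<xi>. \<xi> \<in> X \<Longrightarrow> F \<xi> \<le> 1" "\<And>x. \<exists>\<xi>\<in>X. \<sigma> * H x \<le> x \<bullet> \<xi>"
    using polar_finite_net[OF \<sigma>] by blast
  have card: "real (card X) \<ge> 1" using X by (simp add: Suc_le_eq card_gt_0_iff)
  \<comment> \<open>The log-sum-exp exceeds the maximum by at most
    \<open>\<delta> * ln (card X)\<close>, which is to be at most \<open>\<mu>\<close>; the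
    \<open>+ 1\<close> avoids a zero denominator for a single functional.\<close>
  define \<delta> where "\<delta> = \<mu> / (ln (real (card X)) + 1)"
  have \<delta>: "\<delta> > 0" "\<delta> * ln (real (card X)) \<le> \<mu>"
  proof -
    have pos: "ln (real (card X)) + 1 > 0" using card by (simp add: add_nonneg_pos)
    then show "\<delta> > 0" using \<mu> by (simp add: \<delta>_def)
    then have "\<delta> * ln (real (card X)) \<le> \<delta> * (ln (real (card X)) + 1)" by simp
    then show "\<delta> * ln (real (card X)) \<le> \<mu>" using pos by (simp add: \<delta>_def)
  qed
  define Z where "Z x = (\<Sum>\<xi>\<in>X. exp (x \<bullet> (\<xi> /\<^sub>R \<delta>)))" for x
  have Zpos: "Z x > 0" for x
    unfolding Z_def using X by (intro sum_pos) auto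
  \<comment> \<open>The shift by \<open>\<mu>\<close> keeps \<open>G\<close> positive, also at the
    origin, so that its logarithm is smooth.\<close>
  define G where "G x = \<delta> * ln (Z x) + \<mu>" for x
  have "smooth G"
    unfolding G_def Z_def
    using Zpos unfolding Z_def by (intro smooth_add smooth_mult smooth_const smooth_ln smooth_sum smooth_exp smooth_inner)
  moreover have "\<sigma> * H x + \<mu> \<le> G x" for x
  proof -
    obtain \<xi> where \<xi>: "\<xi> \<in> X" "\<sigma> * H x \<le> x \<bullet> \<xi>" using X by blast
    have "exp (x \<bullet> (\<xi> /\<^sub>R \<delta>)) \<le> Z x"
      unfolding Z_def using X \<xi> by (intro member_le_sum) auto
    then have "x \<bullet> (\<xi> /\<^sub>R \<delta>) \<le> ln (Z x)"
      using Zpos by (simp add: ln_ge_iff)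
    then have "x \<bullet> \<xi> \<le> \<delta> * ln (Z x)"
      using \<delta> by (simp add: field_simps)
    then show ?thesis using \<xi> by (simp add: G_def)
  qed
  moreover have "G x \<le> H x + 2 * \<mu>" for x
  proof -
    have "Z x \<le> (\<Sum>\<xi>\<in>X. exp (H x / \<delta>))"
      unfolding Z_def using X(3) inner_le_polar \<delta>
      by (intro sum_mono) (auto simp: divide_inverse mult.commute[of "inverse \<delta>"] intro!: mult_right_mono)
    then have "ln (Z x) \<le> ln (real (card X) * exp (H x / \<delta>))"
      using Zpos by (subst ln_le_cancel_iff) (auto intro: less_le_trans)
    also have "\<dots> = ln (real (card X)) + H x / \<delta>"
      using card by (simp add: ln_mult)
    finally have "\<delta> * ln (Z x) \<le> \<delta> * (ln (real (card X)) + H x / \<delta>)"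
      using \<delta> by simp
    then show ?thesis using \<delta> by (simp add: G_def distrib_left)
  qed
  moreover have "F (grad G x) \<le> 1" for x
  proof -
    define w where "w \<xi> = exp (x \<bullet> (\<xi> /\<^sub>R \<delta>)) / Z x" for \<xi>
    have "sum w X = (\<Sum>\<xi>\<in>X. exp (x \<bullet> (\<xi> /\<^sub>R \<delta>))) / Z x"
      unfolding w_def[abs_def] by (rule sum_divide_distrib[symmetric])
    then have w1: "sum w X = 1"
      unfolding Z_def[symmetric] using Zpos[of x] by simp
    have w0: "w \<xi> \<ge> 0" for \<xi>
      unfolding w_def using Zpos[of x] by (intro divide_nonneg_pos) auto
    note w = w1 w0
    have "((\<lambda>x. exp (x \<bullet> a)) has_derivative (\<lambda>v. exp (x \<bullet> a) * (v \<bullet> a))) (at x)" for a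
      by (auto intro!: derivative_eq_intros)
    then have DZ: "(Z has_derivative (\<lambda>v. \<Sum>\<xi>\<in>X. exp (x \<bullet> (\<xi> /\<^sub>R \<delta>)) * (v \<bullet> (\<xi> /\<^sub>R \<delta>)))) (at x)"
      unfolding Z_def[abs_def] by (intro has_derivative_sum)
    have DG: "(G has_derivative (\<lambda>v. \<delta> * (inverse (Z x) * (\<Sum>\<xi>\<in>X. exp (x \<bullet> (\<xi> /\<^sub>R \<delta>)) * (v \<bullet> (\<xi> /\<^sub>R \<delta>)))))) (at x)"
      unfolding G_def[abs_def]
      using has_derivative_add[OF has_derivative_mult_right[OF has_derivative_compose[OF DZ
        DERIV_ln[OF Zpos, unfolded has_field_derivative_def]]] has_derivative_const]
      by simp
    have DG_eq: "(\<lambda>v. \<delta> * (inverse (Z x) * (\<Sum>\<xi>\<in>X. exp (x \<bullet> (\<xi> /\<^sub>R \<delta>)) * (v \<bullet> (\<xi> /\<^sub>R \<delta>))))) = (\<lambda>v. (\<Sum>\<xi>\<in>X. w \<xi> *\<^sub>R \<xi>) \<bullet> v)"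
    proof
      fix v
      have "(\<Sum>\<xi>\<in>X. w \<xi> *\<^sub>R \<xi>) \<bullet> v = (\<Sum>\<xi>\<in>X. w \<xi> * (v \<bullet> \<xi>))"
        by (simp add: inner_sum_right inner_commute[of _ v])
      also have "\<dots> = (\<Sum>\<xi>\<in>X. \<delta> * (inverse (Z x) * (exp (x \<bullet> (\<xi> /\<^sub>R \<delta>)) * (v \<bullet> (\<xi> /\<^sub>R \<delta>)))))"
        using \<delta> by (intro sum.cong refl) (simp add: w_def divide_inverse)
      finally show "\<delta> * (inverse (Z x) * (\<Sum>\<xi>\<in>X. exp (x \<bullet> (\<xi> /\<^sub>R \<delta>)) * (v \<bullet> (\<xi> /\<^sub>R \<delta>)))) =
          (\<Sum>\<xi>\<in>X. w \<xi> *\<^sub>R \<xi>) \<bullet> v"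
        by (simp only: sum_distrib_left)
    qed
    have "grad G x = (\<Sum>\<xi>\<in>X. w \<xi> *\<^sub>R \<xi>)"
      using DG unfolding DG_eq by (rule grad_eqI)
    moreover have "F (\<Sum>\<xi>\<in>X. w \<xi> *\<^sub>R \<xi>) \<le> (\<Sum>\<xi>\<in>X. w \<xi> * F \<xi>)"
      using X w by (intro convex_on_sum[OF _ _ F_convex]) auto
    moreover have "\<dots> \<le> (\<Sum>\<xi>\<in>X. w \<xi> * 1)"
      using X w by (intro sum_mono mult_left_mono) auto
    ultimately show ?thesis using w by simp
  qed
  ultimately show ?thesis by (intro exI[of _ G] conjI allI)
qed

text \<open>The witness is the soft positive part of \<open>- ln G\<close>. The parameter
  \<open>\<mu>\<close> truncates the logarithm at height about \<open>ln (1 / \<mu>)\<close>, and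
  \<open>F (grad G x) \<le> 1\<close> makes the slope that of a logarithm.\<close>

lemma log_profile:
  assumes \<sigma>: "0 < \<sigma>" "\<sigma> < 1" and \<mu>: "\<mu> > 0"
  shows "\<exists>u. test_function u \<and> (\<forall>x. 0 \<le> u x \<and> u x \<le> max 0 (- ln (\<sigma> * H x + \<mu>)) \<and>
    - ln (H x + 2 * \<mu>) - 1 \<le> u x \<and>
    F (grad u x) \<le> (if \<sigma> * H x + \<mu> < 1 then 1 / (\<sigma> * H x + \<mu>) else 0))"
proof -
  obtain G where G: "smooth G" "\<And>x. \<sigma> * H x + \<mu> \<le> G x" "\<And>x. G x \<le> H x + 2 * \<mu>" "\<And>x. F (grad G x) \<le> 1"
    using smooth_polar_approximation[OF assms] by blast
  have Apos: "\<sigma> * H x + \<mu> > 0" for x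
    using \<sigma> \<mu> polar_nonneg[of x] by (simp add: add_nonneg_pos)
  have Gpos: "G x > 0" for x using Apos G(2) by (rule less_le_trans)
  define u where "u x = soft_pos (- 1 * ln (G x))" for x
  have "smooth u"
    unfolding u_def by (intro smooth_soft_pos smooth_mult smooth_const smooth_ln G Gpos)
  have zero: "u x = 0" if "\<not> \<sigma> * H x + \<mu> < 1" for x
    using that G(2)[of x] by (simp add: u_def soft_pos_def flat_def)
  obtain a where a: "a > 0" "\<And>x. a * norm x \<le> H x"
    using polar_bounds by blast
  have "{x. u x \<noteq> 0} \<subseteq> cball 0 (1 / (\<sigma> * a))"
  proof
    fix x assume "x \<in> {x. u x \<noteq> 0}"
    then have "\<sigma> * H x < 1" using zero[of x] \<mu> by (cases "\<sigma> * H x + \<mu> < 1") auto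
    moreover have "\<sigma> * (a * norm x) \<le> \<sigma> * H x" using a \<sigma> by (intro mult_left_mono) auto
    ultimately have "\<sigma> * (a * norm x) \<le> 1" by linarith
    then show "x \<in> cball 0 (1 / (\<sigma> * a))"
      using a \<sigma> by (simp add: field_simps)
  qed
  then have "compact (closure {x. u x \<noteq> 0})"
    by (meson bounded_cball bounded_subset compact_closure)
  then have "test_function u"
    using \<open>smooth u\<close> by (simp add: test_function_def smooth_def)
  moreover have "0 \<le> u x" for x by (simp add: u_def soft_pos_bounds)
  moreover have "u x \<le> max 0 (- ln (\<sigma> * H x + \<mu>))" for x
  proof -
    have "ln (\<sigma> * H x + \<mu>) \<le> ln (G x)"
      using G(2) Apos Gpos by simp
    then show ?thesis
      using soft_pos_bounds(2)[of "- ln (G x)"] by (simp add: u_def)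
  qed
  moreover have "- ln (H x + 2 * \<mu>) - 1 \<le> u x" for x
  proof -
    have "ln (G x) \<le> ln (H x + 2 * \<mu>)"
      using G(3)[of x] Gpos[of x] by simp
    then show ?thesis
      using soft_pos_bounds(3)[of "- ln (G x)"] by (simp add: u_def)
  qed
  moreover have "F (grad u x) \<le> (if \<sigma> * H x + \<mu> < 1 then 1 / (\<sigma> * H x + \<mu>) else 0)" for x
  proof -
    obtain d where d: "(soft_pos has_real_derivative d) (at (- 1 * ln (G x)))" "0 \<le> d"
        "d \<le> (if - 1 * ln (G x) > 0 then 1 else 0)"
      using soft_pos_deriv by blast
    have "((\<lambda>x. - 1 * ln (G x)) has_derivative (\<lambda>v. - 1 * (inverse (G x) * (grad G x \<bullet> v)))) (at x)"
      using Gpos[of x] has_derivative_grad[OF smooth_differentiable[OF G(1)], of x]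
      by (auto intro!: derivative_eq_intros simp: mult.commute)
    from has_derivative_compose[OF this d(1)[unfolded has_field_derivative_def]]
    have "(u has_derivative (\<lambda>v. ((- d * inverse (G x)) *\<^sub>R grad G x) \<bullet> v)) (at x)"
      unfolding u_def by (simp add: mult.assoc)
    then have "grad u x = (- d * inverse (G x)) *\<^sub>R grad G x"
      by (rule grad_eqI)
    then have "F (grad u x) = d / G x * F (grad G x)"
      using d(2) Gpos[of x] by (simp add: F_scale F_minus abs_mult divide_inverse)
    also have "\<dots> \<le> d / G x * 1"
      using d(2) Gpos[of x] G(4)[of x] by (intro mult_left_mono) auto
    also have "\<dots> = d / G x" by simp
    also have "\<dots> \<le> (if \<sigma> * H x + \<mu> < 1 then 1 / (\<sigma> * H x + \<mu>) else 0)"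
    proof (cases "G x < 1")
      case True
      then have "d / G x \<le> 1 / (\<sigma> * H x + \<mu>)"
        using d G(2)[of x] Apos[of x] by (intro frac_le) (auto split: if_splits)
      then show ?thesis using True G(2)[of x] by auto
    next
      case False
      then have "d = 0" using d(2,3) by auto
      then show ?thesis using Apos[of x] by (auto intro: less_imp_le)
    qed
    finally show ?thesis .
  qed
  ultimately show ?thesis by (intro exI[of _ u] conjI allI)
qed

text \<open>In the radial integral \<open>\<sigma> * r\<close> is replaced by the larger
  \<open>\<sigma> * r + \<mu>\<close> in the power \<open>N - 1\<close>. This leaves the logarithmic
  derivative, integrated up to the radius where \<open>\<sigma> * r + \<mu> = 1\<close>.\<close>

lemma profile_energy:
  assumes \<sigma>: "0 < \<sigma>" "\<sigma> < 1" and \<mu>: "0 < \<mu>" "\<mu> < 1"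
  shows "(\<integral>\<^sup>+x. ennreal ((if \<sigma> * H x + \<mu> < 1 then 1 / (\<sigma> * H x + \<mu>) else 0) powr N) \<partial>lborel)
    \<le> ennreal (N * \<kappa> * \<sigma> powr (- N) * ln (1 / \<mu>))"
proof -
  let ?b = "(1 - \<mu>) / \<sigma>"
  have "(\<integral>\<^sup>+x. ennreal ((if \<sigma> * H x + \<mu> < 1 then 1 / (\<sigma> * H x + \<mu>) else 0) powr N) \<partial>lborel) =
      (\<integral>\<^sup>+r. ennreal (N * \<kappa> * r powr (N - 1)) * indicator {0<..} r *
        ennreal ((if \<sigma> * r + \<mu> < 1 then 1 / (\<sigma> * r + \<mu>) else 0) powr N) \<partial>lborel)"
    by (rule nn_integral_polar) measurable
  also have "\<dots> \<le> (\<integral>\<^sup>+r. ennreal (N * \<kappa> * \<sigma> powr (1 - N) * (1 / (\<sigma> * r + \<mu>))) * indicator {0..?b} r \<partial>lborel)"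
  proof (intro nn_integral_mono)
    fix r :: real
    show "ennreal (N * \<kappa> * r powr (N - 1)) * indicator {0<..} r *
        ennreal ((if \<sigma> * r + \<mu> < 1 then 1 / (\<sigma> * r + \<mu>) else 0) powr N)
      \<le> ennreal (N * \<kappa> * \<sigma> powr (1 - N) * (1 / (\<sigma> * r + \<mu>))) * indicator {0..?b} r"
    proof (cases "0 < r \<and> \<sigma> * r + \<mu> < 1")
      case True
      define A where "A = \<sigma> * r + \<mu>"
      have A: "A > 0" "\<sigma> * r \<le> A" using True \<sigma> \<mu> by (auto simp: A_def add_pos_pos)
      have "r powr (N - 1) = \<sigma> powr (1 - N) * (\<sigma> * r) powr (N - 1)"
        using True \<sigma> by (simp add: powr_mult powr_add[symmetric] mult.assoc[symmetric])
      also have "\<dots> \<le> \<sigma> powr (1 - N) * A powr (N - 1)"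
        using True \<sigma> A N_ge_2 by (intro mult_left_mono powr_mono2) auto
      finally have "r powr (N - 1) * (1 / A) powr N \<le> \<sigma> powr (1 - N) * A powr (N - 1) * (1 / A) powr N"
        by (rule mult_right_mono) simp
      also have "\<dots> = \<sigma> powr (1 - N) * (1 / A)"
        using A by (simp add: powr_divide powr_diff)
      finally have "N * \<kappa> * (r powr (N - 1) * (1 / A) powr N) \<le> N * \<kappa> * (\<sigma> powr (1 - N) * (1 / A))"
        using N_ge_2 kappa_pos by (intro mult_left_mono) auto
      moreover have "r \<le> ?b" using True \<sigma> by (simp add: field_simps)
      ultimately show ?thesis
        using True N_ge_2 kappa_pos by (simp add: A_def[symmetric] ennreal_mult'[symmetric] mult.assoc ennreal_leI)
    next
      case False
      then show ?thesis using N_ge_2 by (auto simp: indicator_def)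
    qed
  qed
  also have "((\<lambda>r. 1 / (\<sigma> * r + \<mu>)) has_integral (ln (\<sigma> * ?b + \<mu>) / \<sigma> - ln (\<sigma> * 0 + \<mu>) / \<sigma>)) {0..?b}"
    using \<sigma> \<mu> by (intro fundamental_theorem_of_calculus)
      (auto intro!: derivative_eq_intros simp: has_real_derivative_iff_has_vector_derivative[symmetric] add_nonneg_pos)
  then have "((\<lambda>r. N * \<kappa> * \<sigma> powr (1 - N) * (1 / (\<sigma> * r + \<mu>))) has_integral
      N * \<kappa> * \<sigma> powr (1 - N) * (ln (\<sigma> * ?b + \<mu>) / \<sigma> - ln (\<sigma> * 0 + \<mu>) / \<sigma>)) {0..?b}"
    by (rule has_integral_mult_right)
  then have "(\<integral>\<^sup>+r. ennreal (N * \<kappa> * \<sigma> powr (1 - N) * (1 / (\<sigma> * r + \<mu>))) * indicator {0..?b} r \<partial>lborel) =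
      ennreal (N * \<kappa> * \<sigma> powr (1 - N) * (ln (\<sigma> * ?b + \<mu>) / \<sigma> - ln (\<sigma> * 0 + \<mu>) / \<sigma>))"
    using N_ge_2 kappa_pos \<sigma> \<mu> by (intro nn_integral_has_integral_lebesgue') auto
  also have "N * \<kappa> * \<sigma> powr (1 - N) * (ln (\<sigma> * ?b + \<mu>) / \<sigma> - ln (\<sigma> * 0 + \<mu>) / \<sigma>) =
      N * \<kappa> * \<sigma> powr (- N) * ln (1 / \<mu>)"
  proof -
    have e: "\<sigma> * ?b + \<mu> = 1" using \<sigma> by simp
    have "\<sigma> powr (1 - N) = \<sigma> * \<sigma> powr (- N)"
      using powr_add[of \<sigma> 1 "- N"] \<sigma> by simp
    then show ?thesis unfolding e using \<sigma> \<mu> by (simp add: ln_div)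
  qed
  finally show ?thesis .
qed

text \<open>Powers of the logarithm are dominated by \<open>H powr (- (1 / 2))\<close>, which is
  integrable on polar balls. The bound must serve all Moser functions at once. At the origin
  \<open>ln (2 / H x)\<close> is only a default value, so that point is excluded.\<close>

lemma log_power_integral:
  assumes q: "q \<ge> 1"
  shows "\<exists>A\<ge>0. \<forall>u. (\<forall>x. x \<noteq> 0 \<longrightarrow> \<bar>u x\<bar> \<le> max 0 (ln (2 / H x))) \<longrightarrow>
    (\<integral>\<^sup>+x. ennreal (\<bar>u x\<bar> powr q) \<partial>lborel) \<le> ennreal A"
proof -
  define K where "K = ((q + 1) / (1 / 2)) powr q * 2 powr (1 / 2)"
  define A where "A = K * (N * \<kappa> * 2 powr (N + - (1 / 2)) / (N + - (1 / 2)))"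
  have K: "K \<ge> 0" by (simp add: K_def)
  show ?thesis
  proof (intro exI[of _ A] conjI allI impI)
    show "A \<ge> 0" using K N_ge_2 kappa_pos by (simp add: A_def)
    fix u :: "real^'n \<Rightarrow> real" assume u: "\<forall>x. x \<noteq> 0 \<longrightarrow> \<bar>u x\<bar> \<le> max 0 (ln (2 / H x))"
    have "(\<integral>\<^sup>+x. ennreal (\<bar>u x\<bar> powr q) \<partial>lborel) \<le>
        (\<integral>\<^sup>+x. ennreal K * (ennreal (H x powr (- (1 / 2))) * indicator {x. H x \<le> 2} x) \<partial>lborel)"
    proof (rule nn_integral_mono_AE, use AE_lborel_singleton[of 0] in eventually_elim)
      fix x :: "real^'n" assume "x \<noteq> 0"
      then have Hx: "H x > 0" by (rule polar_pos)
      show "ennreal (\<bar>u x\<bar> powr q) \<le> ennreal K * (ennreal (H x powr (- (1 / 2))) * indicator {x. H x \<le> 2} x)"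
      proof (cases "ln (2 / H x) > 0")
        case True
        then have "H x \<le> 2" using Hx by simp
        have "\<bar>u x\<bar> \<le> ln (2 / H x)" using u[rule_format, OF \<open>x \<noteq> 0\<close>] True by simp
        then have "\<bar>u x\<bar> powr q \<le> ln (2 / H x) powr q" using q by (intro powr_mono2) auto
        also have "\<dots> \<le> ((q + 1) / (1 / 2)) powr q * exp (1 / 2 * ln (2 / H x))"
          using True q by (intro powr_le_exp) auto
        also have "exp (1 / 2 * ln (2 / H x)) = (2 / H x) powr (1 / 2)"
          using Hx by (simp add: powr_def)
        also have "(2 / H x) powr (1 / 2) = 2 powr (1 / 2) * H x powr (- (1 / 2))"
          using Hx by (simp add: powr_divide powr_minus_divide)
        also have "((q + 1) / (1 / 2)) powr q * (2 powr (1 / 2) * H x powr (- (1 / 2))) = K * H x powr (- (1 / 2))"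
          unfolding K_def by (rule mult.assoc[symmetric])
        finally show ?thesis
          using \<open>H x \<le> 2\<close> K by (simp add: ennreal_mult'[symmetric] ennreal_leI)
      next
        case False
        then have "u x = 0" using u[rule_format, OF \<open>x \<noteq> 0\<close>] by auto
        then show ?thesis by simp
      qed
    qed
    also have "\<dots> = ennreal K * (\<integral>\<^sup>+x. ennreal (H x powr (- (1 / 2))) * indicator {x. H x \<le> 2} x \<partial>lborel)"
      by (rule nn_integral_cmult) measurable
    also have "(\<integral>\<^sup>+x. ennreal (H x powr (- (1 / 2))) * indicator {x. H x \<le> 2} x \<partial>lborel) =
        ennreal (N * \<kappa> * 2 powr (N + - (1 / 2)) / (N + - (1 / 2)))"
      using N_ge_2 by (intro nn_integral_polar_powr) auto
    also have "ennreal K * \<dots> = ennreal A"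
      unfolding A_def using K by (rule ennreal_mult'[symmetric])
    finally show "(\<integral>\<^sup>+x. ennreal (\<bar>u x\<bar> powr q) \<partial>lborel) \<le> ennreal A" .
  qed
qed

section \<open>Normalised Moser functions\<close>

lemma test_function_scale:
  assumes "test_function u"
  shows "test_function (\<lambda>x. c * u x)" "grad (\<lambda>x. c * u x) x = c *\<^sub>R grad u x"
proof -
  have "{x. c * u x \<noteq> 0} \<subseteq> {x. u x \<noteq> 0}" by auto
  then have "compact (closure {x. c * u x \<noteq> 0})"
    using assms unfolding test_function_def
    by (meson bounded_subset closure_mono closure_subset compact_closure compact_imp_bounded)
  then show "test_function (\<lambda>x. c * u x)"
    using assms by (auto simp: test_function_def intro!: C_on_mult C_on_const)
  have "u differentiable (at x)"
    using test_function_C_on[OF assms, of 1] by simp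
  then have "((\<lambda>x. c * u x) has_derivative (\<lambda>v. (c *\<^sub>R grad u x) \<bullet> v)) (at x)"
    by (auto intro!: derivative_eq_intros has_derivative_grad)
  then show "grad (\<lambda>x. c * u x) x = c *\<^sub>R grad u x"
    by (rule grad_eqI)
qed

lemma Lp_norm_le:
  assumes "in_Lp s f" "s > 0" "B \<ge> 0" "(\<integral>\<^sup>+x. ennreal (norm (f x) powr s) \<partial>lebesgue) \<le> ennreal (B powr s)"
  shows "Lp_norm s f \<le> B"
proof -
  have "Lp_norm s f powr s \<le> B powr s"
    using assms nn_integral_in_Lp[OF assms(1,2)] by simp
  then show ?thesis
    using powr_less_mono2[of s B "Lp_norm s f"] assms by (auto simp: not_le[symmetric])
qed

text \<open>The \<open>N\<close>-th root of the energy bound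
  \<open>N * \<kappa> * \<sigma> powr (- N) * L\<close> for
  \<open>\<sigma> powr (- N) = (L + 1) / L\<close>; division by it makes the energy at most
  1.\<close>

definition moser_scale :: "real \<Rightarrow> real" where
  "moser_scale L = (N * \<kappa> * (L + 1)) powr (1 / N)"

lemma moser_function:
  assumes q: "q \<ge> 1"
  shows "\<exists>A. \<forall>L\<ge>7. \<exists>v. DNq_gradient q v (grad v) \<and> Lp_norm N (\<lambda>x. F (grad v x)) \<le> 1 \<and>
    Lp_norm q v \<le> A \<and> (\<forall>x. H x \<le> exp (- L) \<longrightarrow> (L - 3) / moser_scale L \<le> v x)"
proof -
  obtain A where A: "A \<ge> 0" "\<And>u. (\<And>x. x \<noteq> 0 \<Longrightarrow> \<bar>u x\<bar> \<le> max 0 (ln (2 / H x))) \<Longrightarrow>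
      (\<integral>\<^sup>+x. ennreal (\<bar>u x\<bar> powr q) \<partial>lborel) \<le> ennreal A"
    using log_power_integral[OF q] by blast
  define D0 where "D0 = (N * \<kappa>) powr (1 / N)"
  have D0: "D0 > 0" using N_ge_2 kappa_pos by (simp add: D0_def)
  show ?thesis
  proof (intro exI[of _ "A powr (1 / q) / D0"] allI impI)
    fix L :: real assume L: "L \<ge> 7"
    define D where "D = moser_scale L"
    have Lpos: "N * \<kappa> * (L + 1) > 0" using L N_ge_2 kappa_pos by simp
    then have D: "D > 0" "D powr N = N * \<kappa> * (L + 1)"
      using N_ge_2 by (auto simp: D_def moser_scale_def powr_powr)
    have "D0 \<le> D"
      unfolding D_def D0_def moser_scale_def using N_ge_2 kappa_pos L by (intro powr_mono2) auto
    \<comment> \<open>The approximation of \<open>H\<close> improves with \<open>L\<close> at just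
      the rate that raises the energy from \<open>L\<close> to \<open>L + 1\<close>. A fixed
      \<open>\<sigma> < 1\<close> would cost a factor in the exponent and miss
      \<open>lambda_crit\<close>.\<close>
    define \<sigma> where "\<sigma> = (L / (L + 1)) powr (1 / N)"
    have \<sigma>: "0 < \<sigma>" "\<sigma> < 1" "\<sigma> powr (- N) = (L + 1) / L"
      using L N_ge_2 by (auto simp: \<sigma>_def powr_powr powr01_less_one powr_minus_divide)
    \<comment> \<open>A lower bound independent of \<open>L\<close>; the 2 in
      \<open>ln (2 / H x)\<close> is its reciprocal.\<close>
    have "1 / 2 \<le> \<sigma>"
    proof -
      have "(1 / 2 :: real) powr 1 \<le> (1 / 2) powr (1 / N)" using N_ge_2 by (intro powr_mono') auto
      also have "\<dots> \<le> \<sigma>" unfolding \<sigma>_def using L N_ge_2 by (intro powr_mono2) (auto simp: field_simps)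
      finally show ?thesis by simp
    qed
    define \<mu> where "\<mu> = exp (- L)"
    have \<mu>: "0 < \<mu>" "\<mu> < 1" "ln (1 / \<mu>) = L" using L by (auto simp: \<mu>_def ln_div)
    obtain u where u: "test_function u" "\<And>x. 0 \<le> u x" "\<And>x. u x \<le> max 0 (- ln (\<sigma> * H x + \<mu>))"
      "\<And>x. - ln (H x + 2 * \<mu>) - 1 \<le> u x"
      "\<And>x. F (grad u x) \<le> (if \<sigma> * H x + \<mu> < 1 then 1 / (\<sigma> * H x + \<mu>) else 0)"
      using log_profile[OF \<sigma>(1,2) \<mu>(1)] by blast
    define v where "v x = (1 / D) * u x" for x
    have v1: "test_function v"
      unfolding v_def[abs_def] by (rule test_function_scale[OF u(1)])
    have v2: "grad v x = (1 / D) *\<^sub>R grad u x" for x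
      unfolding v_def[abs_def] by (rule test_function_scale[OF u(1)])
    have "DNq_gradient q v (grad v)"
      using v1 q by (intro test_function_DNq) auto
    moreover have "Lp_norm N (\<lambda>x. F (grad v x)) \<le> 1"
    proof (rule Lp_norm_le)
      show "in_Lp N (\<lambda>x. F (grad v x))"
        using v1 N_ge_2 by (intro F_comp_in_Lp test_function_in_Lp) auto
      have m: "grad v \<in> borel_measurable borel"
        by (intro borel_measurable_continuous_onI C1_continuous_grad test_function_C_on v1)
      have "(\<integral>\<^sup>+x. ennreal (norm (F (grad v x)) powr N) \<partial>lebesgue) = (\<integral>\<^sup>+x. ennreal (norm (F (grad v x)) powr N) \<partial>lborel)"
        by (rule nn_integral_completion)
      also have "\<dots> \<le> (\<integral>\<^sup>+x. ennreal (1 / D powr N) * ennreal ((if \<sigma> * H x + \<mu> < 1 then 1 / (\<sigma> * H x + \<mu>) else 0) powr N) \<partial>lborel)"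
      proof (intro nn_integral_mono)
        fix x
        have "norm (F (grad v x)) powr N = 1 / D powr N * F (grad u x) powr N"
          using D F_nonneg by (simp add: v2 F_scale powr_divide)
        also have "\<dots> \<le> 1 / D powr N * (if \<sigma> * H x + \<mu> < 1 then 1 / (\<sigma> * H x + \<mu>) else 0) powr N"
          using N_ge_2 F_nonneg by (intro mult_left_mono powr_mono2 u(5)) auto
        finally show "ennreal (norm (F (grad v x)) powr N) \<le>
            ennreal (1 / D powr N) * ennreal ((if \<sigma> * H x + \<mu> < 1 then 1 / (\<sigma> * H x + \<mu>) else 0) powr N)"
          by (simp add: ennreal_mult'[symmetric] ennreal_leI)
      qed
      also have "\<dots> = ennreal (1 / D powr N) * (\<integral>\<^sup>+x. ennreal ((if \<sigma> * H x + \<mu> < 1 then 1 / (\<sigma> * H x + \<mu>) else 0) powr N) \<partial>lborel)"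
        by (rule nn_integral_cmult) measurable
      also have "\<dots> \<le> ennreal (1 / D powr N) * ennreal (N * \<kappa> * \<sigma> powr (- N) * ln (1 / \<mu>))"
        using \<sigma> \<mu> by (intro mult_left_mono profile_energy) auto
      also have "\<dots> = ennreal (1 powr N)"
      proof -
        have "1 / D powr N * (N * \<kappa> * \<sigma> powr (- N) * ln (1 / \<mu>)) = 1 powr N"
          unfolding D(2) \<sigma>(3) \<mu>(3) using L N_ge_2 kappa_pos by simp
        then show ?thesis
          by (metis ennreal_mult' powr_ge_zero zero_le_divide_1_iff)
      qed
      finally show "(\<integral>\<^sup>+x. ennreal (norm (F (grad v x)) powr N) \<partial>lebesgue) \<le> ennreal (1 powr N)" .
    qed (use N_ge_2 in auto)
    moreover have "Lp_norm q v \<le> A powr (1 / q) / D0"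
    proof (rule Lp_norm_le)
      show "in_Lp q v" using v1 q by (intro test_function_in_Lp) auto
      have ub: "\<bar>u x\<bar> \<le> max 0 (ln (2 / H x))" if "x \<noteq> 0" for x
      proof -
        have Hx: "H x > 0" using that by (rule polar_pos)
        have "1 / 2 * H x \<le> \<sigma> * H x" using \<open>1 / 2 \<le> \<sigma>\<close> Hx by (intro mult_right_mono) auto
        then have "H x / 2 \<le> \<sigma> * H x + \<mu>" using \<mu> by simp
        then have "ln (H x / 2) \<le> ln (\<sigma> * H x + \<mu>)" using Hx by simp
        moreover have "ln (H x / 2) = - ln (2 / H x)" using Hx by (simp add: ln_div)
        ultimately show ?thesis using u(2)[of x] u(3)[of x] by auto
      qed
      have "(\<integral>\<^sup>+x. ennreal (norm (v x) powr q) \<partial>lebesgue) = (\<integral>\<^sup>+x. ennreal (norm (v x) powr q) \<partial>lborel)"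
        by (rule nn_integral_completion)
      also have "\<dots> \<le> (\<integral>\<^sup>+x. ennreal (1 / D0 powr q) * ennreal (\<bar>u x\<bar> powr q) \<partial>lborel)"
      proof (intro nn_integral_mono)
        fix x
        have "norm (v x) \<le> \<bar>u x\<bar> / D0"
          using D D0 \<open>D0 \<le> D\<close> by (simp add: v_def abs_mult divide_left_mono)
        then have "norm (v x) powr q \<le> (\<bar>u x\<bar> / D0) powr q"
          using q by (intro powr_mono2) auto
        then show "ennreal (norm (v x) powr q) \<le> ennreal (1 / D0 powr q) * ennreal (\<bar>u x\<bar> powr q)"
          using D0 by (simp add: ennreal_mult'[symmetric] ennreal_leI powr_divide)
      qed
      also have "\<dots> = ennreal (1 / D0 powr q) * (\<integral>\<^sup>+x. ennreal (\<bar>u x\<bar> powr q) \<partial>lborel)"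
      proof -
        have "u \<in> borel_measurable borel"
          using test_function_C_on[OF u(1), of 0] by (intro borel_measurable_continuous_onI) simp
        then show ?thesis by (intro nn_integral_cmult) measurable
      qed
      also have "\<dots> \<le> ennreal (1 / D0 powr q) * ennreal A"
        by (intro mult_left_mono A(2) ub) auto
      also have "\<dots> = ennreal ((A powr (1 / q) / D0) powr q)"
        using A(1) D0 q by (simp add: ennreal_mult'[symmetric] powr_divide powr_powr)
      finally show "(\<integral>\<^sup>+x. ennreal (norm (v x) powr q) \<partial>lebesgue) \<le> ennreal ((A powr (1 / q) / D0) powr q)" .
    qed (use q D0 in auto)
    moreover have "(L - 3) / moser_scale L \<le> v x" if "H x \<le> exp (- L)" for x
    proof -
      \<comment> \<open>On this ball \<open>H x \<le> \<mu>\<close>. The estimate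
        \<open>ln 3 \<le> 2\<close> and the 1 lost by \<open>soft_pos\<close> make up the 3 in
        \<open>L - 3\<close>.\<close>
      have "ln (H x + 2 * \<mu>) \<le> ln (3 * \<mu>)"
        using that \<mu> polar_nonneg[of x] by (subst ln_le_cancel_iff) (auto simp: \<mu>_def[symmetric] add_nonneg_pos)
      also have "\<dots> = ln 3 - L" using \<mu> by (simp add: ln_mult ln_div)
      finally have "L - 1 - ln 3 \<le> u x" using u(4)[of x] by simp
      moreover have "ln (3 :: real) \<le> 3 - 1" by (rule ln_le_minus_one) simp
      ultimately have "L - 3 \<le> u x" by simp
      then show ?thesis using D by (simp add: v_def D_def[symmetric] divide_right_mono)
    qed
    ultimately show "\<exists>v. DNq_gradient q v (grad v) \<and> Lp_norm N (\<lambda>x. F (grad v x)) \<le> 1 \<and>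
      Lp_norm q v \<le> A powr (1 / q) / D0 \<and> (\<forall>x. H x \<le> exp (- L) \<longrightarrow> (L - 3) / moser_scale L \<le> v x)"
      by blast
  qed
qed

text \<open>At height \<open>y = (L - 3) / moser_scale L\<close> the quantity
  \<open>lambda_crit F * y powr (N / (N - 1))\<close> is \<open>N * L\<close> up to a bounded error,
  matching a ball of volume \<open>\<kappa> * exp (- N * L)\<close>. What is left is
  \<open>y powr p\<close>, which is unbounded in \<open>L\<close>.\<close>

lemma supercritical_failure:
  assumes \<beta>: "0 \<le> \<beta>" "\<beta> < N" and q: "q \<ge> 1" and p: "p > 0" and lam: "lam \<ge> lambda_crit F"
  shows "\<not> (\<exists>C. \<forall>u g. DNq_gradient q u g \<and> Lp_norm N (\<lambda>x. F (g x)) \<le> 1 \<longrightarrow>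
    tm_integral F \<beta> p lam u \<le> ennreal (C * Lp_norm q u powr (q * (1 - \<beta> / N))))"
proof
  assume "\<exists>C. \<forall>u g. DNq_gradient q u g \<and> Lp_norm N (\<lambda>x. F (g x)) \<le> 1 \<longrightarrow>
    tm_integral F \<beta> p lam u \<le> ennreal (C * Lp_norm q u powr (q * (1 - \<beta> / N)))"
  then obtain C where C: "\<And>u g. DNq_gradient q u g \<Longrightarrow> Lp_norm N (\<lambda>x. F (g x)) \<le> 1 \<Longrightarrow>
    tm_integral F \<beta> p lam u \<le> ennreal (C * Lp_norm q u powr (q * (1 - \<beta> / N)))" by blast
  obtain A where A: "\<And>L. L \<ge> 7 \<Longrightarrow> \<exists>v. DNq_gradient q v (grad v) \<and> Lp_norm N (\<lambda>x. F (grad v x)) \<le> 1 \<and>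
    Lp_norm q v \<le> A \<and> (\<forall>x. H x \<le> exp (- L) \<longrightarrow> (L - 3) / moser_scale L \<le> v x)"
    using moser_function[OF q] by blast
  define \<theta> where "\<theta> = 1 - \<beta> / N"
  have \<theta>: "\<theta> > 0" "N * \<theta> = N - \<beta>" using \<beta> by (auto simp: \<theta>_def field_simps)
  \<comment> \<open>The sign of \<open>C\<close> is unrestricted, hence the absolute value.\<close>
  define B where "B = \<bar>C\<bar> * A powr (q * \<theta>)"
  \<comment> \<open>What remains of volume, weight and exponential once the powers of
    \<open>exp L\<close> cancel.\<close>
  define c where "c = \<kappa> * exp (- 7 * (N - \<beta>))"
  have c: "c > 0" using kappa_pos by (simp add: c_def)
  have bound: "c * ((L - 3) / moser_scale L) powr p \<le> B" if L: "L \<ge> 7" for L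
  proof -
    obtain v where v: "DNq_gradient q v (grad v)" "Lp_norm N (\<lambda>x. F (grad v x)) \<le> 1" "Lp_norm q v \<le> A"
      "\<And>x. H x \<le> exp (- L) \<Longrightarrow> (L - 3) / moser_scale L \<le> v x"
      using A[OF L] by blast
    define y where "y = (L - 3) / moser_scale L"
    have Lpos: "N * \<kappa> * (L + 1) > 0" using L N_ge_2 kappa_pos by simp
    then have D: "moser_scale L > 0"
      unfolding moser_scale_def by (metis less_irrefl powr_gt_zero)
    have y: "y > 0" using L D by (simp add: y_def)
    have expo: "(N - \<beta>) * (L - 7) \<le> lam * \<theta> * y powr (N / (N - 1))"
    proof -
      have NN: "N / (N - 1) = 1 + 1 / (N - 1)" using N_ge_2 by (simp add: field_simps)
      have a: "0 \<le> N / (N - 1)" "N / (N - 1) \<le> 2" using N_ge_2 by (auto simp: field_simps)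
      define z where "z = (L - 3) / (L + 1)"
      have z: "0 < z" "z \<le> 1" using L by (auto simp: z_def)
      have "moser_scale L powr (N / (N - 1)) = (N * \<kappa> * (L + 1)) powr (1 / (N - 1))"
        using Lpos N_ge_2 by (simp add: moser_scale_def powr_powr)
      also have "\<dots> = (N * \<kappa>) powr (1 / (N - 1)) * (L + 1) powr (1 / (N - 1))"
        using L N_ge_2 kappa_pos by (simp add: powr_mult)
      finally have D': "moser_scale L powr (N / (N - 1)) = (N * \<kappa>) powr (1 / (N - 1)) * (L + 1) powr (1 / (N - 1))" .
      have lc: "lambda_crit F = N * (N * \<kappa>) powr (1 / (N - 1))"
        using N_ge_2 kappa_pos unfolding lambda_crit_eq NN by (simp add: powr_mult powr_add)
      have "(L - 3) powr (N / (N - 1)) = z powr (N / (N - 1)) * (L + 1) powr (N / (N - 1))"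
        using z L by (simp add: powr_mult[symmetric] z_def)
      also have "(L + 1) powr (N / (N - 1)) = (L + 1) * (L + 1) powr (1 / (N - 1))"
        unfolding NN using L by (simp add: powr_add)
      finally have "lambda_crit F * y powr (N / (N - 1)) = N * (z powr (N / (N - 1)) * (L + 1))"
        using L D N_ge_2 kappa_pos unfolding y_def by (subst powr_divide) (auto simp: D' lc)
      moreover have "z powr (N / (N - 1)) * (L + 1) \<ge> L - 7"
      proof -
        \<comment> \<open>As \<open>N \<ge> 2\<close>, the exponent is at most 2, and
          \<open>z\<^sup>2\<close> falls short of 1 by at most \<open>8 / (L + 1)\<close>;
          multiplication by \<open>L + 1\<close> gives \<open>L - 7\<close>.\<close>
        have "z powr 2 \<le> z powr (N / (N - 1))" using z a by (intro powr_mono') auto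
        moreover have "z powr 2 = z\<^sup>2" using z by simp
        moreover have "z = 1 - 4 / (L + 1)" using L by (simp add: z_def field_simps)
        moreover have "(1 - 4 / (L + 1))\<^sup>2 \<ge> 1 - 8 / (L + 1)" by (simp add: power2_diff)
        ultimately have "(1 - 8 / (L + 1)) * (L + 1) \<le> z powr (N / (N - 1)) * (L + 1)"
          using L by (intro mult_right_mono) auto
        moreover have "(1 - 8 / (L + 1)) * (L + 1) = L - 7" using L by (simp add: field_simps)
        ultimately show ?thesis by simp
      qed
      ultimately have "N * (L - 7) \<le> lambda_crit F * y powr (N / (N - 1))"
        using N_ge_2 by simp
      also have "\<dots> \<le> lam * y powr (N / (N - 1))"
        using lam by (intro mult_right_mono) auto
      finally have "\<theta> * (N * (L - 7)) \<le> \<theta> * (lam * y powr (N / (N - 1)))"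
        using \<theta> by simp
      then show ?thesis using \<theta>(2) by (metis mult.assoc mult.commute)
    qed
    have lam0: "lam \<ge> 0" using lam lambda_crit_pos by simp
    let ?\<mu> = "exp (- L)"
    have "ennreal (c * y powr p) = ennreal (exp ((N - \<beta>) * (L - 7)) * y powr p * ?\<mu> powr (- \<beta>)) * emeasure lborel {x. H x \<le> ?\<mu>}"
    proof -
      have "exp ((N - \<beta>) * (L - 7)) * ?\<mu> powr (- \<beta>) * ?\<mu> powr N = exp (- 7 * (N - \<beta>))"
        by (simp add: exp_powr_real exp_add[symmetric] algebra_simps)
      then have eq: "c * y powr p = exp ((N - \<beta>) * (L - 7)) * y powr p * ?\<mu> powr (- \<beta>) * (\<kappa> * ?\<mu> powr N)"
        by (simp add: c_def mult_ac)
      have e: "emeasure lborel {x. H x \<le> ?\<mu>} = ennreal (\<kappa> * ?\<mu> powr N)"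
        by (rule polar_ball_emeasure) simp
      show ?thesis
        unfolding e eq by (rule ennreal_mult') simp
    qed
    also have "\<dots> = (\<integral>\<^sup>+x. ennreal (exp ((N - \<beta>) * (L - 7)) * y powr p * ?\<mu> powr (- \<beta>)) * indicator {x. H x \<le> ?\<mu>} x \<partial>lborel)"
      by (subst nn_integral_cmult_indicator) auto
    also have "\<dots> \<le> (\<integral>\<^sup>+x. ennreal (exp (lam * (1 - \<beta> / N) * \<bar>v x\<bar> powr (N / (N - 1))) * \<bar>v x\<bar> powr p * H x powr (- \<beta>)) \<partial>lborel)"
    proof (rule nn_integral_mono_AE, use AE_lborel_singleton[of 0] in eventually_elim)
      fix x :: "real^'n" assume "x \<noteq> 0"
      then have Hx: "H x > 0" by (rule polar_pos)
      have "exp ((N - \<beta>) * (L - 7)) * y powr p * ?\<mu> powr (- \<beta>) \<le>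
          exp (lam * (1 - \<beta> / N) * \<bar>v x\<bar> powr (N / (N - 1))) * \<bar>v x\<bar> powr p * H x powr (- \<beta>)" if "H x \<le> ?\<mu>"
      proof -
        have yv: "y \<le> \<bar>v x\<bar>" using v(4)[OF that] by (simp add: y_def)
        have "(N - \<beta>) * (L - 7) \<le> lam * \<theta> * \<bar>v x\<bar> powr (N / (N - 1))"
          using expo yv y lam0 \<theta> N_ge_2 by (elim order_trans) (intro mult_left_mono powr_mono2, auto)
        moreover have "y powr p \<le> \<bar>v x\<bar> powr p" using yv y p by (intro powr_mono2) auto
        moreover have "?\<mu> powr (- \<beta>) \<le> H x powr (- \<beta>)" using that Hx \<beta> by (intro powr_mono2') auto
        ultimately show ?thesis by (intro mult_mono) (auto simp: \<theta>_def)
      qed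
      then show "ennreal (exp ((N - \<beta>) * (L - 7)) * y powr p * ?\<mu> powr (- \<beta>)) * indicator {x. H x \<le> ?\<mu>} x \<le>
          ennreal (exp (lam * (1 - \<beta> / N) * \<bar>v x\<bar> powr (N / (N - 1))) * \<bar>v x\<bar> powr p * H x powr (- \<beta>))"
        by (auto simp: indicator_def intro!: ennreal_leI)
    qed
    also have "\<dots> = tm_integral F \<beta> p lam v"
      by (simp add: tm_integral_eq nn_integral_completion)
    also have "\<dots> \<le> ennreal (C * Lp_norm q v powr (q * (1 - \<beta> / N)))"
      by (rule C[OF v(1,2)])
    also have "\<dots> \<le> ennreal B"
    proof (intro ennreal_leI)
      have "Lp_norm q v powr (q * \<theta>) \<le> A powr (q * \<theta>)"
        using v(3) q \<theta> by (intro powr_mono2) (auto simp: Lp_norm_def)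
      then have "\<bar>C\<bar> * Lp_norm q v powr (q * \<theta>) \<le> B"
        unfolding B_def by (intro mult_left_mono) auto
      moreover have "C * Lp_norm q v powr (q * \<theta>) \<le> \<bar>C\<bar> * Lp_norm q v powr (q * \<theta>)"
        by (intro mult_right_mono) auto
      ultimately show "C * Lp_norm q v powr (q * (1 - \<beta> / N)) \<le> B" by (simp add: \<theta>_def)
    qed
    finally show ?thesis
      by (simp add: y_def B_def)
  qed
  have B0: "B \<ge> 0" by (simp add: B_def)
  define D0 where "D0 = (N * \<kappa>) powr (1 / N)"
  have D0: "D0 > 0" using N_ge_2 kappa_pos by (simp add: D0_def)
  \<comment> \<open>A height at which the bound just proved would read
    \<open>B + 1 \<le> B\<close>.\<close>
  define Y where "Y = ((B + 1) / c) powr (1 / p)"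
  have Y: "Y > 0" "c * Y powr p = B + 1" using B0 c p by (auto simp: Y_def powr_powr)
  \<comment> \<open>Since \<open>N \<ge> 2\<close>, \<open>moser_scale L\<close> is at most
    \<open>D0 * sqrt (L + 1)\<close>; the square makes \<open>sqrt (L + 1) \<ge> 2 * D0 * Y\<close>,
    and the 7 yields \<open>L + 1 \<le> 2 * (L - 3)\<close>.\<close>
  define L where "L = (2 * D0 * Y)\<^sup>2 + 7"
  have L: "L \<ge> 7" by (simp add: L_def)
  have "Y \<le> (L - 3) / moser_scale L"
  proof -
    have "moser_scale L = D0 * (L + 1) powr (1 / N)"
      using N_ge_2 kappa_pos L by (simp add: moser_scale_def D0_def powr_mult)
    also have "\<dots> \<le> D0 * (L + 1) powr (1 / 2)"
      using N_ge_2 L D0 by (intro mult_left_mono powr_mono) (auto simp: field_simps)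
    also have "\<dots> = D0 * sqrt (L + 1)" using L by (simp add: powr_half_sqrt)
    finally have 1: "moser_scale L \<le> D0 * sqrt (L + 1)" .
    have "2 * D0 * Y \<le> sqrt (L + 1)" by (intro real_le_rsqrt) (simp add: L_def)
    then have "2 * D0 * Y * sqrt (L + 1) \<le> sqrt (L + 1) * sqrt (L + 1)" using L by (intro mult_right_mono) auto
    also have "\<dots> = L + 1" using L by simp
    also have "\<dots> \<le> 2 * (L - 3)" using L by simp
    finally have "Y * (D0 * sqrt (L + 1)) \<le> L - 3" by (simp add: mult_ac)
    moreover have "Y * moser_scale L \<le> Y * (D0 * sqrt (L + 1))" using 1 Y by simp
    moreover have "moser_scale L > 0" using L N_ge_2 kappa_pos by (simp add: moser_scale_def)
    ultimately show ?thesis by (simp add: field_simps)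
  qed
  then have "c * Y powr p \<le> c * ((L - 3) / moser_scale L) powr p"
    using Y p c by (intro mult_left_mono powr_mono2) auto
  then show False using bound[OF L] Y by simp
qed

end

theorem theorem1p1:
  fixes F :: "real^'n \<Rightarrow> real" and p q \<beta> lam :: real
  assumes "CARD('n) \<ge> 2"
    and "0 \<le> \<beta>" and "\<beta> < real CARD('n)"
    and "q \<ge> 1"
    and "finsler_function F"
    and "p > q * (1 - \<beta> / real CARD('n)) \<or> (\<beta> = 0 \<and> p \<ge> q)"
  shows "(0 \<le> lam \<and> lam < lambda_crit F \<longrightarrow>
      (\<exists>C>0. \<forall>u \<in> DNq q. \<forall>g. DNq_gradient q u g \<and> Lp_norm (real CARD('n)) (\<lambda>x. F (g x)) \<le> 1 \<longrightarrow>
        tm_integral F \<beta> p lam u \<le> ennreal (C * Lp_norm q u powr (q * (1 - \<beta> / real CARD('n))))))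
    \<and> (lam \<ge> lambda_crit F \<longrightarrow>
      \<not> (\<exists>C. \<forall>u \<in> DNq q. \<forall>g. DNq_gradient q u g \<and> Lp_norm (real CARD('n)) (\<lambda>x. F (g x)) \<le> 1 \<longrightarrow>
        tm_integral F \<beta> p lam u \<le> ennreal (C * Lp_norm q u powr (q * (1 - \<beta> / real CARD('n))))))"
proof -
  interpret finsler_norm F "real CARD('n)"
    using assms by unfold_locales auto
  have pos: "q * (1 - \<beta> / real CARD('n)) > 0"
    using assms by (intro mult_pos_pos) auto
  \<comment> \<open>Positivity is what lets \<open>y powr p\<close> tend to infinity in the failure
    part.\<close>
  have p: "p > 0"
    using assms(6)
  proof
    assume "p > q * (1 - \<beta> / real CARD('n))"
    then show ?thesis using pos by (rule less_trans[rotated])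
  qed (use assms(4) in auto)
  have pq: "p > q * (1 - \<beta> / real CARD('n)) \<or> \<beta> = 0 \<and> p \<ge> q"
    using assms by blast
  show ?thesis
  proof (intro conjI impI)
    assume "0 \<le> lam \<and> lam < lambda_crit F"
    then show "\<exists>C>0. \<forall>u \<in> DNq q. \<forall>g. DNq_gradient q u g \<and> Lp_norm (real CARD('n)) (\<lambda>x. F (g x)) \<le> 1 \<longrightarrow>
        tm_integral F \<beta> p lam u \<le> ennreal (C * Lp_norm q u powr (q * (1 - \<beta> / real CARD('n))))"
      using subcritical_inequality[OF assms(2,3,4) pq] by blast
  next
    assume "lam \<ge> lambda_crit F"
    then have "\<not> (\<exists>C. \<forall>u g. DNq_gradient q u g \<and> Lp_norm (real CARD('n)) (\<lambda>x. F (g x)) \<le> 1 \<longrightarrow>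
        tm_integral F \<beta> p lam u \<le> ennreal (C * Lp_norm q u powr (q * (1 - \<beta> / real CARD('n)))))"
      by (rule supercritical_failure[OF assms(2,3,4) p])
    moreover have "u \<in> DNq q" if "DNq_gradient q u g" for u g
      using that by (auto simp: DNq_def)
    ultimately show "\<not> (\<exists>C. \<forall>u \<in> DNq q. \<forall>g. DNq_gradient q u g \<and> Lp_norm (real CARD('n)) (\<lambda>x. F (g x)) \<le> 1 \<longrightarrow>
        tm_integral F \<beta> p lam u \<le> ennreal (C * Lp_norm q u powr (q * (1 - \<beta> / real CARD('n)))))"
      by metis
  qed
qed

end
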